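(* Let $A \mid B$ be a Frobenius extension of rings. Then there exist a ring $R$, a right $R$-bialgebroid $T$ that is finitely generated projective as a left $R$-module, and a right $T$-comodule algebra structure on $A$ for which $A \mid B$ is a (right) $T$-Galois extension, if and only if $A \mid B$ is depth two (D2) and the right module $A_B$ is balanced.
   Context: All rings are associative and unital, not necessarily commutative; ring homomorphisms preserve $1$. A ring extension $A \mid B$ means a ring $A$ with a subring $B \subseteq A$ sharing the same $1$. Frobenius extension: $A \mid B$ is a Frobenius extension if $A_B$ is finitely generated projective and $A \cong \mathrm{Hom}(A_B, B_B)$ as $B$-$A$-bimodules. Depth two: $A \mid B$ is depth two (D2) if the tensor-square $A \otimes_B A$ is isomorphic, both as a natural $B$-$A$-bimodule (left D2) and as a natural $A$-$B$-bimodule (right D2), to a direct summand of a finite direct sum of copies of $A$. Balanced: let $\mathcal{E} = \mathrm{End}(A_B)$ be the ring of right $B$-module endomorphisms of $A$, acting on $A$ from the left. The module $A_B$ is balanced if every endomorphism of the left $\mathcal{E}$-module $A$ is of the form $x \mapsto xb$ for some $b \in B$. Right bialgebroid: a right $R$-bialgebroid $T$ consists of rings $R$ and $T$, a ring homomorphism $\tilde{s}: R \to T$ and a ring anti-homomorphism $\tilde{t}: R \to T$ with $\tilde{s}(r)\tilde{t}(r') = \tilde{t}(r')\tilde{s}(r)$ for all $r, r' \in R$, and maps $\Delta: T \to T \otimes_R T$, $\varepsilon: T \to R$ such that $(T, \Delta, \varepsilon)$ is an $R$-coring (i.e. $\Delta$ and $\varepsilon$ are $R$-$R$-bimodule maps,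 coassociative and counital) with respect to the $R$-$R$-bimodule structure $r \cdot x \cdot r' = x\tilde{t}(r)\tilde{s}(r')$ on $T$, and for all $x, y \in T$, $r \in R$: (i) $(\tilde{s}(r) \otimes 1)\Delta(x) = (1 \otimes \tilde{t}(r))\Delta(x)$; (ii) $\Delta(xy) = \Delta(x)\Delta(y)$ (componentwise product, well defined because of (i)) and $\Delta(1) = 1 \otimes 1$; (iii) $\varepsilon(1_T) = 1_R$ and $\varepsilon(xy) = \varepsilon(\tilde{s}(\varepsilon(x))y) = \varepsilon(\tilde{t}(\varepsilon(x))y)$. The left $R$-module structure on $T$ is $r \cdot x = x\tilde{t}(r)$; "left finite projective" means that ${}_RT$ is finitely generated projective for this structure. Comodule algebra: a (right) $T$-comodule algebra is a ring $A$ with a ring homomorphism $R \to A$ (making $A$ an $R$-$R$-bimodule) together with a coaction $\delta: A \to A \otimes_R T$, written $\delta(a) = a_{(0)} \otimes a_{(1)}$, such that $A$ is a right comodule over the $R$-coring $T$ ($\delta$ is right $R$-linear, coassociative and counital), $\delta(1_A) = 1_A \otimes 1_T$, $ra_{(0)} \otimes a_{(1)} = a_{(0)} \otimes \tilde{t}(r)a_{(1)}$ for all $r \in R$, $a \in A$, and $\delta(aa') = \delta(a)\delta(a')$ for all $a, a' \in A$ (componentwise product, well defined by the preceding condition). Its subring of coinvariants is $A^{\mathrm{co}\,T} = \{a \in A \mid \delta(a) = a \otimes 1_T\}$. Galois extension: for $T$ a left finite projective right $R$-bialgebroid, $A \mid B$ is a (right) $T$-Galois extension if $A$ is a right $T$-comodule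 algebra with $A^{\mathrm{co}\,T} = B$ and the Galois mapping $\beta: A \otimes_B A \to A \otimes_R T$, $\beta(a \otimes a') = a a'_{(0)} \otimes a'_{(1)}$, is bijective. *)

theory Defs
  imports "HOL-Algebra.Free_Abelian_Groups" "HOL-Algebra.Subrings"
begin

section \<open>Bimodules over noncommutative rings\<close>

text \<open>
  The module theory of HOL-Algebra is restricted to commutative scalars. Here the abelian group
  underlying a bimodule is a group record, written multiplicatively as in HOL-Algebra: for a
  module \<open>M\<close>, \<open>x \<otimes>\<^bsub>M\<^esub> y\<close> is the sum of \<open>x\<close> and \<open>y\<close>, and \<open>\<one>\<^bsub>M\<^esub>\<close> is the zero
  element. The record does not store the scalar rings. The sets of scalars are arguments of the
  notions that depend on them, so that restricting scalars to a subring leaves the record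
  unchanged.
\<close>

record ('l, 'r, 'm) bimodule = "'m monoid" +
  lact :: "'l \<Rightarrow> 'm \<Rightarrow> 'm"  (infixr "\<triangleright>\<index>" 75)
  ract :: "'m \<Rightarrow> 'r \<Rightarrow> 'm"  (infixl "\<triangleleft>\<index>" 75)

definition bimodule_on ::
  "('m, 'x) ring_scheme \<Rightarrow> ('l \<Rightarrow> 'm \<Rightarrow> 'm) \<Rightarrow> ('m \<Rightarrow> 'r \<Rightarrow> 'm) \<Rightarrow> ('l, 'r, 'm) bimodule" where
  "bimodule_on A f g =
     \<lparr>carrier = carrier A, monoid.mult = add A, one = \<zero>\<^bsub>A\<^esub>, lact = f, ract = g\<rparr>"

definition regular :: "('a, 'x) ring_scheme \<Rightarrow> ('a, 'a, 'a) bimodule" where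
  "regular A = bimodule_on A (monoid.mult A) (monoid.mult A)"

definition left_hom ::
  "'l set \<Rightarrow> ('l, 'r, 'm, 'x) bimodule_scheme \<Rightarrow> ('l, 's, 'n, 'y) bimodule_scheme \<Rightarrow> ('m \<Rightarrow> 'n) set" where
  "left_hom L M N =
     {f \<in> hom M N. \<forall>l\<in>L. \<forall>m\<in>carrier M. f (l \<triangleright>\<^bsub>M\<^esub> m) = l \<triangleright>\<^bsub>N\<^esub> f m}"

definition right_hom ::
  "'r set \<Rightarrow> ('l, 'r, 'm, 'x) bimodule_scheme \<Rightarrow> ('k, 'r, 'n, 'y) bimodule_scheme \<Rightarrow> ('m \<Rightarrow> 'n) set" where
  "right_hom R M N =
     {f \<in> hom M N. \<forall>m\<in>carrier M. \<forall>r\<in>R. f (m \<triangleleft>\<^bsub>M\<^esub> r) = f m \<triangleleft>\<^bsub>N\<^esub> r}"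

definition bimodule_hom ::
  "'l set \<Rightarrow> 'r set \<Rightarrow> ('l, 'r, 'm, 'x) bimodule_scheme \<Rightarrow> ('l, 'r, 'n, 'y) bimodule_scheme \<Rightarrow> ('m \<Rightarrow> 'n) set" where
  "bimodule_hom L R M N = left_hom L M N \<inter> right_hom R M N"

definition left_submodule :: "'l set \<Rightarrow> ('l, 'r, 'm, 'x) bimodule_scheme \<Rightarrow> 'm set \<Rightarrow> bool" where
  "left_submodule L M P \<longleftrightarrow> subgroup P M \<and> (\<forall>l\<in>L. \<forall>p\<in>P. l \<triangleright>\<^bsub>M\<^esub> p \<in> P)"

definition right_submodule :: "'r set \<Rightarrow> ('l, 'r, 'm, 'x) bimodule_scheme \<Rightarrow> 'm set \<Rightarrow> bool" where
  "right_submodule R M P \<longleftrightarrow> subgroup P M \<and> (\<forall>p\<in>P. \<forall>r\<in>R. p \<triangleleft>\<^bsub>M\<^esub> r \<in> P)"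

definition sub_bimodule ::
  "'l set \<Rightarrow> 'r set \<Rightarrow> ('l, 'r, 'm, 'x) bimodule_scheme \<Rightarrow> 'm set \<Rightarrow> bool" where
  "sub_bimodule L R M P \<longleftrightarrow> left_submodule L M P \<and> right_submodule R M P"

text \<open>
  \<open>M\<close> is isomorphic to a direct summand of \<open>N\<close>. The arguments \<open>H\<close> (the homomorphisms from
  \<open>M\<close> to \<open>N\<close>) and \<open>sub\<close> (the submodules of \<open>N\<close>) choose between left modules, right modules
  and bimodules.
\<close>

definition iso_to_summand ::
  "('m \<Rightarrow> 'n) set \<Rightarrow> ('n set \<Rightarrow> bool) \<Rightarrow> ('m, 'x) monoid_scheme \<Rightarrow> ('n, 'y) monoid_scheme \<Rightarrow> bool" where
  "iso_to_summand H sub M N \<longleftrightarrow>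
     (\<exists>P Q. sub P \<and> sub Q \<and> P \<inter> Q = {\<one>\<^bsub>N\<^esub>} \<and> P <#>\<^bsub>N\<^esub> Q = carrier N \<and>
            (\<exists>f\<in>H. bij_betw f (carrier M) P))"

definition copies ::
  "nat \<Rightarrow> ('l, 'r, 'm, 'x) bimodule_scheme \<Rightarrow> ('l, 'r, nat \<Rightarrow> 'm) bimodule" where
  "copies n M =
     \<lparr>carrier = carrier (product_group {..<n} (\<lambda>_. M)),
      monoid.mult = monoid.mult (product_group {..<n} (\<lambda>_. M)),
      one = one (product_group {..<n} (\<lambda>_. M)),
      lact = (\<lambda>l x. \<lambda>i\<in>{..<n}. l \<triangleright>\<^bsub>M\<^esub> x i),
      ract = (\<lambda>x r. \<lambda>i\<in>{..<n}. x i \<triangleleft>\<^bsub>M\<^esub> r)\<rparr>"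

text \<open>
  Finitely generated projective modules over a ring \<open>R\<close>, as direct summands of finite free ones.
\<close>

definition left_fg_projective ::
  "('r, 'x) ring_scheme \<Rightarrow> ('r, 's, 'm, 'y) bimodule_scheme \<Rightarrow> bool" where
  "left_fg_projective R M \<longleftrightarrow>
     (\<exists>n. let F = copies n (regular R)
          in iso_to_summand (left_hom (carrier R) M F) (left_submodule (carrier R) F) M F)"

definition right_fg_projective ::
  "('r, 'x) ring_scheme \<Rightarrow> ('s, 'r, 'm, 'y) bimodule_scheme \<Rightarrow> bool" where
  "right_fg_projective R M \<longleftrightarrow>
     (\<exists>n. let F = copies n (regular R)
          in iso_to_summand (right_hom (carrier R) M F) (right_submodule (carrier R) F) M F)"


section \<open>Tensor products\<close>

text \<open>
  \<open>M \<otimes>\<^sub>S N\<close> is the free abelian group on \<open>M \<times> N\<close> modulo the subgroup generated by the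
  relators of biadditivity and \<open>S\<close>-balancedness. Its elements are cosets of formal integer
  combinations of pairs.
\<close>

type_synonym ('m, 'n) tensor = "(('m \<times> 'n) \<Rightarrow>\<^sub>0 int) set"

definition tensor_relators ::
  "'s set \<Rightarrow> ('l, 's, 'm, 'x) bimodule_scheme \<Rightarrow> ('s, 'r, 'n, 'y) bimodule_scheme \<Rightarrow> (('m \<times> 'n) \<Rightarrow>\<^sub>0 int) set" where
  "tensor_relators S M N =
     {frag_of (m \<otimes>\<^bsub>M\<^esub> m', n) - frag_of (m, n) - frag_of (m', n) | m m' n.
        m \<in> carrier M \<and> m' \<in> carrier M \<and> n \<in> carrier N} \<union>
     {frag_of (m, n \<otimes>\<^bsub>N\<^esub> n') - frag_of (m, n) - frag_of (m, n') | m n n'.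
        m \<in> carrier M \<and> n \<in> carrier N \<and> n' \<in> carrier N} \<union>
     {frag_of (m \<triangleleft>\<^bsub>M\<^esub> s, n) - frag_of (m, s \<triangleright>\<^bsub>N\<^esub> n) | m s n.
        m \<in> carrier M \<and> s \<in> S \<and> n \<in> carrier N}"

definition tensor_null ::
  "'s set \<Rightarrow> ('l, 's, 'm, 'x) bimodule_scheme \<Rightarrow> ('s, 'r, 'n, 'y) bimodule_scheme \<Rightarrow> ('m, 'n) tensor" where
  "tensor_null S M N =
     generate (free_Abelian_group (carrier M \<times> carrier N)) (tensor_relators S M N)"

definition tensor_group ::
  "'s set \<Rightarrow> ('l, 's, 'm, 'x) bimodule_scheme \<Rightarrow> ('s, 'r, 'n, 'y) bimodule_scheme \<Rightarrow> ('m, 'n) tensor monoid" where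
  "tensor_group S M N = free_Abelian_group (carrier M \<times> carrier N) Mod tensor_null S M N"

definition pure_tensor ::
  "'s set \<Rightarrow> ('l, 's, 'm, 'x) bimodule_scheme \<Rightarrow> ('s, 'r, 'n, 'y) bimodule_scheme \<Rightarrow> 'm \<Rightarrow> 'n \<Rightarrow> ('m, 'n) tensor" where
  "pure_tensor S M N m n =
     tensor_null S M N #>\<^bsub>free_Abelian_group (carrier M \<times> carrier N)\<^esub> frag_of (m, n)"

text \<open>
  The additive map \<open>M \<otimes>\<^sub>S N \<rightarrow> G\<close> induced by a biadditive balanced map \<open>f\<close>. For such \<open>f\<close>, the
  sum of the \<open>c (m, n) \<cdot> f m n\<close> is the same for every representative \<open>c\<close> of the coset \<open>X\<close>. For
  any other \<open>f\<close> the value is unspecified, so \<open>tensor_lift\<close> must only be applied to maps that are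
  known to be balanced.
\<close>

definition tensor_lift ::
  "('g, 'x) monoid_scheme \<Rightarrow> ('m \<Rightarrow> 'n \<Rightarrow> 'g) \<Rightarrow> ('m, 'n) tensor \<Rightarrow> 'g" where
  "tensor_lift G f X =
     the_elem ((\<lambda>c. finprod G (\<lambda>(m, n). f m n [^]\<^bsub>G\<^esub> Poly_Mapping.lookup c (m, n))
                       (Poly_Mapping.keys c)) ` X)"

definition tensor ::
  "'s set \<Rightarrow> ('l, 's, 'm, 'x) bimodule_scheme \<Rightarrow> ('s, 'r, 'n, 'y) bimodule_scheme \<Rightarrow>
     ('l, 'r, ('m, 'n) tensor) bimodule" where
  "tensor S M N =
     \<lparr>carrier = carrier (tensor_group S M N),
      monoid.mult = monoid.mult (tensor_group S M N),
      one = one (tensor_group S M N),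
      lact = (\<lambda>l. tensor_lift (tensor_group S M N) (\<lambda>m n. pure_tensor S M N (l \<triangleright>\<^bsub>M\<^esub> m) n)),
      ract = (\<lambda>X r. tensor_lift (tensor_group S M N) (\<lambda>m n. pure_tensor S M N m (n \<triangleleft>\<^bsub>N\<^esub> r)) X)\<rparr>"

text \<open>The map \<open>f \<otimes> g\<close> with codomain \<open>M \<otimes>\<^sub>S N\<close>.\<close>

definition tensor_map ::
  "'s set \<Rightarrow> ('l, 's, 'm, 'x) bimodule_scheme \<Rightarrow> ('s, 'r, 'n, 'y) bimodule_scheme \<Rightarrow>
     ('p \<Rightarrow> 'm) \<Rightarrow> ('q \<Rightarrow> 'n) \<Rightarrow> ('p, 'q) tensor \<Rightarrow> ('m, 'n) tensor" where
  "tensor_map S M N f g =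
     tensor_lift (tensor S M N) (\<lambda>p q. pure_tensor S M N (f p) (g q))"

text \<open>The canonical isomorphism \<open>(M \<otimes>\<^sub>S N) \<otimes>\<^sub>S P \<rightarrow> M \<otimes>\<^sub>S (N \<otimes>\<^sub>S P)\<close>.\<close>

definition tensor_assoc ::
  "'s set \<Rightarrow> ('l, 's, 'm, 'x) bimodule_scheme \<Rightarrow> ('s, 's, 'n, 'y) bimodule_scheme \<Rightarrow>
     ('s, 'r, 'p, 'z) bimodule_scheme \<Rightarrow> (('m, 'n) tensor, 'p) tensor \<Rightarrow> ('m, ('n, 'p) tensor) tensor" where
  "tensor_assoc S M N P =
     (let K = tensor S M (tensor S N P)
      in tensor_lift K (\<lambda>X p. tensor_lift K
           (\<lambda>m n. pure_tensor S M (tensor S N P) m (pure_tensor S N P n p)) X))"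

text \<open>
  The componentwise product \<open>(a \<otimes> x)(a' \<otimes> x') = aa' \<otimes> xx'\<close>, where \<open>M\<close> and \<open>N\<close> are bimodule
  structures on the rings \<open>A\<close> and \<open>T\<close> whose scalars act by right multiplications on
  \<open>M\<^sub>S\<close> and \<open>\<^sub>SN\<close>. It is well defined for a right factor \<open>Y\<close> such that, for all scalars, left
  multiplication of \<open>Y\<close> by the element acting on the first leg agrees with left multiplication by
  the element acting on the second leg. The left factor is then arbitrary.
\<close>

definition tensor_mult ::
  "'s set \<Rightarrow> ('l, 's, 'm, 'x) bimodule_scheme \<Rightarrow> ('s, 'r, 'n, 'y) bimodule_scheme \<Rightarrow>
     ('m, 'v) ring_scheme \<Rightarrow> ('n, 'w) ring_scheme \<Rightarrow>
     ('m, 'n) tensor \<Rightarrow> ('m, 'n) tensor \<Rightarrow> ('m, 'n) tensor" where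
  "tensor_mult S M N A T X Y =
     tensor_lift (tensor S M N)
       (\<lambda>a x. tensor_map S M N (\<lambda>a'. a \<otimes>\<^bsub>A\<^esub> a') (\<lambda>x'. x \<otimes>\<^bsub>T\<^esub> x') Y) X"


section \<open>Frobenius, depth two and balanced extensions\<close>

text \<open>\<open>Hom(A\<^sub>B, B\<^sub>B)\<close> with the \<open>B\<close>-\<open>A\<close>-bimodule structure \<open>(b f a)(x) = b f(a x)\<close>.\<close>

definition dual_bimodule :: "('a, 'x) ring_scheme \<Rightarrow> 'a set \<Rightarrow> ('a, 'a, 'a \<Rightarrow> 'a) bimodule" where
  "dual_bimodule A B =
     \<lparr>carrier = right_hom B (regular A) (regular (A\<lparr>carrier := B\<rparr>)) \<inter> extensional (carrier A),
      monoid.mult = (\<lambda>f g. \<lambda>x\<in>carrier A. f x \<oplus>\<^bsub>A\<^esub> g x),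
      one = (\<lambda>x\<in>carrier A. \<zero>\<^bsub>A\<^esub>),
      lact = (\<lambda>b f. \<lambda>x\<in>carrier A. b \<otimes>\<^bsub>A\<^esub> f x),
      ract = (\<lambda>f a. \<lambda>x\<in>carrier A. f (a \<otimes>\<^bsub>A\<^esub> x))\<rparr>"

definition frobenius_extension :: "('a, 'x) ring_scheme \<Rightarrow> 'a set \<Rightarrow> bool" where
  "frobenius_extension A B \<longleftrightarrow>
     right_fg_projective (A\<lparr>carrier := B\<rparr>) (regular A) \<and>
     (\<exists>f \<in> bimodule_hom B (carrier A) (regular A) (dual_bimodule A B).
        bij_betw f (carrier A) (carrier (dual_bimodule A B)))"

definition tensor_square ::
  "('a, 'x) ring_scheme \<Rightarrow> 'a set \<Rightarrow> ('a, 'a, ('a, 'a) tensor) bimodule" where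
  "tensor_square A B = tensor B (regular A) (regular A)"

definition tensor_square_summand ::
  "'a set \<Rightarrow> 'a set \<Rightarrow> ('a, 'x) ring_scheme \<Rightarrow> 'a set \<Rightarrow> bool" where
  "tensor_square_summand L R A B \<longleftrightarrow>
     (\<exists>n. let F = copies n (regular A)
          in iso_to_summand (bimodule_hom L R (tensor_square A B) F) (sub_bimodule L R F)
               (tensor_square A B) F)"

definition left_depth_two :: "('a, 'x) ring_scheme \<Rightarrow> 'a set \<Rightarrow> bool" where
  "left_depth_two A B \<longleftrightarrow> tensor_square_summand B (carrier A) A B"

definition right_depth_two :: "('a, 'x) ring_scheme \<Rightarrow> 'a set \<Rightarrow> bool" where
  "right_depth_two A B \<longleftrightarrow> tensor_square_summand (carrier A) B A B"

definition depth_two :: "('a, 'x) ring_scheme \<Rightarrow> 'a set \<Rightarrow> bool" where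
  "depth_two A B \<longleftrightarrow> left_depth_two A B \<and> right_depth_two A B"

definition right_End :: "('a, 'x) ring_scheme \<Rightarrow> 'a set \<Rightarrow> ('a \<Rightarrow> 'a) set" where
  "right_End A B = right_hom B (regular A) (regular A)"

definition balanced :: "('a, 'x) ring_scheme \<Rightarrow> 'a set \<Rightarrow> bool" where
  "balanced A B \<longleftrightarrow>
     (\<forall>g \<in> hom (add_monoid A) (add_monoid A).
        (\<forall>f\<in>right_End A B. \<forall>x\<in>carrier A. g (f x) = f (g x)) \<longrightarrow>
        (\<exists>b\<in>B. \<forall>x\<in>carrier A. g x = x \<otimes>\<^bsub>A\<^esub> b))"


section \<open>Right bialgebroids\<close>

text \<open>A ring anti-homomorphism is a ring homomorphism into the opposite ring.\<close>

locale source_target =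
  R: ring R + T: ring T
  for R :: "('r, 'x) ring_scheme" and T :: "('t, 'y) ring_scheme" +
  fixes s t :: "'r \<Rightarrow> 't"
  assumes source_hom: "s \<in> ring_hom R T"
    and target_antihom: "t \<in> ring_hom R (T\<lparr>monoid.mult := (\<lambda>x y. y \<otimes>\<^bsub>T\<^esub> x)\<rparr>)"
    and source_target_commute:
      "\<And>r r'. r \<in> carrier R \<Longrightarrow> r' \<in> carrier R \<Longrightarrow> s r \<otimes>\<^bsub>T\<^esub> t r' = t r' \<otimes>\<^bsub>T\<^esub> s r"
begin

definition Tbim :: "('r, 'r, 't) bimodule" where
  "Tbim = bimodule_on T (\<lambda>r x. x \<otimes>\<^bsub>T\<^esub> t r) (\<lambda>x r. x \<otimes>\<^bsub>T\<^esub> s r)"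

definition TT :: "('r, 'r, ('t, 't) tensor) bimodule" where
  "TT = tensor (carrier R) Tbim Tbim"

definition pureTT :: "'t \<Rightarrow> 't \<Rightarrow> ('t, 't) tensor" where
  "pureTT = pure_tensor (carrier R) Tbim Tbim"

end

text \<open>
  The Takeuchi condition is stated with the maps induced on \<open>T \<otimes>\<^sub>R T\<close> by left multiplication on
  one leg, which are always well defined. It makes the product \<open>\<Delta>(x)\<Delta>(y)\<close> well defined.
\<close>

locale right_bialgebroid = source_target R T s t
  for R :: "('r, 'x) ring_scheme" and T :: "('t, 'y) ring_scheme" and s t +
  fixes \<Delta> :: "'t \<Rightarrow> ('t, 't) tensor" and \<epsilon> :: "'t \<Rightarrow> 'r"
  assumes comult_hom: "\<Delta> \<in> bimodule_hom (carrier R) (carrier R) Tbim TT"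
    and counit_hom: "\<epsilon> \<in> bimodule_hom (carrier R) (carrier R) Tbim (regular R)"
    and coassoc: "\<And>x. x \<in> carrier T \<Longrightarrow>
      tensor_assoc (carrier R) Tbim Tbim Tbim (tensor_map (carrier R) TT Tbim \<Delta> (\<lambda>y. y) (\<Delta> x)) =
      tensor_map (carrier R) Tbim TT (\<lambda>y. y) \<Delta> (\<Delta> x)"
    and counit_left: "\<And>x. x \<in> carrier T \<Longrightarrow>
      tensor_lift Tbim (\<lambda>y z. \<epsilon> y \<triangleright>\<^bsub>Tbim\<^esub> z) (\<Delta> x) = x"
    and counit_right: "\<And>x. x \<in> carrier T \<Longrightarrow>
      tensor_lift Tbim (\<lambda>y z. y \<triangleleft>\<^bsub>Tbim\<^esub> \<epsilon> z) (\<Delta> x) = x"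
    and takeuchi: "\<And>r x. r \<in> carrier R \<Longrightarrow> x \<in> carrier T \<Longrightarrow>
      tensor_map (carrier R) Tbim Tbim (\<lambda>y. s r \<otimes>\<^bsub>T\<^esub> y) (\<lambda>z. z) (\<Delta> x) =
      tensor_map (carrier R) Tbim Tbim (\<lambda>y. y) (\<lambda>z. t r \<otimes>\<^bsub>T\<^esub> z) (\<Delta> x)"
    and comult_mult: "\<And>x y. x \<in> carrier T \<Longrightarrow> y \<in> carrier T \<Longrightarrow>
      \<Delta> (x \<otimes>\<^bsub>T\<^esub> y) = tensor_mult (carrier R) Tbim Tbim T T (\<Delta> x) (\<Delta> y)"
    and comult_one: "\<Delta> \<one>\<^bsub>T\<^esub> = pureTT \<one>\<^bsub>T\<^esub> \<one>\<^bsub>T\<^esub>"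
    and counit_one: "\<epsilon> \<one>\<^bsub>T\<^esub> = \<one>\<^bsub>R\<^esub>"
    and counit_mult_source: "\<And>x y. x \<in> carrier T \<Longrightarrow> y \<in> carrier T \<Longrightarrow>
      \<epsilon> (x \<otimes>\<^bsub>T\<^esub> y) = \<epsilon> (s (\<epsilon> x) \<otimes>\<^bsub>T\<^esub> y)"
    and counit_mult_target: "\<And>x y. x \<in> carrier T \<Longrightarrow> y \<in> carrier T \<Longrightarrow>
      \<epsilon> (x \<otimes>\<^bsub>T\<^esub> y) = \<epsilon> (t (\<epsilon> x) \<otimes>\<^bsub>T\<^esub> y)"


section \<open>Comodule algebras and Galois extensions\<close>

text \<open>
  The tensor product \<open>A \<otimes>\<^sub>R T\<close> only involves the right \<open>R\<close>-module \<open>A\<close>. The left factor is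
  taken with its left multiplication by \<open>A\<close>, so that \<open>A \<otimes>\<^sub>R T\<close> carries the left \<open>A\<close>-action
  used by the Galois mapping.
\<close>

locale algebra_over_base = right_bialgebroid R T s t \<Delta> \<epsilon> + A: ring A
  for R :: "('r, 'x) ring_scheme" and T :: "('t, 'y) ring_scheme" and s t \<Delta> \<epsilon>
    and A :: "('a, 'z) ring_scheme" +
  fixes \<eta> :: "'r \<Rightarrow> 'a"
  assumes base_hom: "\<eta> \<in> ring_hom R A"
begin

definition Abim :: "('a, 'r, 'a) bimodule" where
  "Abim = bimodule_on A (monoid.mult A) (\<lambda>a r. a \<otimes>\<^bsub>A\<^esub> \<eta> r)"

definition AT :: "('a, 'r, ('a, 't) tensor) bimodule" where
  "AT = tensor (carrier R) Abim Tbim"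

definition pureAT :: "'a \<Rightarrow> 't \<Rightarrow> ('a, 't) tensor" where
  "pureAT = pure_tensor (carrier R) Abim Tbim"

end

locale right_comodule_algebra = algebra_over_base R T s t \<Delta> \<epsilon> A \<eta>
  for R :: "('r, 'x) ring_scheme" and T :: "('t, 'y) ring_scheme" and s t \<Delta> \<epsilon>
    and A :: "('a, 'z) ring_scheme" and \<eta> +
  fixes \<delta> :: "'a \<Rightarrow> ('a, 't) tensor"
  assumes coaction_hom: "\<delta> \<in> right_hom (carrier R) Abim AT"
    and coaction_coassoc: "\<And>a. a \<in> carrier A \<Longrightarrow>
      tensor_assoc (carrier R) Abim Tbim Tbim (tensor_map (carrier R) AT Tbim \<delta> (\<lambda>x. x) (\<delta> a)) =
      tensor_map (carrier R) Abim TT (\<lambda>a'. a') \<Delta> (\<delta> a)"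
    and coaction_counit: "\<And>a. a \<in> carrier A \<Longrightarrow>
      tensor_lift Abim (\<lambda>a' x. a' \<triangleleft>\<^bsub>Abim\<^esub> \<epsilon> x) (\<delta> a) = a"
    and coaction_one: "\<delta> \<one>\<^bsub>A\<^esub> = pureAT \<one>\<^bsub>A\<^esub> \<one>\<^bsub>T\<^esub>"
    and coaction_takeuchi: "\<And>r a. r \<in> carrier R \<Longrightarrow> a \<in> carrier A \<Longrightarrow>
      tensor_map (carrier R) Abim Tbim (\<lambda>a'. \<eta> r \<otimes>\<^bsub>A\<^esub> a') (\<lambda>x. x) (\<delta> a) =
      tensor_map (carrier R) Abim Tbim (\<lambda>a'. a') (\<lambda>x. t r \<otimes>\<^bsub>T\<^esub> x) (\<delta> a)"
    and coaction_mult: "\<And>a a'. a \<in> carrier A \<Longrightarrow> a' \<in> carrier A \<Longrightarrow>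
      \<delta> (a \<otimes>\<^bsub>A\<^esub> a') = tensor_mult (carrier R) Abim Tbim A T (\<delta> a) (\<delta> a')"
begin

definition coinvariants :: "'a set" where
  "coinvariants = {a \<in> carrier A. \<delta> a = pureAT a \<one>\<^bsub>T\<^esub>}"

definition galois_map :: "('a, 'a) tensor \<Rightarrow> ('a, 't) tensor" where
  "galois_map = tensor_lift AT (\<lambda>a a'. a \<triangleright>\<^bsub>AT\<^esub> \<delta> a')"

end

locale right_galois_extension = right_comodule_algebra R T s t \<Delta> \<epsilon> A \<eta> \<delta>
  for R :: "('r, 'x) ring_scheme" and T :: "('t, 'y) ring_scheme" and s t \<Delta> \<epsilon>
    and A :: "('a, 'z) ring_scheme" and \<eta> \<delta> +
  fixes B :: "'a set"
  assumes left_finite_projective: "left_fg_projective R Tbim"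
    and coinvariants_eq: "coinvariants = B"
    and galois_bij: "bij_betw galois_map (carrier (tensor_square A B)) (carrier AT)"

end

theory Submission
  imports Defs
begin

text \<open>
  Write \<open>S\<close> for the ring of \<open>B\<close>-\<open>B\<close>-bimodule endomorphisms of \<open>A\<close>. Right depth two amounts to a
  quasibasis: elements \<open>\<gamma>\<^sub>j\<close> of \<open>S\<close> and \<open>u\<^sub>j\<close> of \<open>(A \<otimes>\<^sub>B A)\<^sup>B\<close> with \<open>1 \<otimes> a = \<Sum>\<^sub>j \<gamma>\<^sub>j(a) u\<^sub>j\<close> for all \<open>a\<close>.

  If \<open>A | B\<close> is Galois, a dual basis \<open>(\<phi>\<^sub>j, \<tau>\<^sub>j)\<close> of \<open>\<^sub>RT\<close> gives the quasibasis
  \<open>\<gamma>\<^sub>j(a) = a\<^sub>0 \<phi>\<^sub>j(a\<^sub>1)\<close>, \<open>u\<^sub>j = \<beta>\<inverse>(1 \<otimes> \<tau>\<^sub>j)\<close>. A Frobenius homomorphism \<open>E\<close> with dual bases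
  \<open>x\<^sub>k, y\<^sub>k\<close> turns it into a left quasibasis, \<open>a \<otimes> 1 = \<Sum>\<^sub>j t\<^sub>j \<delta>\<^sub>j(a)\<close>, with
  \<open>t\<^sub>j = \<Sum>\<^sub>k x\<^sub>k \<otimes> \<gamma>\<^sub>j(y\<^sub>k)\<close>, \<open>\<delta>\<^sub>j(a) = u\<^sub>j\<^sup>1 E(u\<^sub>j\<^sup>2 a)\<close>.
  A map commuting with \<open>End(A\<^sub>B)\<close> is the right multiplication by some \<open>b\<close>, and a dual basis of \<open>A\<^sub>B\<close>
  yields \<open>1 \<otimes> b = b \<otimes> 1\<close>; applying \<open>\<beta>\<close> shows that \<open>b\<close> is coinvariant.

  Conversely, a quasibasis makes \<open>T = (A \<otimes>\<^sub>B A)\<^sup>B\<close>, with product \<open>x y = y\<^sup>1 x\<^sup>1 \<otimes> x\<^sup>2 y\<^sup>2\<close>, a bialgebroid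
  over the centralizer \<open>R\<close> of \<open>B\<close>, and \<open>a \<mapsto> \<Sum>\<^sub>j \<gamma>\<^sub>j(a) \<otimes> u\<^sub>j\<close> a coaction on \<open>A\<close>. Balancedness enters
  only to identify the coinvariants with \<open>B\<close>.
\<close>

text \<open>An invariant tensor need not be a sum of invariant pure tensors, so an identity in T
  cannot be checked on generators of T. Two devices get around this. Operations on T are defined on
  as much of \<open>A \<otimes>\<^sub>B A\<close> as possible, where induction over pure tensors
  works, and are restricted afterwards. Identities in \<open>A \<otimes>\<^sub>R T\<close> and
  \<open>T \<otimes>\<^sub>R T\<close> are tested by the functionals
  \<open>x \<mapsto> x\<^sup>1 f(x\<^sup>2)\<close> with f in S: a quasibasis makes them a
  separating family, and the comodule algebra axioms become identities about the action of S.

  The quasibasis is the identity of \<open>A \<otimes>\<^sub>B A\<close> factored through finitely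
  many copies of A: an A-B-bimodule map from \<open>A \<otimes>\<^sub>B A\<close> to A is determined
  by its values at \<open>1 \<otimes> a\<close>, which gives an element of S, and one in the other
  direction by its value at 1, which gives an element of T.\<close>

lemma comm_group_hom_finprod:
  assumes "comm_group G" "comm_group H" "h \<in> hom G H" "f \<in> I \<rightarrow> carrier G"
  shows "h (finprod G f I) = finprod H (\<lambda>i. h (f i)) I"
proof -
  interpret G: comm_group G by fact
  interpret H: comm_group H by fact
  interpret group_hom G H h
    by unfold_locales (rule assms(3))
  show ?thesis
    using assms(4)
  proof (induction I rule: infinite_finite_induct)
    case (insert i I)
    then have "f \<in> I \<rightarrow> carrier G" "f i \<in> carrier G" by auto
    moreover then have "(\<lambda>i. h (f i)) \<in> I \<rightarrow> carrier H" "h (f i) \<in> carrier H"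
      using hom_closed by blast+
    ultimately show ?case using insert by simp
  qed auto
qed

lemma (in comm_group) hom_finprod_pointwise:
  assumes "group N" "\<And>i. i \<in> I \<Longrightarrow> f i \<in> hom N G"
  shows "(\<lambda>x. finprod G (\<lambda>i. f i x) I) \<in> hom N G"
proof (rule homI)
  interpret N: group N by fact
  have closed: "f i x \<in> carrier G" if "i \<in> I" "x \<in> carrier N" for i x
    using assms(2) that by (metis hom_in_carrier)
  show "finprod G (\<lambda>i. f i x) I \<in> carrier G" if "x \<in> carrier N" for x
    using that by (intro finprod_closed) (simp add: closed)
  show "finprod G (\<lambda>i. f i (x \<otimes>\<^bsub>N\<^esub> y)) I = finprod G (\<lambda>i. f i x) I \<otimes> finprod G (\<lambda>i. f i y) I"
    if "x \<in> carrier N" "y \<in> carrier N" for x y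
  proof -
    have "finprod G (\<lambda>i. f i (x \<otimes>\<^bsub>N\<^esub> y)) I = finprod G (\<lambda>i. f i x \<otimes> f i y) I"
      using that by (intro finprod_cong) (simp_all add: closed hom_mult[OF assms(2)] simp_implies_def Pi_iff)
    also have "\<dots> = finprod G (\<lambda>i. f i x) I \<otimes> finprod G (\<lambda>i. f i y) I"
      using that by (intro finprod_multf) (simp_all add: closed)
    finally show ?thesis .
  qed
qed

lemma (in comm_group) finprod_swap:
  assumes "finite J" "\<And>i j. i \<in> I \<Longrightarrow> j \<in> J \<Longrightarrow> f i j \<in> carrier G"
  shows "finprod G (\<lambda>i. finprod G (f i) J) I = finprod G (\<lambda>j. finprod G (\<lambda>i. f i j) I) J"
  using assms
proof (induction J rule: finite_induct)
  case (insert k J)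
  have "finprod G (\<lambda>i. finprod G (f i) (insert k J)) I = finprod G (\<lambda>i. f i k \<otimes> finprod G (f i) J) I"
    using insert by (intro finprod_cong) (auto simp: simp_implies_def Pi_def intro!: finprod_insert m_closed finprod_closed)
  also have "\<dots> = finprod G (\<lambda>i. f i k) I \<otimes> finprod G (\<lambda>i. finprod G (f i) J) I"
    using insert by (intro finprod_multf) (auto intro!: finprod_closed)
  also have "\<dots> = finprod G (\<lambda>j. finprod G (\<lambda>i. f i j) I) (insert k J)"
    using insert by (subst finprod_insert) (auto intro!: finprod_closed)
  finally show ?case .
qed simp

text \<open>Additive monoids of rings, quotient groups and bimodules are records of different types,
  so equality of records cannot carry group structure from one to another; equality of the three
  relevant fields does.\<close>

lemma comm_group_cong:
  assumes "comm_group G" and one: "one G = one H"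
    and carrier: "carrier H = carrier G" and mult: "monoid.mult H = monoid.mult G"
  shows "comm_group H"
proof -
  interpret comm_group G by fact
  show ?thesis
  proof (rule comm_groupI)
    show "\<exists>y\<in>carrier H. y \<otimes>\<^bsub>H\<^esub> x = \<one>\<^bsub>H\<^esub>" if "x \<in> carrier H" for x
      using that l_inv inv_closed unfolding carrier mult one[symmetric] by blast
  qed (simp_all add: carrier mult one[symmetric] m_assoc m_comm m_lcomm)
qed

section \<open>Tensor products of bimodules\<close>

text \<open>The scalars are bare sets, and the actions are only additive and commuting, which is all
  that the tensor product uses. One-sided modules are the case of an empty scalar set on the other
  side.\<close>

locale bimod = comm_group M
  for L :: "'l set" and R :: "'r set" and M :: "('l, 'r, 'm, 'x) bimodule_scheme" (structure) +
  assumes lact_closed [simp, intro]: "l \<in> L \<Longrightarrow> m \<in> carrier M \<Longrightarrow> l \<triangleright> m \<in> carrier M"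
    and ract_closed [simp, intro]: "m \<in> carrier M \<Longrightarrow> r \<in> R \<Longrightarrow> m \<triangleleft> r \<in> carrier M"
    and lact_add: "l \<in> L \<Longrightarrow> m \<in> carrier M \<Longrightarrow> n \<in> carrier M \<Longrightarrow> l \<triangleright> (m \<otimes> n) = l \<triangleright> m \<otimes> l \<triangleright> n"
    and ract_add: "r \<in> R \<Longrightarrow> m \<in> carrier M \<Longrightarrow> n \<in> carrier M \<Longrightarrow> (m \<otimes> n) \<triangleleft> r = m \<triangleleft> r \<otimes> n \<triangleleft> r"
    and act_assoc: "l \<in> L \<Longrightarrow> m \<in> carrier M \<Longrightarrow> r \<in> R \<Longrightarrow> l \<triangleright> (m \<triangleleft> r) = (l \<triangleright> m) \<triangleleft> r"
begin

lemma lact_hom: "l \<in> L \<Longrightarrow> (\<lambda>m. l \<triangleright> m) \<in> hom M M"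
  by (rule homI) (auto simp: lact_add)

lemma ract_hom: "r \<in> R \<Longrightarrow> (\<lambda>m. m \<triangleleft> r) \<in> hom M M"
  by (rule homI) (auto simp: ract_add)

lemma bimod_subset: "L' \<subseteq> L \<Longrightarrow> R' \<subseteq> R \<Longrightarrow> bimod L' R' M"
  by unfold_locales (auto simp: lact_add ract_add act_assoc subset_iff)

end

definition balanced_map ::
  "'s set \<Rightarrow> ('l, 's, 'm, 'x) bimodule_scheme \<Rightarrow> ('s, 'r, 'n, 'y) bimodule_scheme \<Rightarrow>
     ('g, 'z) monoid_scheme \<Rightarrow> ('m \<Rightarrow> 'n \<Rightarrow> 'g) \<Rightarrow> bool" where
  "balanced_map S M N G f \<longleftrightarrow>
     (\<forall>n\<in>carrier N. (\<lambda>m. f m n) \<in> hom M G) \<and>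
     (\<forall>m\<in>carrier M. f m \<in> hom N G) \<and>
     (\<forall>m\<in>carrier M. \<forall>n\<in>carrier N. \<forall>s\<in>S. f (m \<triangleleft>\<^bsub>M\<^esub> s) n = f m (s \<triangleright>\<^bsub>N\<^esub> n))"

lemma balanced_mapI:
  assumes "\<And>m n. m \<in> carrier M \<Longrightarrow> n \<in> carrier N \<Longrightarrow> f m n \<in> carrier G"
    and "\<And>m m' n. m \<in> carrier M \<Longrightarrow> m' \<in> carrier M \<Longrightarrow> n \<in> carrier N \<Longrightarrow>
      f (m \<otimes>\<^bsub>M\<^esub> m') n = f m n \<otimes>\<^bsub>G\<^esub> f m' n"
    and "\<And>m n n'. m \<in> carrier M \<Longrightarrow> n \<in> carrier N \<Longrightarrow> n' \<in> carrier N \<Longrightarrow>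
      f m (n \<otimes>\<^bsub>N\<^esub> n') = f m n \<otimes>\<^bsub>G\<^esub> f m n'"
    and "\<And>m n s. m \<in> carrier M \<Longrightarrow> n \<in> carrier N \<Longrightarrow> s \<in> S \<Longrightarrow>
      f (m \<triangleleft>\<^bsub>M\<^esub> s) n = f m (s \<triangleright>\<^bsub>N\<^esub> n)"
  shows "balanced_map S M N G f"
  using assms unfolding balanced_map_def by (auto intro!: homI)

locale bimod_pair = M: bimod L S M + N: bimod S R N
  for L :: "'l set" and S :: "'s set" and R :: "'r set"
    and M :: "('l, 's, 'm, 'x) bimodule_scheme" and N :: "('s, 'r, 'n, 'y) bimodule_scheme"
begin

abbreviation "free \<equiv> free_Abelian_group (carrier M \<times> carrier N)"
abbreviation "null \<equiv> tensor_null S M N"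
abbreviation "MN \<equiv> tensor S M N"
abbreviation "pure \<equiv> pure_tensor S M N"

sublocale free: comm_group free
  by (rule abelian_free_Abelian_group)

lemma relators_closed: "tensor_relators S M N \<subseteq> carrier free"
  unfolding tensor_relators_def
  by (auto dest!: subsetD [OF keys_diff] split: if_splits)

lemma null_normal: "null \<lhd> free"
  unfolding tensor_null_def
  by (intro free.normal_iff_subgroup[THEN iffD2] free.generate_is_subgroup relators_closed)

lemma null_subset: "null \<subseteq> carrier free"
  using null_normal by (meson normal_imp_subgroup subgroup.subset)

lemma MN_simps: "carrier MN = carrier (free Mod null)" "monoid.mult MN = monoid.mult (free Mod null)"
  "one MN = null"
  by (auto simp: tensor_def tensor_group_def FactGroup_def)

lemma group_Mod: "comm_group (free Mod null)"
proof -
  interpret normal null free by (rule null_normal)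
  show ?thesis by (simp add: free.abelian_FactGroup is_subgroup)
qed

lemma comm_group_MN: "comm_group MN"
proof -
  have "comm_group (free Mod null)" "\<one>\<^bsub>free Mod null\<^esub> = one MN"
    by (rule group_Mod) (simp add: MN_simps FactGroup_def)
  then show ?thesis
    by (rule comm_group_cong) (simp_all only: MN_simps)
qed

sublocale MN: comm_group MN
  by (rule comm_group_MN)

lemma class_hom: "(\<lambda>c. null #>\<^bsub>free\<^esub> c) \<in> hom free MN"
proof -
  interpret normal null free by (rule null_normal)
  show ?thesis
    using r_coset_hom_Mod unfolding hom_def by (simp add: MN_simps)
qed

lemma class_eq_one: "c \<in> null \<Longrightarrow> null #>\<^bsub>free\<^esub> c = \<one>\<^bsub>MN\<^esub>"
  using free.coset_join2[of c null] null_normal subsetD[OF null_subset, of c]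
  by (simp add: MN_simps normal_imp_subgroup)

lemma pure_closed [simp, intro]: "m \<in> carrier M \<Longrightarrow> n \<in> carrier N \<Longrightarrow> pure m n \<in> carrier MN"
  unfolding pure_tensor_def using class_hom by (auto simp: hom_def)

lemma class_add: "Poly_Mapping.keys c \<subseteq> carrier M \<times> carrier N \<Longrightarrow> Poly_Mapping.keys d \<subseteq> carrier M \<times> carrier N \<Longrightarrow>
   null #>\<^bsub>free\<^esub> (c + d) = (null #>\<^bsub>free\<^esub> c) \<otimes>\<^bsub>MN\<^esub> (null #>\<^bsub>free\<^esub> d)"
  using hom_mult[OF class_hom, of c d] by simp

lemma relator_in_null: "c \<in> tensor_relators S M N \<Longrightarrow> c \<in> null"
  unfolding tensor_null_def by (rule generate.incl)

lemma class_cong: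
  assumes "c - d \<in> null" "Poly_Mapping.keys d \<subseteq> carrier M \<times> carrier N"
  shows "null #>\<^bsub>free\<^esub> c = null #>\<^bsub>free\<^esub> d"
proof -
  have "null #>\<^bsub>free\<^esub> (c - d + d) = (null #>\<^bsub>free\<^esub> (c - d)) \<otimes>\<^bsub>MN\<^esub> (null #>\<^bsub>free\<^esub> d)"
    using assms null_subset by (intro class_add) (auto simp: subset_iff)
  moreover have "null #>\<^bsub>free\<^esub> d \<in> carrier MN"
    using class_hom assms by (auto simp: hom_def)
  ultimately show ?thesis using assms by (simp add: class_eq_one)
qed

lemma pure_add_left:
  assumes "m \<in> carrier M" "m' \<in> carrier M" "n \<in> carrier N"
  shows "pure (m \<otimes>\<^bsub>M\<^esub> m') n = pure m n \<otimes>\<^bsub>MN\<^esub> pure m' n"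
proof -
  have "frag_of (m \<otimes>\<^bsub>M\<^esub> m', n) - (frag_of (m, n) + frag_of (m', n)) \<in> null"
    using assms by (intro relator_in_null) (auto simp: tensor_relators_def diff_diff_eq)
  then show ?thesis
    unfolding pure_tensor_def using assms
    by (subst class_add[symmetric]) (auto intro!: class_cong dest!: subsetD[OF keys_add])
qed

lemma pure_add_right:
  assumes "m \<in> carrier M" "n \<in> carrier N" "n' \<in> carrier N"
  shows "pure m (n \<otimes>\<^bsub>N\<^esub> n') = pure m n \<otimes>\<^bsub>MN\<^esub> pure m n'"
proof -
  have "frag_of (m, n \<otimes>\<^bsub>N\<^esub> n') - frag_of (m, n) - frag_of (m, n') \<in> null"
    using assms by (intro relator_in_null) (unfold tensor_relators_def, blast)
  then have "frag_of (m, n \<otimes>\<^bsub>N\<^esub> n') - (frag_of (m, n) + frag_of (m, n')) \<in> null"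
    by (simp add: diff_diff_eq)
  then show ?thesis
    unfolding pure_tensor_def using assms
    by (subst class_add[symmetric]) (auto intro!: class_cong dest!: subsetD[OF keys_add])
qed

lemma pure_balanced:
  assumes "m \<in> carrier M" "s \<in> S" "n \<in> carrier N"
  shows "pure (m \<triangleleft>\<^bsub>M\<^esub> s) n = pure m (s \<triangleright>\<^bsub>N\<^esub> n)"
proof -
  have "frag_of (m \<triangleleft>\<^bsub>M\<^esub> s, n) - frag_of (m, s \<triangleright>\<^bsub>N\<^esub> n) \<in> null"
    using assms by (intro relator_in_null) (unfold tensor_relators_def, blast)
  then show ?thesis
    unfolding pure_tensor_def using assms by (auto intro!: class_cong)
qed

lemma pure_hom_left: "n \<in> carrier N \<Longrightarrow> (\<lambda>m. pure m n) \<in> hom M MN"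
  by (rule homI) (auto simp: pure_add_left)

lemma pure_hom_right: "m \<in> carrier M \<Longrightarrow> pure m \<in> hom N MN"
  by (rule homI) (auto simp: pure_add_right)

text \<open>Zero and negatives need no cases of their own: zero is the pure tensor of two zeros, and
  the negative of a pure tensor is again pure.\<close>

lemma tensor_induct [consumes 1, case_names pure add]:
  assumes X: "X \<in> carrier MN"
    and pure: "\<And>m n. m \<in> carrier M \<Longrightarrow> n \<in> carrier N \<Longrightarrow> P (pure m n)"
    and add: "\<And>X Y. X \<in> carrier MN \<Longrightarrow> Y \<in> carrier MN \<Longrightarrow> P X \<Longrightarrow> P Y \<Longrightarrow> P (X \<otimes>\<^bsub>MN\<^esub> Y)"
  shows "P X"
proof -
  interpret cls: group_hom free MN "\<lambda>c. null #>\<^bsub>free\<^esub> c"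
    by unfold_locales (rule class_hom)
  obtain c where c: "Poly_Mapping.keys c \<subseteq> carrier M \<times> carrier N" "X = null #>\<^bsub>free\<^esub> c"
    using X by (auto simp: MN_simps FactGroup_def RCOSETS_def)
  \<comment> \<open>The induction rule of the free abelian group builds differences, so P is carried
    for c and -c at once.\<close>
  have "P (null #>\<^bsub>free\<^esub> c) \<and> P (null #>\<^bsub>free\<^esub> (- c))"
  proof (rule free_Abelian_group_induct[OF c(1), where P = "\<lambda>c. P (null #>\<^bsub>free\<^esub> c) \<and> P (null #>\<^bsub>free\<^esub> (- c))"], goal_cases)
    case 1
    have "P (pure \<one>\<^bsub>M\<^esub> \<one>\<^bsub>N\<^esub>)" by (rule pure) auto
    moreover have "pure \<one>\<^bsub>M\<^esub> \<one>\<^bsub>N\<^esub> = \<one>\<^bsub>MN\<^esub>"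
      using hom_one[OF pure_hom_right, of "\<one>\<^bsub>M\<^esub>"] MN.is_group N.is_group by simp
    ultimately show ?case using cls.hom_one by simp
  next
    case (2 x y)
    have "P (null #>\<^bsub>free\<^esub> (x + - y))" "P (null #>\<^bsub>free\<^esub> (y + - x))"
      by (subst class_add; use 2 cls.hom_closed in \<open>auto intro!: add\<close>)+
    then show ?case by simp
  next
    case (3 a)
    obtain m n where a: "a = (m, n)" "m \<in> carrier M" "n \<in> carrier N" using 3 by auto
    have "P (pure (inv\<^bsub>M\<^esub> m) n)" using a by (intro pure) auto
    also have "pure (inv\<^bsub>M\<^esub> m) n = inv\<^bsub>MN\<^esub> (pure m n)"
      using a pure_hom_left[of n] by (intro group_hom.hom_inv) (auto intro!: group_hom.intro simp: group_hom_axioms_def)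
    also have "\<dots> = null #>\<^bsub>free\<^esub> (- frag_of a)"
      unfolding pure_tensor_def using a cls.hom_inv[of "frag_of a"] by simp
    finally show ?case using pure[OF a(2,3)] a(1) by (simp add: pure_tensor_def)
  qed
  then show ?thesis using c by simp
qed

lemma hom_ext:
  assumes "f \<in> hom MN G" "g \<in> hom MN G"
    and "\<And>m n. m \<in> carrier M \<Longrightarrow> n \<in> carrier N \<Longrightarrow> f (pure m n) = g (pure m n)"
    and "X \<in> carrier MN"
  shows "f X = g X"
  using assms(4) by (induction rule: tensor_induct) (simp_all add: assms(3) hom_mult[OF assms(1)] hom_mult[OF assms(2)])

end

text \<open>The integer combination that \<open>tensor_lift\<close> evaluates on a representative.\<close>

lemma (in comm_group) frag_eval_hom:
  fixes f :: "'c \<Rightarrow> 'a"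
  assumes f: "f \<in> S \<rightarrow> carrier G"
  shows "(\<lambda>c. finprod G (\<lambda>x. f x [^] Poly_Mapping.lookup c x) (Poly_Mapping.keys c)) \<in> hom (free_Abelian_group S) G"
proof (rule homI)
  let ?h = "\<lambda>c. finprod G (\<lambda>x. f x [^] Poly_Mapping.lookup c x) (Poly_Mapping.keys c)"
  have pow: "f x [^] (k :: int) \<in> carrier G" if "x \<in> S" for x k using f that by auto
  show "?h c \<in> carrier G" if "c \<in> carrier (free_Abelian_group S)" for c
    using that pow by (intro finprod_closed) auto
  show "?h (c \<otimes>\<^bsub>free_Abelian_group S\<^esub> d) = ?h c \<otimes> ?h d"
    if "c \<in> carrier (free_Abelian_group S)" "d \<in> carrier (free_Abelian_group S)" for c d
  proof -
    let ?U = "Poly_Mapping.keys c \<union> Poly_Mapping.keys d"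
    have U: "?U \<subseteq> S" "finite ?U" using that by auto
    \<comment> \<open>Cancellation may shrink the support of a sum, so all three products are
      extended to the union of the supports, where the added factors are trivial.\<close>
    have ext: "?h e = finprod G (\<lambda>x. f x [^] Poly_Mapping.lookup e x) ?U" if "Poly_Mapping.keys e \<subseteq> ?U" for e :: "'c \<Rightarrow>\<^sub>0 int"
    proof (rule finprod_mono_neutral_cong_left)
      show "(\<lambda>x. f x [^] Poly_Mapping.lookup e x) \<in> ?U \<rightarrow> carrier G"
        using U pow by blast
    qed (use U that in \<open>auto simp: in_keys_iff\<close>)
    have "?h (c + d) = finprod G (\<lambda>x. f x [^] Poly_Mapping.lookup c x \<otimes> f x [^] Poly_Mapping.lookup d x) ?U"
      using U pow f
      by (subst ext[OF keys_add]) (intro finprod_cong; auto simp: lookup_add int_pow_mult Pi_iff subset_iff simp_implies_def)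
    also have "\<dots> = finprod G (\<lambda>x. f x [^] Poly_Mapping.lookup c x) ?U \<otimes>
        finprod G (\<lambda>x. f x [^] Poly_Mapping.lookup d x) ?U"
      using U pow by (intro finprod_multf) blast+
    also have "\<dots> = ?h c \<otimes> ?h d"
      using ext[of c] ext[of d] by simp
    finally show ?thesis by simp
  qed
qed

context bimod_pair
begin

text \<open>The universal property. Evaluation on the free group is a homomorphism that kills the
  relators and hence the whole subgroup \<open>null\<close>; it is therefore constant on each coset,
  and \<open>the_elem\<close> in \<open>tensor_lift\<close> meets a singleton.\<close>

lemma
  assumes "comm_group G" "balanced_map S M N G f"
  shows lift_hom: "tensor_lift G f \<in> hom MN G"
    and lift_pure: "m \<in> carrier M \<Longrightarrow> n \<in> carrier N \<Longrightarrow> tensor_lift G f (pure m n) = f m n"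
proof -
  interpret G: comm_group G by fact
  define h where "h c = finprod G (\<lambda>(m, n). f m n [^]\<^bsub>G\<^esub> Poly_Mapping.lookup c (m, n)) (Poly_Mapping.keys c)"
    for c :: "('m \<times> 'n) \<Rightarrow>\<^sub>0 int"
  have closed: "f m n \<in> carrier G" if "m \<in> carrier M" "n \<in> carrier N" for m n
    using assms(2) that by (auto simp: balanced_map_def hom_def)
  have "(\<lambda>c. finprod G (\<lambda>x. (case x of (m, n) \<Rightarrow> f m n) [^]\<^bsub>G\<^esub> Poly_Mapping.lookup c x) (Poly_Mapping.keys c)) \<in> hom free G"
    by (rule G.frag_eval_hom) (use closed in auto)
  moreover have "(\<lambda>c. finprod G (\<lambda>x. (case x of (m, n) \<Rightarrow> f m n) [^]\<^bsub>G\<^esub> Poly_Mapping.lookup c x) (Poly_Mapping.keys c)) = h"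
    by (auto simp: h_def case_prod_beta' intro!: ext)
  ultimately have h_hom: "h \<in> hom free G" by simp
  then interpret h: group_hom free G h by unfold_locales
  have h_frag: "h (frag_of (m, n)) = f m n" if "m \<in> carrier M" "n \<in> carrier N" for m n
    using closed[OF that] G.finprod_singleton[of "(m, n)" "{(m, n)}" "\<lambda>(m, n). f m n"] by (simp add: h_def)
  have h_diff: "h (c - d) = h c \<otimes>\<^bsub>G\<^esub> inv\<^bsub>G\<^esub> h d"
    if "Poly_Mapping.keys c \<subseteq> carrier M \<times> carrier N" "Poly_Mapping.keys d \<subseteq> carrier M \<times> carrier N" for c d
    using h.hom_mult[of c "- d"] h.hom_inv[of d] that by simp
  have h_relators: "h c = \<one>\<^bsub>G\<^esub>" if "c \<in> tensor_relators S M N" for c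
  proof -
    have bal: "f (m \<otimes>\<^bsub>M\<^esub> m') n = f m n \<otimes>\<^bsub>G\<^esub> f m' n" if "m \<in> carrier M" "m' \<in> carrier M" "n \<in> carrier N" for m m' n
      using assms(2) that by (auto simp: balanced_map_def hom_def)
    have bal': "f m (n \<otimes>\<^bsub>N\<^esub> n') = f m n \<otimes>\<^bsub>G\<^esub> f m n'" if "m \<in> carrier M" "n' \<in> carrier N" "n \<in> carrier N" for m n n'
      using assms(2) that by (auto simp: balanced_map_def hom_def)
    have bal'': "f (m \<triangleleft>\<^bsub>M\<^esub> s) n = f m (s \<triangleright>\<^bsub>N\<^esub> n)" if "m \<in> carrier M" "n \<in> carrier N" "s \<in> S" for m n s
      using assms(2) that by (auto simp: balanced_map_def)
    have cancel: "(x \<otimes>\<^bsub>G\<^esub> y) \<otimes>\<^bsub>G\<^esub> inv\<^bsub>G\<^esub> x \<otimes>\<^bsub>G\<^esub> inv\<^bsub>G\<^esub> y = \<one>\<^bsub>G\<^esub>"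
      if "x \<in> carrier G" "y \<in> carrier G" for x y
      using that by (metis G.inv_closed G.m_assoc G.m_closed G.m_comm G.r_inv G.r_one)
    have two: "h (frag_of (m, n) - frag_of (m', n')) = f m n \<otimes>\<^bsub>G\<^esub> inv\<^bsub>G\<^esub> f m' n'"
      if "m \<in> carrier M" "n \<in> carrier N" "m' \<in> carrier M" "n' \<in> carrier N" for m n m' n'
      using that by (subst h_diff) (simp_all add: h_frag)
    have three: "h (frag_of (m, n) - frag_of (m', n') - frag_of (m'', n'')) =
        f m n \<otimes>\<^bsub>G\<^esub> inv\<^bsub>G\<^esub> f m' n' \<otimes>\<^bsub>G\<^esub> inv\<^bsub>G\<^esub> f m'' n''"
      if "m \<in> carrier M" "n \<in> carrier N" "m' \<in> carrier M" "n' \<in> carrier N" "m'' \<in> carrier M" "n'' \<in> carrier N"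
      for m n m' n' m'' n''
      using that keys_diff[of "frag_of (m, n)" "frag_of (m', n')"]
      by (subst h_diff) (auto simp: two h_frag subset_iff)
    show ?thesis
      using that unfolding tensor_relators_def
    proof (elim UnE CollectE exE conjE)
    qed (simp_all add: two three closed bal bal' bal'' cancel del: diff_diff_add)
  qed
  have h_null: "h c = \<one>\<^bsub>G\<^esub>" if "c \<in> null" for c
    using that unfolding tensor_null_def
  proof (induction rule: generate.induct)
    case (inv c)
    then have "c \<in> carrier free" using relators_closed by blast
    then have "h (inv\<^bsub>free\<^esub> c) = inv\<^bsub>G\<^esub> h c" by (rule h.hom_inv)
    then show ?case using h_relators[OF inv] by simp
  next
    case (eng c d)
    then have "c \<in> carrier free" "d \<in> carrier free"
      using null_subset unfolding tensor_null_def by blast+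
    then have "h (c \<otimes>\<^bsub>free\<^esub> d) = h c \<otimes>\<^bsub>G\<^esub> h d" by (rule h.hom_mult)
    then show ?case using eng.IH by simp
  qed (use h_relators h.hom_one in auto)
  have lift: "tensor_lift G f (null #>\<^bsub>free\<^esub> c) = h c" if c: "Poly_Mapping.keys c \<subseteq> carrier M \<times> carrier N" for c
  proof -
    have "h ` (null #>\<^bsub>free\<^esub> c) = {h c}"
    proof -
      have "h (d + c) = h c" if "d \<in> null" for d
        using h.hom_mult[of d c] h.hom_closed[of c] c h_null[OF that] subsetD[OF null_subset that] by simp
      moreover have "0 \<in> null"
        using generate.one[of free "tensor_relators S M N"] by (simp add: tensor_null_def)
      ultimately show ?thesis by (auto simp: r_coset_def)
    qed
    moreover have "tensor_lift G f (null #>\<^bsub>free\<^esub> c) = the_elem (h ` (null #>\<^bsub>free\<^esub> c))"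
      unfolding tensor_lift_def h_def ..
    ultimately show ?thesis by simp
  qed
  show "tensor_lift G f \<in> hom MN G"
  proof (rule homI)
    fix X Y assume "X \<in> carrier MN" "Y \<in> carrier MN"
    then obtain c d where cd: "Poly_Mapping.keys c \<subseteq> carrier M \<times> carrier N" "X = null #>\<^bsub>free\<^esub> c"
      "Poly_Mapping.keys d \<subseteq> carrier M \<times> carrier N" "Y = null #>\<^bsub>free\<^esub> d"
      by (auto simp: MN_simps FactGroup_def RCOSETS_def)
    show "tensor_lift G f X \<in> carrier G" using cd by (simp add: lift h.hom_closed)
    have keys: "Poly_Mapping.keys (c + d) \<subseteq> carrier M \<times> carrier N"
      using cd(1,3) keys_add[of c d] by blast
    have "tensor_lift G f (X \<otimes>\<^bsub>MN\<^esub> Y) = tensor_lift G f (null #>\<^bsub>free\<^esub> (c + d))"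
      by (simp only: cd(2,4) class_add[OF cd(1,3)])
    also have "\<dots> = h (c \<otimes>\<^bsub>free\<^esub> d)" using keys by (simp add: lift)
    also have "\<dots> = h c \<otimes>\<^bsub>G\<^esub> h d" using cd by (intro h.hom_mult) auto
    finally show "tensor_lift G f (X \<otimes>\<^bsub>MN\<^esub> Y) = tensor_lift G f X \<otimes>\<^bsub>G\<^esub> tensor_lift G f Y"
      by (simp only: cd(2,4) lift[OF cd(1)] lift[OF cd(3)])
  qed
  show "tensor_lift G f (pure m n) = f m n" if "m \<in> carrier M" "n \<in> carrier N"
    using that unfolding pure_tensor_def by (simp add: lift h_frag)
qed

text \<open>The actions of \<open>tensor\<close> are themselves lifts into
  \<open>tensor_group\<close>, a different record on the same group. This and the next two facts
  move the universal property between the two.\<close>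

lemma hom_tensor_group: "hom K (tensor_group S M N) = hom K MN"
  by (simp add: hom_def MN_simps tensor_group_def)

lemma comm_group_tensor_group: "comm_group (tensor_group S M N)"
  unfolding tensor_group_def by (rule group_Mod)

lemma balanced_map_tensor_group: "balanced_map S M N (tensor_group S M N) f \<longleftrightarrow> balanced_map S M N MN f"
  by (simp add: balanced_map_def hom_tensor_group)

lemma balanced_map_lact: "l \<in> L \<Longrightarrow> balanced_map S M N MN (\<lambda>m n. pure (l \<triangleright>\<^bsub>M\<^esub> m) n)"
  by (rule balanced_mapI) (auto simp: M.lact_add M.act_assoc pure_balanced pure_add_left pure_add_right)

lemma balanced_map_ract: "r \<in> R \<Longrightarrow> balanced_map S M N MN (\<lambda>m n. pure m (n \<triangleleft>\<^bsub>N\<^esub> r))"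
  by (rule balanced_mapI) (auto simp: N.ract_add N.act_assoc[symmetric] pure_balanced pure_add_left pure_add_right)

lemma
  assumes "l \<in> L"
  shows tensor_lact_hom: "(\<lambda>X. l \<triangleright>\<^bsub>MN\<^esub> X) \<in> hom MN MN"
    and lact_pure: "m \<in> carrier M \<Longrightarrow> n \<in> carrier N \<Longrightarrow> l \<triangleright>\<^bsub>MN\<^esub> pure m n = pure (l \<triangleright>\<^bsub>M\<^esub> m) n"
  using lift_hom[OF comm_group_tensor_group, unfolded balanced_map_tensor_group, OF balanced_map_lact[OF assms]]
    lift_pure[OF comm_group_tensor_group, unfolded balanced_map_tensor_group, OF balanced_map_lact[OF assms]]
  by (simp_all add: tensor_def hom_tensor_group)

lemma
  assumes "r \<in> R"
  shows tensor_ract_hom: "(\<lambda>X. X \<triangleleft>\<^bsub>MN\<^esub> r) \<in> hom MN MN"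
    and ract_pure: "m \<in> carrier M \<Longrightarrow> n \<in> carrier N \<Longrightarrow> pure m n \<triangleleft>\<^bsub>MN\<^esub> r = pure m (n \<triangleleft>\<^bsub>N\<^esub> r)"
  using lift_hom[OF comm_group_tensor_group, unfolded balanced_map_tensor_group, OF balanced_map_ract[OF assms]]
    lift_pure[OF comm_group_tensor_group, unfolded balanced_map_tensor_group, OF balanced_map_ract[OF assms]]
  by (simp_all add: tensor_def hom_tensor_group)

lemma bimod_tensor: "bimod L R MN"
proof
  show closed: "l \<triangleright>\<^bsub>MN\<^esub> X \<in> carrier MN" if "l \<in> L" "X \<in> carrier MN" for l X
    using tensor_lact_hom that by (auto simp: hom_def)
  show closed': "X \<triangleleft>\<^bsub>MN\<^esub> r \<in> carrier MN" if "X \<in> carrier MN" "r \<in> R" for r X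
    using tensor_ract_hom that by (auto simp: hom_def)
  show lact_add: "l \<triangleright>\<^bsub>MN\<^esub> (X \<otimes>\<^bsub>MN\<^esub> Y) = l \<triangleright>\<^bsub>MN\<^esub> X \<otimes>\<^bsub>MN\<^esub> l \<triangleright>\<^bsub>MN\<^esub> Y"
    if "l \<in> L" "X \<in> carrier MN" "Y \<in> carrier MN" for l X Y
    using tensor_lact_hom that by (auto simp: hom_def)
  show add': "(X \<otimes>\<^bsub>MN\<^esub> Y) \<triangleleft>\<^bsub>MN\<^esub> r = X \<triangleleft>\<^bsub>MN\<^esub> r \<otimes>\<^bsub>MN\<^esub> Y \<triangleleft>\<^bsub>MN\<^esub> r"
    if "r \<in> R" "X \<in> carrier MN" "Y \<in> carrier MN" for r X Y
    using tensor_ract_hom that by (auto simp: hom_def)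
  show "l \<triangleright>\<^bsub>MN\<^esub> (X \<triangleleft>\<^bsub>MN\<^esub> r) = (l \<triangleright>\<^bsub>MN\<^esub> X) \<triangleleft>\<^bsub>MN\<^esub> r"
    if lr: "l \<in> L" "r \<in> R" and "X \<in> carrier MN" for l r X
    using that(3)
  proof (induction rule: tensor_induct)
    case (pure m n)
    then show ?case using lr by (simp add: lact_pure ract_pure)
  next
    case (add X Y)
    then show ?case using lr by (simp add: add' closed closed' lact_add)
  qed
qed

sublocale MN: bimod L R MN
  by (rule bimod_tensor)

end

lemma
  assumes PQ: "bimod_pair K S R' P Q" and MN: "bimod_pair L S R M N"
    and f: "f \<in> right_hom S P M" and g: "g \<in> left_hom S Q N"
  shows tensor_map_hom: "tensor_map S M N f g \<in> hom (tensor S P Q) (tensor S M N)"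
    and tensor_map_pure: "p \<in> carrier P \<Longrightarrow> q \<in> carrier Q \<Longrightarrow>
      tensor_map S M N f g (pure_tensor S P Q p q) = pure_tensor S M N (f p) (g q)"
proof -
  interpret PQ: bimod_pair K S R' P Q by fact
  interpret MN: bimod_pair L S R M N by fact
  have f': "f \<in> hom P M" "\<And>p s. p \<in> carrier P \<Longrightarrow> s \<in> S \<Longrightarrow> f (p \<triangleleft>\<^bsub>P\<^esub> s) = f p \<triangleleft>\<^bsub>M\<^esub> s"
    using f by (auto simp: right_hom_def)
  have g': "g \<in> hom Q N" "\<And>q s. q \<in> carrier Q \<Longrightarrow> s \<in> S \<Longrightarrow> g (s \<triangleright>\<^bsub>Q\<^esub> q) = s \<triangleright>\<^bsub>N\<^esub> g q"
    using g by (auto simp: left_hom_def)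
  have "balanced_map S P Q (tensor S M N) (\<lambda>p q. pure_tensor S M N (f p) (g q))"
    by (rule balanced_mapI)
      (simp_all add: hom_in_carrier[OF f'(1)] hom_in_carrier[OF g'(1)] hom_mult[OF f'(1)] hom_mult[OF g'(1)]
        f'(2) g'(2) MN.pure_add_left MN.pure_add_right MN.pure_balanced)
  note bal = MN.comm_group_MN this
  show "tensor_map S M N f g \<in> hom (tensor S P Q) (tensor S M N)"
    unfolding tensor_map_def by (rule PQ.lift_hom[OF bal])
  show "tensor_map S M N f g (pure_tensor S P Q p q) = pure_tensor S M N (f p) (g q)"
    if "p \<in> carrier P" "q \<in> carrier Q"
    unfolding tensor_map_def by (rule PQ.lift_pure[OF bal that])
qed

text \<open>The universal property is used twice: for fixed p on the inner tensor product, then in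
  p. The inner lift is known only on pure tensors, so additivity and balancedness of the outer map
  are proved by induction on its first argument.\<close>

lemma
  assumes "bimod L S M" "bimod S S N" "bimod S R P"
  shows tensor_assoc_hom: "tensor_assoc S M N P \<in> hom (tensor S (tensor S M N) P) (tensor S M (tensor S N P))"
    and tensor_assoc_pure: "m \<in> carrier M \<Longrightarrow> n \<in> carrier N \<Longrightarrow> p \<in> carrier P \<Longrightarrow>
      tensor_assoc S M N P (pure_tensor S (tensor S M N) P (pure_tensor S M N m n) p) =
      pure_tensor S M (tensor S N P) m (pure_tensor S N P n p)"
proof -
  interpret MN: bimod_pair L S S M N using assms by (simp add: bimod_pair_def)
  interpret NP: bimod_pair S S R N P using assms by (simp add: bimod_pair_def)
  interpret K: bimod_pair L S R M "tensor S N P"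
    using assms NP.bimod_tensor by (simp add: bimod_pair_def)
  interpret Q: bimod_pair L S R "tensor S M N" P
    using assms MN.bimod_tensor by (simp add: bimod_pair_def)
  have inner: "balanced_map S M N K.MN (\<lambda>m n. K.pure m (NP.pure n p))" if "p \<in> carrier P" for p
    using that by (intro balanced_mapI)
      (simp_all add: K.pure_add_left K.pure_add_right NP.pure_add_left K.pure_balanced NP.lact_pure)
  define h where "h p = tensor_lift K.MN (\<lambda>m n. K.pure m (NP.pure n p))" for p
  have h_hom: "h p \<in> hom MN.MN K.MN" if "p \<in> carrier P" for p
    unfolding h_def using inner[OF that] by (intro MN.lift_hom K.MN.comm_group_axioms)
  have h_pure: "h p (MN.pure m n) = K.pure m (NP.pure n p)"
    if "p \<in> carrier P" "m \<in> carrier M" "n \<in> carrier N" for p m n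
    unfolding h_def using inner[OF that(1)] that by (intro MN.lift_pure K.MN.comm_group_axioms)
  have h_closed: "h p X \<in> carrier K.MN" if "p \<in> carrier P" "X \<in> carrier MN.MN" for p X
    using h_hom that by (auto simp: hom_def)
  have h_add: "h p (X \<otimes>\<^bsub>MN.MN\<^esub> Y) = h p X \<otimes>\<^bsub>K.MN\<^esub> h p Y"
    if "p \<in> carrier P" "X \<in> carrier MN.MN" "Y \<in> carrier MN.MN" for p X Y
    using hom_mult[OF h_hom] that by blast
  have outer: "balanced_map S MN.MN P K.MN (\<lambda>X p. h p X)"
  proof (rule balanced_mapI)
    show "h (p \<otimes>\<^bsub>P\<^esub> p') X = h p X \<otimes>\<^bsub>K.MN\<^esub> h p' X"
      if X: "X \<in> carrier MN.MN" and p: "p \<in> carrier P" "p' \<in> carrier P" for X p p'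
      using X
      by (induction rule: MN.tensor_induct)
        (simp_all add: p h_pure NP.pure_add_right K.pure_add_right h_add h_closed K.MN.m_ac)
    show "h p (X \<triangleleft>\<^bsub>MN.MN\<^esub> r) = h (r \<triangleright>\<^bsub>P\<^esub> p) X"
      if X: "X \<in> carrier MN.MN" and p: "p \<in> carrier P" and r: "r \<in> S" for X p r
      using X
      by (induction rule: MN.tensor_induct)
        (simp_all add: p r h_pure MN.ract_pure NP.pure_balanced h_add MN.MN.ract_add)
  qed (simp_all add: h_closed h_add)
  note bal = K.MN.comm_group_axioms outer
  have eq: "tensor_assoc S M N P = tensor_lift K.MN (\<lambda>X p. h p X)"
    by (simp add: tensor_assoc_def h_def Let_def)
  show "tensor_assoc S M N P \<in> hom Q.MN K.MN"
    unfolding eq by (rule Q.lift_hom[OF bal])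
  show "tensor_assoc S M N P (Q.pure (MN.pure m n) p) = K.pure m (NP.pure n p)"
    if "m \<in> carrier M" "n \<in> carrier N" "p \<in> carrier P"
    unfolding eq using that by (subst Q.lift_pure[OF bal]) (simp_all add: h_pure)
qed


section \<open>Direct summands\<close>

lemma bimodule_homD:
  assumes "f \<in> bimodule_hom L R M N"
  shows "f \<in> hom M N"
    and "l \<in> L \<Longrightarrow> m \<in> carrier M \<Longrightarrow> f (l \<triangleright>\<^bsub>M\<^esub> m) = l \<triangleright>\<^bsub>N\<^esub> f m"
    and "r \<in> R \<Longrightarrow> m \<in> carrier M \<Longrightarrow> f (m \<triangleleft>\<^bsub>M\<^esub> r) = f m \<triangleleft>\<^bsub>N\<^esub> r"
    and "m \<in> carrier M \<Longrightarrow> f m \<in> carrier N"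
    and "m \<in> carrier M \<Longrightarrow> m' \<in> carrier M \<Longrightarrow> f (m \<otimes>\<^bsub>M\<^esub> m') = f m \<otimes>\<^bsub>N\<^esub> f m'"
  using assms unfolding bimodule_hom_def left_hom_def right_hom_def hom_def by auto

lemma bimodule_homI:
  assumes "f \<in> hom M N"
    and "\<And>l m. l \<in> L \<Longrightarrow> m \<in> carrier M \<Longrightarrow> f (l \<triangleright>\<^bsub>M\<^esub> m) = l \<triangleright>\<^bsub>N\<^esub> f m"
    and "\<And>r m. r \<in> R \<Longrightarrow> m \<in> carrier M \<Longrightarrow> f (m \<triangleleft>\<^bsub>M\<^esub> r) = f m \<triangleleft>\<^bsub>N\<^esub> r"
  shows "f \<in> bimodule_hom L R M N"
  using assms unfolding bimodule_hom_def left_hom_def right_hom_def by blast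

lemma bimodule_hom_compose:
  assumes "f \<in> bimodule_hom L R M N" "g \<in> bimodule_hom L R N K"
  shows "(\<lambda>x. g (f x)) \<in> bimodule_hom L R M K"
  by (intro bimodule_homI homI)
    (simp_all add: bimodule_homD[OF assms(1)] bimodule_homD[OF assms(2)])

text \<open>From a decomposition, the retraction is the projection onto P along Q followed by the
  inverse of f. From a retraction, the summands are the image of f and the kernel of g.\<close>

lemma iso_to_summand_iff_retract:
  assumes "bimod L R M" "bimod L R N"
  shows "iso_to_summand (bimodule_hom L R M N) (sub_bimodule L R N) M N \<longleftrightarrow>
    (\<exists>f\<in>bimodule_hom L R M N. \<exists>g\<in>bimodule_hom L R N M. \<forall>m\<in>carrier M. g (f m) = m)"
    (is "?lhs \<longleftrightarrow> ?rhs")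
proof
  interpret M: bimod L R M by fact
  interpret N: bimod L R N by fact
  assume ?lhs
  then obtain P Q f where P: "sub_bimodule L R N P" and Q: "sub_bimodule L R N Q"
    and int: "P \<inter> Q = {\<one>\<^bsub>N\<^esub>}" and sum: "P <#>\<^bsub>N\<^esub> Q = carrier N"
    and f: "f \<in> bimodule_hom L R M N" and bij: "bij_betw f (carrier M) P"
    unfolding iso_to_summand_def by blast
  have subP: "subgroup P N" and subQ: "subgroup Q N"
    using P Q by (auto simp: sub_bimodule_def left_submodule_def)
  interpret f: group_hom M N f
    by unfold_locales (use f in \<open>auto simp: bimodule_hom_def left_hom_def\<close>)
  have Qc: "q \<in> carrier N" if "q \<in> Q" for q using that subQ subgroup.mem_carrier by metis
  have uniq: "m = m'" if "m \<in> carrier M" "m' \<in> carrier M" "q \<in> Q" "q' \<in> Q"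
    "f m \<otimes>\<^bsub>N\<^esub> q = f m' \<otimes>\<^bsub>N\<^esub> q'" for m m' q q'
  proof -
    have "f m = f m' \<otimes>\<^bsub>N\<^esub> q' \<otimes>\<^bsub>N\<^esub> inv\<^bsub>N\<^esub> q"
      using that Qc by (metis N.inv_solve_right N.m_closed f.hom_closed)
    then have "inv\<^bsub>N\<^esub> f m' \<otimes>\<^bsub>N\<^esub> f m = q' \<otimes>\<^bsub>N\<^esub> inv\<^bsub>N\<^esub> q"
      using that Qc N.m_assoc[of "inv\<^bsub>N\<^esub> f m'" "f m'" "q' \<otimes>\<^bsub>N\<^esub> inv\<^bsub>N\<^esub> q"]
      by (simp add: N.m_assoc)
    moreover have "q' \<otimes>\<^bsub>N\<^esub> inv\<^bsub>N\<^esub> q \<in> Q" using subQ that by (simp add: subgroup.m_closed subgroup.m_inv_closed)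
    moreover have "inv\<^bsub>N\<^esub> f m' \<otimes>\<^bsub>N\<^esub> f m \<in> P"
      using that bij_betw_apply[OF bij]
      by (intro subgroup.m_closed[OF subP] subgroup.m_inv_closed[OF subP]) auto
    ultimately have "inv\<^bsub>N\<^esub> f m' \<otimes>\<^bsub>N\<^esub> f m = \<one>\<^bsub>N\<^esub>" using int by auto
    then have "f m = f m'" using that
      by (metis N.inv_closed N.inv_inv N.inv_equality f.hom_closed N.m_comm)
    then show ?thesis using bij that by (auto simp: bij_betw_def inj_on_def)
  qed
  \<comment> \<open>The description is unique by \<open>uniq\<close>, so linearity of g follows by
    exhibiting a decomposition of the argument in question.\<close>
  define g where "g x = (THE m. m \<in> carrier M \<and> (\<exists>q\<in>Q. x = f m \<otimes>\<^bsub>N\<^esub> q))" for x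
  have g_eq: "g x = m" if "m \<in> carrier M" "q \<in> Q" "x = f m \<otimes>\<^bsub>N\<^esub> q" for x m q
    unfolding g_def using that uniq by (intro the_equality) blast+
  have decomp: "\<exists>m\<in>carrier M. \<exists>q\<in>Q. x = f m \<otimes>\<^bsub>N\<^esub> q" if "x \<in> carrier N" for x
    using that bij unfolding sum[symmetric] set_mult_def bij_betw_def by blast
  have g_dec: "g x \<in> carrier M \<and> (\<exists>q\<in>Q. x = f (g x) \<otimes>\<^bsub>N\<^esub> q)" if x: "x \<in> carrier N" for x
  proof -
    obtain m q where mq: "m \<in> carrier M" "q \<in> Q" "x = f m \<otimes>\<^bsub>N\<^esub> q" using decomp[OF x] by blast
    then have gx: "g x = m" by (rule g_eq)
    show ?thesis unfolding gx using mq by blast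
  qed
  have "g \<in> hom N M"
  proof (rule homI)
    show "g x \<in> carrier M" if "x \<in> carrier N" for x using g_dec that by blast
    fix x y assume xy: "x \<in> carrier N" "y \<in> carrier N"
    obtain q q' where q: "q \<in> Q" "x = f (g x) \<otimes>\<^bsub>N\<^esub> q" "q' \<in> Q" "y = f (g y) \<otimes>\<^bsub>N\<^esub> q'" using g_dec xy by blast
    show "g (x \<otimes>\<^bsub>N\<^esub> y) = g x \<otimes>\<^bsub>M\<^esub> g y"
    proof (rule g_eq)
      show "q \<otimes>\<^bsub>N\<^esub> q' \<in> Q" using q subQ by (simp add: subgroup.m_closed)
      have "x \<otimes>\<^bsub>N\<^esub> y = f (g x) \<otimes>\<^bsub>N\<^esub> q \<otimes>\<^bsub>N\<^esub> (f (g y) \<otimes>\<^bsub>N\<^esub> q')" using q by simp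
      also have "\<dots> = f (g x \<otimes>\<^bsub>M\<^esub> g y) \<otimes>\<^bsub>N\<^esub> (q \<otimes>\<^bsub>N\<^esub> q')"
        using g_dec xy q(1,3) Qc by (simp add: N.m_ac)
      finally show "x \<otimes>\<^bsub>N\<^esub> y = f (g x \<otimes>\<^bsub>M\<^esub> g y) \<otimes>\<^bsub>N\<^esub> (q \<otimes>\<^bsub>N\<^esub> q')" .
    qed (use g_dec xy in auto)
  qed
  moreover have "g (l \<triangleright>\<^bsub>N\<^esub> x) = l \<triangleright>\<^bsub>M\<^esub> g x" if "l \<in> L" "x \<in> carrier N" for l x
  proof -
    obtain q where q: "q \<in> Q" "x = f (g x) \<otimes>\<^bsub>N\<^esub> q" using g_dec \<open>x \<in> carrier N\<close> by blast
    have "l \<triangleright>\<^bsub>N\<^esub> x = l \<triangleright>\<^bsub>N\<^esub> (f (g x) \<otimes>\<^bsub>N\<^esub> q)" using q by simp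
    also have "\<dots> = f (l \<triangleright>\<^bsub>M\<^esub> g x) \<otimes>\<^bsub>N\<^esub> l \<triangleright>\<^bsub>N\<^esub> q"
      using f that g_dec q(1) Qc by (simp add: N.lact_add bimodule_hom_def left_hom_def)
    finally show ?thesis
      using that g_dec q(1) Q by (intro g_eq) (auto simp: sub_bimodule_def left_submodule_def)
  qed
  moreover have "g (x \<triangleleft>\<^bsub>N\<^esub> r) = g x \<triangleleft>\<^bsub>M\<^esub> r" if "r \<in> R" "x \<in> carrier N" for r x
  proof -
    obtain q where q: "q \<in> Q" "x = f (g x) \<otimes>\<^bsub>N\<^esub> q" using g_dec \<open>x \<in> carrier N\<close> by blast
    have "x \<triangleleft>\<^bsub>N\<^esub> r = (f (g x) \<otimes>\<^bsub>N\<^esub> q) \<triangleleft>\<^bsub>N\<^esub> r" using q by simp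
    also have "\<dots> = f (g x \<triangleleft>\<^bsub>M\<^esub> r) \<otimes>\<^bsub>N\<^esub> (q \<triangleleft>\<^bsub>N\<^esub> r)"
      using f that g_dec q(1) Qc by (simp add: N.ract_add bimodule_hom_def right_hom_def)
    finally show ?thesis
      using that g_dec q(1) Q by (intro g_eq) (auto simp: sub_bimodule_def right_submodule_def)
  qed
  moreover have "g (f m) = m" if "m \<in> carrier M" for m
    using that subQ by (intro g_eq[of m "\<one>\<^bsub>N\<^esub>"]) (auto simp: subgroup.one_closed)
  ultimately show ?rhs
    using f by (intro bexI[of _ f] bexI[of _ g]) (auto simp: bimodule_hom_def left_hom_def right_hom_def)
next
  interpret M: bimod L R M by fact
  interpret N: bimod L R N by fact
  assume ?rhs
  then obtain f g where f: "f \<in> bimodule_hom L R M N" and g: "g \<in> bimodule_hom L R N M"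
    and gf: "\<And>m. m \<in> carrier M \<Longrightarrow> g (f m) = m" by blast
  interpret f: group_hom M N f
    by unfold_locales (use f in \<open>auto simp: bimodule_hom_def left_hom_def\<close>)
  interpret g: group_hom N M g
    by unfold_locales (use g in \<open>auto simp: bimodule_hom_def left_hom_def\<close>)
  have fl: "f (l \<triangleright>\<^bsub>M\<^esub> m) = l \<triangleright>\<^bsub>N\<^esub> f m" "f (m \<triangleleft>\<^bsub>M\<^esub> r) = f m \<triangleleft>\<^bsub>N\<^esub> r"
    if "l \<in> L" "m \<in> carrier M" "r \<in> R" for l m r
    using f that by (auto simp: bimodule_hom_def left_hom_def right_hom_def)
  show ?lhs
    unfolding iso_to_summand_def
  proof (intro exI conjI bexI)
    show "f ` carrier M \<inter> kernel N M g = {\<one>\<^bsub>N\<^esub>}"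
      by (auto simp: kernel_def gf intro!: image_eqI[of _ f "\<one>\<^bsub>M\<^esub>"])
    \<comment> \<open>The splitting of x into f (g x) and the difference x - f (g x), which g
      kills.\<close>
    have "\<exists>m\<in>carrier M. \<exists>q\<in>carrier N. g q = \<one>\<^bsub>M\<^esub> \<and> x = f m \<otimes>\<^bsub>N\<^esub> q" if "x \<in> carrier N" for x
    proof (intro bexI conjI)
      show "g (inv\<^bsub>N\<^esub> f (g x) \<otimes>\<^bsub>N\<^esub> x) = \<one>\<^bsub>M\<^esub>" using that by (simp add: gf)
      show "x = f (g x) \<otimes>\<^bsub>N\<^esub> (inv\<^bsub>N\<^esub> f (g x) \<otimes>\<^bsub>N\<^esub> x)" using that by (simp flip: N.m_assoc)
    qed (use that in auto)
    then show "f ` carrier M <#>\<^bsub>N\<^esub> kernel N M g = carrier N"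
      unfolding set_mult_def kernel_def by fastforce
    show "bij_betw f (carrier M) (f ` carrier M)"
      by (rule bij_betw_imageI) (auto intro!: inj_onI dest: arg_cong[of _ _ g] simp: gf)
    have "subgroup (f ` carrier M) N" "subgroup (kernel N M g) N"
      by (simp_all add: f.img_is_subgroup g.subgroup_kernel)
    moreover have "l \<triangleright>\<^bsub>N\<^esub> f m \<in> f ` carrier M" if "l \<in> L" "m \<in> carrier M" for l m
      using that f by (intro image_eqI[of _ f "l \<triangleright>\<^bsub>M\<^esub> m"]) (auto simp: bimodule_hom_def left_hom_def)
    moreover have "f m \<triangleleft>\<^bsub>N\<^esub> r \<in> f ` carrier M" if "r \<in> R" "m \<in> carrier M" for r m
      using that f by (intro image_eqI[of _ f "m \<triangleleft>\<^bsub>M\<^esub> r"]) (auto simp: bimodule_hom_def right_hom_def)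
    moreover have "l \<triangleright>\<^bsub>M\<^esub> \<one>\<^bsub>M\<^esub> = \<one>\<^bsub>M\<^esub>" if "l \<in> L" for l
      using hom_one[OF M.lact_hom[OF that]] M.is_group by simp
    moreover have "\<one>\<^bsub>M\<^esub> \<triangleleft>\<^bsub>M\<^esub> r = \<one>\<^bsub>M\<^esub>" if "r \<in> R" for r
      using hom_one[OF M.ract_hom[OF that]] M.is_group by simp
    ultimately show "sub_bimodule L R N (f ` carrier M)" "sub_bimodule L R N (kernel N M g)"
      using g by (auto simp: sub_bimodule_def left_submodule_def right_submodule_def kernel_def
          bimodule_hom_def left_hom_def right_hom_def)
  qed (rule f)
qed

section \<open>Finite direct sums of copies of a bimodule\<close>

lemma copies_simps [simp]:
  "carrier (copies n M) = (\<Pi>\<^sub>E i\<in>{..<n}. carrier M)"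
  "x \<otimes>\<^bsub>copies n M\<^esub> y = (\<lambda>i\<in>{..<n}. x i \<otimes>\<^bsub>M\<^esub> y i)"
  "\<one>\<^bsub>copies n M\<^esub> = (\<lambda>i\<in>{..<n}. \<one>\<^bsub>M\<^esub>)"
  "l \<triangleright>\<^bsub>copies n M\<^esub> x = (\<lambda>i\<in>{..<n}. l \<triangleright>\<^bsub>M\<^esub> x i)"
  "x \<triangleleft>\<^bsub>copies n M\<^esub> r = (\<lambda>i\<in>{..<n}. x i \<triangleleft>\<^bsub>M\<^esub> r)"
  by (simp_all add: copies_def)

lemma bimod_copies:
  assumes "bimod L R M"
  shows "bimod L R (copies n M)"
proof -
  interpret M: bimod L R M by fact
  have "comm_group (copies n M)"
  proof (rule comm_groupI)
    fix x assume x: "x \<in> carrier (copies n M)"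
    show "\<exists>y\<in>carrier (copies n M). y \<otimes>\<^bsub>copies n M\<^esub> x = \<one>\<^bsub>copies n M\<^esub>"
      using x by (intro bexI[of _ "\<lambda>i\<in>{..<n}. inv\<^bsub>M\<^esub> x i"]) (auto simp: PiE_iff intro!: restrict_ext)
  qed (auto simp: PiE_iff M.m_assoc intro!: restrict_ext M.m_comm simp: extensional_def fun_eq_iff)
  then interpret C: comm_group "copies n M" .
  show ?thesis
    by unfold_locales
      (auto simp: PiE_iff M.lact_add M.ract_add M.act_assoc intro!: restrict_ext)
qed

lemma copies_expansion:
  assumes "comm_group M" "x \<in> carrier (copies n M)" and comm: "comm_group (copies n M)"
  shows "x = finprod (copies n M) (\<lambda>i. \<lambda>j\<in>{..<n}. if j = i then x i else \<one>\<^bsub>M\<^esub>) {..<n}"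
proof -
  interpret M: comm_group M by fact
  interpret C: comm_group "copies n M" by fact
  have "finprod (copies n M) (\<lambda>i. \<lambda>j\<in>{..<n}. if j = i then x i else \<one>\<^bsub>M\<^esub>) {..<k} =
     (\<lambda>j\<in>{..<n}. if j < k then x j else \<one>\<^bsub>M\<^esub>)" if "k \<le> n" for k
    using that
  proof (induction k)
    case (Suc k)
    have cl: "(\<lambda>j\<in>{..<n}. if j = i then x i else \<one>\<^bsub>M\<^esub>) \<in> carrier (copies n M)" if "i \<le> k" for i
      using assms(2) that Suc by (auto simp: PiE_iff)
    have "finprod (copies n M) (\<lambda>i. \<lambda>j\<in>{..<n}. if j = i then x i else \<one>\<^bsub>M\<^esub>) {..<Suc k} =
      (\<lambda>j\<in>{..<n}. if j = k then x k else \<one>\<^bsub>M\<^esub>) \<otimes>\<^bsub>copies n M\<^esub> (\<lambda>j\<in>{..<n}. if j < k then x j else \<one>\<^bsub>M\<^esub>)"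
    proof -
      have "finprod (copies n M) (\<lambda>i. \<lambda>j\<in>{..<n}. if j = i then x i else \<one>\<^bsub>M\<^esub>) {..<k} =
          (\<lambda>j\<in>{..<n}. if j < k then x j else \<one>\<^bsub>M\<^esub>)"
        by (rule Suc.IH) (use Suc.prems in simp)
      then show ?thesis
        unfolding lessThan_Suc using cl by (subst C.finprod_insert) (simp_all del: copies_simps)
    qed
    also have "\<dots> = (\<lambda>j\<in>{..<n}. if j < Suc k then x j else \<one>\<^bsub>M\<^esub>)"
      using assms(2) by (auto intro!: restrict_ext simp: PiE_iff less_Suc_eq)
    finally show ?case .
  qed auto
  from this[of n] show ?thesis using assms(2) by (auto simp: PiE_iff extensional_def fun_eq_iff)
qed

text \<open>Composition with the coordinate projections and the injections \<open>e i\<close> turns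
  a retraction through the n-fold sum into a decomposition of the identity. Projectivity and depth
  two are used in this form only; it yields both dual bases and quasibases.\<close>

lemma summand_of_copies_iff:
  assumes "bimod L R M" "bimod L R N"
  shows "iso_to_summand (bimodule_hom L R M (copies n N)) (sub_bimodule L R (copies n N)) M (copies n N) \<longleftrightarrow>
    (\<exists>f g. (\<forall>i<n. f i \<in> bimodule_hom L R M N \<and> g i \<in> bimodule_hom L R N M) \<and>
       (\<forall>m\<in>carrier M. m = finprod M (\<lambda>i. g i (f i m)) {..<n}))"
    (is "_ \<longleftrightarrow> ?rhs")
proof -
  interpret M: bimod L R M by fact
  interpret N: bimod L R N by fact
  interpret C: bimod L R "copies n N" by (rule bimod_copies) fact
  let ?C = "copies n N"
  define e where "e i a = (\<lambda>j\<in>{..<n}. if j = i then a else \<one>\<^bsub>N\<^esub>)" for i :: nat and a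
  have zero: "l \<triangleright>\<^bsub>N\<^esub> \<one>\<^bsub>N\<^esub> = \<one>\<^bsub>N\<^esub>" if "l \<in> L" for l
    using hom_one[OF N.lact_hom[OF that]] N.is_group by simp
  have zero': "\<one>\<^bsub>N\<^esub> \<triangleleft>\<^bsub>N\<^esub> r = \<one>\<^bsub>N\<^esub>" if "r \<in> R" for r
    using hom_one[OF N.ract_hom[OF that]] N.is_group by simp
  have e: "e i \<in> bimodule_hom L R N ?C" if "i < n" for i
    using zero zero' unfolding bimodule_hom_def left_hom_def right_hom_def
    by (auto intro!: homI restrict_ext simp: e_def)
  have "(\<exists>f\<in>bimodule_hom L R M ?C. \<exists>g\<in>bimodule_hom L R ?C M. \<forall>m\<in>carrier M. g (f m) = m) \<longleftrightarrow> ?rhs"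
  proof (intro iffI; (elim bexE exE conjE)?)
    fix f g assume f: "f \<in> bimodule_hom L R M ?C" and g: "g \<in> bimodule_hom L R ?C M"
      and gf: "\<forall>m\<in>carrier M. g (f m) = m"
    show ?rhs
    proof (intro exI conjI allI impI ballI)
      fix i assume i: "i < n"
      have fc: "f m i \<in> carrier N" if "m \<in> carrier M" for m
        using f that i by (auto simp: bimodule_hom_def left_hom_def hom_def PiE_iff)
      show "(\<lambda>m. f m i) \<in> bimodule_hom L R M N"
        using f i fc by (auto simp: bimodule_hom_def left_hom_def right_hom_def hom_def)
      show "(\<lambda>a. g (e i a)) \<in> bimodule_hom L R N M"
        using bimodule_hom_compose[OF e[OF i] g] .
    next
      fix m assume m: "m \<in> carrier M"
      have fm: "f m \<in> carrier ?C" using f m by (auto simp: bimodule_hom_def left_hom_def hom_def)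
      have "m = g (f m)" using gf m by simp
      also have "f m = finprod ?C (\<lambda>i. e i (f m i)) {..<n}"
        unfolding e_def by (rule copies_expansion) (use fm in \<open>auto intro: N.comm_group_axioms C.comm_group_axioms\<close>)
      also have "g \<dots> = finprod M (\<lambda>i. g (e i (f m i))) {..<n}"
      proof (rule comm_group_hom_finprod[OF C.comm_group_axioms M.comm_group_axioms])
        show "(\<lambda>i. e i (f m i)) \<in> {..<n} \<rightarrow> carrier ?C"
          using e fm unfolding bimodule_hom_def left_hom_def
          by (auto simp: PiE_iff hom_in_carrier simp del: copies_simps) (auto simp: PiE_iff e_def)
      qed (use g in \<open>auto simp: bimodule_hom_def left_hom_def\<close>)
      finally show "m = finprod M (\<lambda>i. g (e i (f m i))) {..<n}" .
    qed
  next
    fix f g assume fg: "\<forall>i<n. f i \<in> bimodule_hom L R M N \<and> g i \<in> bimodule_hom L R N M"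
      and m: "\<forall>m\<in>carrier M. m = finprod M (\<lambda>i. g i (f i m)) {..<n}"
    define G where "G x = finprod M (\<lambda>i. g i (x i)) {..<n}" for x
    have gc: "g i a \<in> carrier M" if "i < n" "a \<in> carrier N" for i a
      using fg that by (auto simp: bimodule_hom_def left_hom_def hom_in_carrier)
    show "\<exists>f\<in>bimodule_hom L R M ?C. \<exists>g\<in>bimodule_hom L R ?C M. \<forall>m\<in>carrier M. g (f m) = m"
    proof (intro bexI ballI)
      show "(\<lambda>m. \<lambda>i\<in>{..<n}. f i m) \<in> bimodule_hom L R M ?C"
        using fg by (auto simp: bimodule_hom_def left_hom_def right_hom_def hom_def Pi_iff intro!: restrict_ext)
      have "G \<in> hom ?C M"
        unfolding G_def using fg
        by (intro M.hom_finprod_pointwise C.is_group) (auto simp: bimodule_hom_def left_hom_def hom_def PiE_iff Pi_iff)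
      moreover have "G (l \<triangleright>\<^bsub>?C\<^esub> x) = l \<triangleright>\<^bsub>M\<^esub> G x" if "l \<in> L" "x \<in> carrier ?C" for l x
        unfolding G_def using fg that gc
        by (subst comm_group_hom_finprod[OF M.comm_group_axioms M.comm_group_axioms M.lact_hom])
          (auto simp: bimodule_hom_def left_hom_def PiE_iff simp_implies_def intro!: M.finprod_cong)
      moreover have "G (x \<triangleleft>\<^bsub>?C\<^esub> r) = G x \<triangleleft>\<^bsub>M\<^esub> r" if "r \<in> R" "x \<in> carrier ?C" for r x
        unfolding G_def using fg that gc
        by (subst comm_group_hom_finprod[OF M.comm_group_axioms M.comm_group_axioms M.ract_hom])
          (auto simp: bimodule_hom_def right_hom_def PiE_iff simp_implies_def intro!: M.finprod_cong)
      ultimately show "G \<in> bimodule_hom L R ?C M"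
        unfolding bimodule_hom_def left_hom_def right_hom_def by blast
      show "G (\<lambda>i\<in>{..<n}. f i x) = x" if "x \<in> carrier M" for x
        using fg m that gc unfolding G_def
        by (subst (2) m[rule_format, OF that], intro M.finprod_cong)
          (auto simp: simp_implies_def bimodule_hom_def left_hom_def hom_in_carrier)
    qed
  qed
  then show ?thesis
    using iso_to_summand_iff_retract[OF assms(1) C.bimod_axioms] by simp
qed

section \<open>Depth two extensions\<close>

lemma bimodule_on_simps [simp]:
  "carrier (bimodule_on A f g) = carrier A" "monoid.mult (bimodule_on A f g) = add A"
  "\<one>\<^bsub>bimodule_on A f g\<^esub> = \<zero>\<^bsub>A\<^esub>" "lact (bimodule_on A f g) = f" "ract (bimodule_on A f g) = g"
  by (simp_all add: bimodule_on_def)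

lemma regular_simps [simp]:
  "carrier (regular A) = carrier A" "monoid.mult (regular A) = add A"
  "\<one>\<^bsub>regular A\<^esub> = \<zero>\<^bsub>A\<^esub>" "lact (regular A) = monoid.mult A" "ract (regular A) = monoid.mult A"
  by (simp_all add: regular_def)

lemma comm_group_bimodule_on: "ring A \<Longrightarrow> comm_group (bimodule_on A f g)"
  by (rule comm_group_cong[OF abelian_group.a_comm_group]) (simp_all add: ring.is_abelian_group)

lemma comm_group_regular: "ring A \<Longrightarrow> comm_group (regular A)"
  unfolding regular_def by (rule comm_group_bimodule_on)

lemma bimod_regular:
  assumes "ring A"
  shows "bimod (carrier A) (carrier A) (regular A)"
proof -
  interpret A: ring A by fact
  interpret comm_group "regular A" by (rule comm_group_regular) fact
  show ?thesis by unfold_locales (auto simp: A.l_distr A.r_distr A.m_assoc)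
qed

locale ring_extension = A: ring A
  for A :: "('a, 'x) ring_scheme" (structure) and B :: "'a set" +
  assumes subring: "subring B A"
begin

sublocale reg: bimod "carrier A" "carrier A" "regular A"
  by (rule bimod_regular) (rule A.ring_axioms)

lemma B_subset: "B \<subseteq> carrier A"
  using subring by (rule subringE(1))

lemma B_closed [simp, intro]: "b \<in> B \<Longrightarrow> b \<in> carrier A"
  using B_subset by blast

lemma bimod_pair_regular: "bimod_pair (carrier A) B (carrier A) (regular A) (regular A)"
  by (intro bimod_pair.intro reg.bimod_subset B_subset order_refl)

sublocale AA: bimod_pair "carrier A" B "carrier A" "regular A" "regular A"
  by (rule bimod_pair_regular)

abbreviation AA where "AA \<equiv> tensor B (regular A) (regular A)"

abbreviation End where "End \<equiv> bimodule_hom B B (regular A) (regular A)"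

abbreviation tensor_prod (infixl "\<otimes>\<^sub>B" 72) where "a \<otimes>\<^sub>B c \<equiv> pure_tensor B (regular A) (regular A) a c"

text \<open>\<open>(A \<otimes>\<^sub>B A)\<^sup>B\<close>. Evaluation at 1 identifies it with the
  A-B-bimodule maps from A to \<open>A \<otimes>\<^sub>B A\<close>, and equally with the
  B-A-bimodule maps.\<close>

definition centralized :: "('a, 'a) tensor set" where
  "centralized = {X \<in> carrier AA. \<forall>b\<in>B. b \<triangleright>\<^bsub>AA\<^esub> X = X \<triangleleft>\<^bsub>AA\<^esub> b}"

lemma centralizedD: "X \<in> centralized \<Longrightarrow> X \<in> carrier AA"
  "X \<in> centralized \<Longrightarrow> b \<in> B \<Longrightarrow> b \<triangleright>\<^bsub>AA\<^esub> X = X \<triangleleft>\<^bsub>AA\<^esub> b"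
  by (auto simp: centralized_def)

lemma lact_lact:
  assumes "a \<in> carrier A" "b \<in> carrier A" "X \<in> carrier AA"
  shows "a \<triangleright>\<^bsub>AA\<^esub> (b \<triangleright>\<^bsub>AA\<^esub> X) = (a \<otimes> b) \<triangleright>\<^bsub>AA\<^esub> X"
  using assms(3) assms(1,2)
  by (induction rule: AA.tensor_induct) (simp_all add: AA.lact_pure A.m_assoc AA.MN.lact_add)

lemma ract_ract:
  assumes "a \<in> carrier A" "b \<in> carrier A" "X \<in> carrier AA"
  shows "(X \<triangleleft>\<^bsub>AA\<^esub> a) \<triangleleft>\<^bsub>AA\<^esub> b = X \<triangleleft>\<^bsub>AA\<^esub> (a \<otimes> b)"
  using assms(3) assms(1,2)
  by (induction rule: AA.tensor_induct) (simp_all add: AA.ract_pure A.m_assoc AA.MN.ract_add)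

lemma one_lact: "X \<in> carrier AA \<Longrightarrow> \<one> \<triangleright>\<^bsub>AA\<^esub> X = X"
  by (induction rule: AA.tensor_induct) (simp_all add: AA.lact_pure AA.MN.lact_add)

lemma ract_one: "X \<in> carrier AA \<Longrightarrow> X \<triangleleft>\<^bsub>AA\<^esub> \<one> = X"
  by (induction rule: AA.tensor_induct) (simp_all add: AA.ract_pure AA.MN.ract_add)

lemma lact_add_scalar:
  assumes "a \<in> carrier A" "b \<in> carrier A" "X \<in> carrier AA"
  shows "(a \<oplus> b) \<triangleright>\<^bsub>AA\<^esub> X = a \<triangleright>\<^bsub>AA\<^esub> X \<otimes>\<^bsub>AA\<^esub> b \<triangleright>\<^bsub>AA\<^esub> X"
  using assms(3) assms(1,2)
proof (induction rule: AA.tensor_induct)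
  case (pure m n)
  then show ?case using AA.pure_add_left[of "a \<otimes> m" "b \<otimes> m" n] by (simp add: AA.lact_pure A.l_distr)
qed (simp add: AA.MN.lact_add AA.MN.m_ac)

lemma ract_add_scalar:
  assumes "a \<in> carrier A" "b \<in> carrier A" "X \<in> carrier AA"
  shows "X \<triangleleft>\<^bsub>AA\<^esub> (a \<oplus> b) = X \<triangleleft>\<^bsub>AA\<^esub> a \<otimes>\<^bsub>AA\<^esub> X \<triangleleft>\<^bsub>AA\<^esub> b"
  using assms(3) assms(1,2)
proof (induction rule: AA.tensor_induct)
  case (pure m n)
  then show ?case using AA.pure_add_right[of m "n \<otimes> a" "n \<otimes> b"] by (simp add: AA.ract_pure A.r_distr)
qed (simp add: AA.MN.ract_add AA.MN.m_ac)

lemma lact_scalar_hom: "X \<in> carrier AA \<Longrightarrow> (\<lambda>a. a \<triangleright>\<^bsub>AA\<^esub> X) \<in> hom (regular A) AA"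
  by (rule homI) (simp_all add: lact_add_scalar)

lemma ract_scalar_hom: "X \<in> carrier AA \<Longrightarrow> (\<lambda>a. X \<triangleleft>\<^bsub>AA\<^esub> a) \<in> hom (regular A) AA"
  by (rule homI) (simp_all add: ract_add_scalar)

lemma pure_shift: "a \<in> carrier A \<Longrightarrow> b \<in> B \<Longrightarrow> c \<in> carrier A \<Longrightarrow> (a \<otimes> b) \<otimes>\<^sub>B c = a \<otimes>\<^sub>B (b \<otimes> c)"
  using AA.pure_balanced[of a b c] by simp

lemma left_homD:
  assumes "f \<in> left_hom B (regular A) (regular A)"
  shows "f \<in> hom (regular A) (regular A)"
    and "b \<in> B \<Longrightarrow> a \<in> carrier A \<Longrightarrow> f (b \<otimes> a) = b \<otimes> f a"
    and "a \<in> carrier A \<Longrightarrow> f a \<in> carrier A"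
    and "a \<in> carrier A \<Longrightarrow> c \<in> carrier A \<Longrightarrow> f (a \<oplus> c) = f a \<oplus> f c"
  using assms by (auto simp: left_hom_def hom_def)

lemma right_homD:
  assumes "f \<in> right_hom B (regular A) (regular A)"
  shows "f \<in> hom (regular A) (regular A)"
    and "b \<in> B \<Longrightarrow> a \<in> carrier A \<Longrightarrow> f (a \<otimes> b) = f a \<otimes> b"
    and "a \<in> carrier A \<Longrightarrow> f a \<in> carrier A"
    and "a \<in> carrier A \<Longrightarrow> c \<in> carrier A \<Longrightarrow> f (a \<oplus> c) = f a \<oplus> f c"
  using assms by (auto simp: right_hom_def hom_def)

lemma End_left_hom: "f \<in> End \<Longrightarrow> f \<in> left_hom B (regular A) (regular A)"
  and End_right_hom: "f \<in> End \<Longrightarrow> f \<in> right_hom B (regular A) (regular A)"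
  by (simp_all add: bimodule_hom_def)

lemmas EndD = left_homD[OF End_left_hom] right_homD(2)[OF End_right_hom]

text \<open>For f in \<open>End\<close> these are the A-B-bimodule maps from
  \<open>A \<otimes>\<^sub>B A\<close> to A, since such a map is determined by its values at
  \<open>1 \<otimes> c\<close>. \<open>contract_left\<close> plays this part for B-A-bimodule
  maps.\<close>

definition contract_right :: "('a \<Rightarrow> 'a) \<Rightarrow> ('a, 'a) tensor \<Rightarrow> 'a" where
  "contract_right f = tensor_lift (regular A) (\<lambda>a c. a \<otimes> f c)"

definition contract_left :: "('a \<Rightarrow> 'a) \<Rightarrow> ('a, 'a) tensor \<Rightarrow> 'a" where
  "contract_left f = tensor_lift (regular A) (\<lambda>a c. f a \<otimes> c)"

lemma
  assumes "f \<in> left_hom B (regular A) (regular A)"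
  shows contract_right_hom: "contract_right f \<in> hom AA (regular A)"
    and contract_right_pure: "a \<in> carrier A \<Longrightarrow> c \<in> carrier A \<Longrightarrow> contract_right f (a \<otimes>\<^sub>B c) = a \<otimes> f c"
proof -
  have "balanced_map B (regular A) (regular A) (regular A) (\<lambda>a c. a \<otimes> f c)"
    by (rule balanced_mapI) (simp_all add: left_homD[OF assms] A.l_distr A.r_distr A.m_assoc)
  note bal = reg.comm_group_axioms this
  show "contract_right f \<in> hom AA (regular A)"
    unfolding contract_right_def by (rule AA.lift_hom[OF bal])
  show "a \<in> carrier A \<Longrightarrow> c \<in> carrier A \<Longrightarrow> contract_right f (a \<otimes>\<^sub>B c) = a \<otimes> f c"
    using AA.lift_pure[OF bal, of a c] by (simp add: contract_right_def)
qed

lemma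
  assumes "f \<in> right_hom B (regular A) (regular A)"
  shows contract_left_hom: "contract_left f \<in> hom AA (regular A)"
    and contract_left_pure: "a \<in> carrier A \<Longrightarrow> c \<in> carrier A \<Longrightarrow> contract_left f (a \<otimes>\<^sub>B c) = f a \<otimes> c"
proof -
  have "balanced_map B (regular A) (regular A) (regular A) (\<lambda>a c. f a \<otimes> c)"
    by (rule balanced_mapI) (simp_all add: right_homD[OF assms] A.l_distr A.r_distr A.m_assoc)
  note bal = reg.comm_group_axioms this
  show "contract_left f \<in> hom AA (regular A)"
    unfolding contract_left_def by (rule AA.lift_hom[OF bal])
  show "a \<in> carrier A \<Longrightarrow> c \<in> carrier A \<Longrightarrow> contract_left f (a \<otimes>\<^sub>B c) = f a \<otimes> c"
    using AA.lift_pure[OF bal, of a c] by (simp add: contract_left_def)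
qed

lemma contract_right_closed [simp, intro]:
  "f \<in> left_hom B (regular A) (regular A) \<Longrightarrow> X \<in> carrier AA \<Longrightarrow> contract_right f X \<in> carrier A"
  using contract_right_hom by (fastforce simp: hom_def)

lemma contract_left_closed [simp, intro]:
  "f \<in> right_hom B (regular A) (regular A) \<Longrightarrow> X \<in> carrier AA \<Longrightarrow> contract_left f X \<in> carrier A"
  using contract_left_hom by (fastforce simp: hom_def)

lemma contract_right_add:
  "f \<in> left_hom B (regular A) (regular A) \<Longrightarrow> X \<in> carrier AA \<Longrightarrow> Y \<in> carrier AA \<Longrightarrow>
    contract_right f (X \<otimes>\<^bsub>AA\<^esub> Y) = contract_right f X \<oplus> contract_right f Y"
  using hom_mult[OF contract_right_hom] by simp

lemma contract_left_add:
  "f \<in> right_hom B (regular A) (regular A) \<Longrightarrow> X \<in> carrier AA \<Longrightarrow> Y \<in> carrier AA \<Longrightarrow>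
    contract_left f (X \<otimes>\<^bsub>AA\<^esub> Y) = contract_left f X \<oplus> contract_left f Y"
  using hom_mult[OF contract_left_hom] by simp

lemma contract_right_lact:
  assumes "f \<in> left_hom B (regular A) (regular A)" "a \<in> carrier A" "X \<in> carrier AA"
  shows "contract_right f (a \<triangleright>\<^bsub>AA\<^esub> X) = a \<otimes> contract_right f X"
  using assms(3,1,2)
  by (induction rule: AA.tensor_induct)
    (simp_all add: AA.lact_pure AA.MN.lact_add contract_right_pure contract_right_add
      left_homD A.m_assoc A.r_distr)

lemma contract_left_ract:
  assumes "f \<in> right_hom B (regular A) (regular A)" "a \<in> carrier A" "X \<in> carrier AA"
  shows "contract_left f (X \<triangleleft>\<^bsub>AA\<^esub> a) = contract_left f X \<otimes> a"
  using assms(3,1,2)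
  by (induction rule: AA.tensor_induct)
    (simp_all add: AA.ract_pure AA.MN.ract_add contract_left_pure contract_left_add
      right_homD A.m_assoc A.l_distr)

lemma contract_right_ract_End:
  assumes "f \<in> End" "b \<in> B" "X \<in> carrier AA"
  shows "contract_right f (X \<triangleleft>\<^bsub>AA\<^esub> b) = contract_right f X \<otimes> b"
  using assms(3,1,2)
  by (induction rule: AA.tensor_induct)
    (simp_all add: AA.ract_pure AA.MN.ract_add contract_right_pure contract_right_add
      EndD End_left_hom A.m_assoc A.l_distr)

lemma contract_left_lact_End:
  assumes "f \<in> End" "b \<in> B" "X \<in> carrier AA"
  shows "contract_left f (b \<triangleright>\<^bsub>AA\<^esub> X) = b \<otimes> contract_left f X"
  using assms(3,1,2)
  by (induction rule: AA.tensor_induct)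
    (simp_all add: AA.lact_pure AA.MN.lact_add contract_left_pure contract_left_add
      EndD End_right_hom A.m_assoc A.r_distr)

text \<open>Left multiplication by p extends the hypothesis from \<open>1 \<otimes> q\<close> to
  \<open>p \<otimes> q\<close>, and additivity extends it to all tensors: the u form a finite
  generating family of the left A-module \<open>A \<otimes>\<^sub>B A\<close> with the contractions
  as coordinates.\<close>

lemma quasibasis_expansion:
  fixes n :: nat
  assumes \<gamma>: "\<And>i. i < n \<Longrightarrow> \<gamma> i \<in> End" and u: "\<And>i. i < n \<Longrightarrow> u i \<in> centralized"
    and id: "\<And>a. a \<in> carrier A \<Longrightarrow> \<one> \<otimes>\<^sub>B a = finprod AA (\<lambda>i. \<gamma> i a \<triangleright>\<^bsub>AA\<^esub> u i) {..<n}"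
    and X: "X \<in> carrier AA"
  shows "X = finprod AA (\<lambda>i. contract_right (\<gamma> i) X \<triangleright>\<^bsub>AA\<^esub> u i) {..<n}"
proof (rule AA.hom_ext[OF _ _ _ X])
  show "(\<lambda>X. X) \<in> hom AA AA" by (rule homI) auto
  have "(\<lambda>X. contract_right (\<gamma> i) X \<triangleright>\<^bsub>AA\<^esub> u i) \<in> hom AA AA" if "i < n" for i
    using hom_compose[OF contract_right_hom lact_scalar_hom] End_left_hom[OF \<gamma>] centralizedD(1)[OF u] that
    by (auto simp: comp_def)
  then show "(\<lambda>X. finprod AA (\<lambda>i. contract_right (\<gamma> i) X \<triangleright>\<^bsub>AA\<^esub> u i) {..<n}) \<in> hom AA AA"
    by (intro AA.MN.hom_finprod_pointwise AA.MN.is_group) simp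
  fix p q assume pq: "p \<in> carrier (regular A)" "q \<in> carrier (regular A)"
  have u': "u i \<in> carrier AA" "\<gamma> i q \<in> carrier A" if "i < n" for i
    using centralizedD(1)[OF u] EndD(3)[OF \<gamma>] that pq by auto
  have "p \<otimes>\<^sub>B q = p \<triangleright>\<^bsub>AA\<^esub> (\<one> \<otimes>\<^sub>B q)" using pq AA.lact_pure[of p \<one> q] by simp
  also have "\<dots> = p \<triangleright>\<^bsub>AA\<^esub> finprod AA (\<lambda>i. \<gamma> i q \<triangleright>\<^bsub>AA\<^esub> u i) {..<n}" using id pq by simp
  also have "\<dots> = finprod AA (\<lambda>i. p \<triangleright>\<^bsub>AA\<^esub> (\<gamma> i q \<triangleright>\<^bsub>AA\<^esub> u i)) {..<n}"
    using pq u' by (intro comm_group_hom_finprod AA.MN.comm_group_axioms AA.MN.lact_hom) auto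
  also have "\<dots> = finprod AA (\<lambda>i. contract_right (\<gamma> i) (p \<otimes>\<^sub>B q) \<triangleright>\<^bsub>AA\<^esub> u i) {..<n}"
    using pq u' by (intro AA.MN.finprod_cong'[OF refl]) (auto simp: lact_lact contract_right_pure End_left_hom[OF \<gamma>])
  finally show "p \<otimes>\<^sub>B q = finprod AA (\<lambda>i. contract_right (\<gamma> i) (p \<otimes>\<^sub>B q) \<triangleright>\<^bsub>AA\<^esub> u i) {..<n}" .
qed

text \<open>A translation of the decomposition of the identity: a bimodule map f out of the tensor
  square corresponds to \<open>a \<mapsto> f (1 \<otimes> a)\<close> in \<open>End\<close>, a
  bimodule map g into it to the centralized element g 1.\<close>

lemma right_depth_two_iff:
  "right_depth_two A B \<longleftrightarrow> (\<exists>(n :: nat) \<gamma> u. (\<forall>i<n. \<gamma> i \<in> End \<and> u i \<in> centralized) \<and>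
     (\<forall>a\<in>carrier A. \<one> \<otimes>\<^sub>B a = finprod AA (\<lambda>i. \<gamma> i a \<triangleright>\<^bsub>AA\<^esub> u i) {..<n}))"
proof -
  have bimods: "bimod (carrier A) B AA" "bimod (carrier A) B (regular A)"
    by (intro AA.MN.bimod_subset reg.bimod_subset B_subset order_refl)+
  have "right_depth_two A B \<longleftrightarrow> (\<exists>n (f :: nat \<Rightarrow> ('a, 'a) tensor \<Rightarrow> 'a) g.
      (\<forall>i<n. f i \<in> bimodule_hom (carrier A) B AA (regular A) \<and> g i \<in> bimodule_hom (carrier A) B (regular A) AA) \<and>
       (\<forall>X\<in>carrier AA. X = finprod AA (\<lambda>i. g i (f i X)) {..<n}))"
    unfolding right_depth_two_def tensor_square_summand_def tensor_square_def Let_def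
    using summand_of_copies_iff[OF bimods] by simp
  also have "\<dots> \<longleftrightarrow> (\<exists>(n :: nat) \<gamma> u. (\<forall>i<n. \<gamma> i \<in> End \<and> u i \<in> centralized) \<and>
     (\<forall>a\<in>carrier A. \<one> \<otimes>\<^sub>B a = finprod AA (\<lambda>i. \<gamma> i a \<triangleright>\<^bsub>AA\<^esub> u i) {..<n}))"
  proof (intro iffI; elim exE conjE)
    fix n :: nat and f :: "nat \<Rightarrow> ('a, 'a) tensor \<Rightarrow> 'a" and g
    assume fg: "\<forall>i<n. f i \<in> bimodule_hom (carrier A) B AA (regular A) \<and> g i \<in> bimodule_hom (carrier A) B (regular A) AA"
      and id: "\<forall>X\<in>carrier AA. X = finprod AA (\<lambda>i. g i (f i X)) {..<n}"
    define \<gamma> where "\<gamma> i a = f i (\<one> \<otimes>\<^sub>B a)" for i a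
    define u where "u i = g i \<one>" for i
    have f: "f i \<in> bimodule_hom (carrier A) B AA (regular A)" and g: "g i \<in> bimodule_hom (carrier A) B (regular A) AA"
      if "i < n" for i
      using fg that by auto
    have "\<gamma> i \<in> End" if i: "i < n" for i
    proof (rule bimodule_homI)
      show "\<gamma> i \<in> hom (regular A) (regular A)"
        unfolding \<gamma>_def using bimodule_homD(4,5)[OF f[OF i]] AA.pure_add_right[of \<one>] by (intro homI) simp_all
      show "\<gamma> i (l \<triangleright>\<^bsub>regular A\<^esub> m) = l \<triangleright>\<^bsub>regular A\<^esub> \<gamma> i m" if "l \<in> B" "m \<in> carrier (regular A)" for l m
        using that bimodule_homD(2)[OF f[OF i], of l "\<one> \<otimes>\<^sub>B m"] AA.pure_balanced[of \<one> l m] AA.lact_pure[of l \<one> m]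
        by (simp add: \<gamma>_def)
      show "\<gamma> i (m \<triangleleft>\<^bsub>regular A\<^esub> r) = \<gamma> i m \<triangleleft>\<^bsub>regular A\<^esub> r" if "r \<in> B" "m \<in> carrier (regular A)" for r m
        using that bimodule_homD(3)[OF f[OF i], of r "\<one> \<otimes>\<^sub>B m"] AA.ract_pure[of r \<one> m]
        by (simp add: \<gamma>_def)
    qed
    moreover have "u i \<in> centralized" if i: "i < n" for i
    proof -
      have "b \<triangleright>\<^bsub>AA\<^esub> g i \<one> = g i \<one> \<triangleleft>\<^bsub>AA\<^esub> b" if "b \<in> B" for b
        using that bimodule_homD(2)[OF g[OF i], of b \<one>] bimodule_homD(3)[OF g[OF i], of b \<one>] by simp
      then show ?thesis
        using bimodule_homD(4)[OF g[OF i], of \<one>] by (simp add: centralized_def u_def)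
    qed
    moreover have "\<one> \<otimes>\<^sub>B a = finprod AA (\<lambda>i. \<gamma> i a \<triangleright>\<^bsub>AA\<^esub> u i) {..<n}" if a: "a \<in> carrier A" for a
    proof -
      have "\<one> \<otimes>\<^sub>B a = finprod AA (\<lambda>i. g i (f i (\<one> \<otimes>\<^sub>B a))) {..<n}"
        using id a by simp
      also have "\<dots> = finprod AA (\<lambda>i. \<gamma> i a \<triangleright>\<^bsub>AA\<^esub> u i) {..<n}"
      proof (rule AA.MN.finprod_cong'[OF refl])
        show "g i (f i (\<one> \<otimes>\<^sub>B a)) = \<gamma> i a \<triangleright>\<^bsub>AA\<^esub> u i" if "i \<in> {..<n}" for i
          using a that bimodule_homD(2)[OF g, of i "f i (\<one> \<otimes>\<^sub>B a)" \<one>] bimodule_homD(4)[OF f, of i "\<one> \<otimes>\<^sub>B a"]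
          by (simp add: \<gamma>_def u_def)
        show "(\<lambda>i. \<gamma> i a \<triangleright>\<^bsub>AA\<^esub> u i) \<in> {..<n} \<rightarrow> carrier AA"
          using a bimodule_homD(4)[OF f] bimodule_homD(4)[OF g] by (auto simp: \<gamma>_def u_def)
      qed
      finally show ?thesis .
    qed
    ultimately show "\<exists>(n :: nat) \<gamma> u. (\<forall>i<n. \<gamma> i \<in> End \<and> u i \<in> centralized) \<and>
      (\<forall>a\<in>carrier A. \<one> \<otimes>\<^sub>B a = finprod AA (\<lambda>i. \<gamma> i a \<triangleright>\<^bsub>AA\<^esub> u i) {..<n})" by blast
  next
    fix n :: nat and \<gamma> u
    assume gu: "\<forall>i<n. \<gamma> i \<in> End \<and> u i \<in> centralized"
      and id: "\<forall>a\<in>carrier A. \<one> \<otimes>\<^sub>B a = finprod AA (\<lambda>i. \<gamma> i a \<triangleright>\<^bsub>AA\<^esub> u i) {..<n}"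
    have c: "contract_right (\<gamma> i) \<in> bimodule_hom (carrier A) B AA (regular A)" if "i < n" for i
      using gu that
      by (intro bimodule_homI) (simp_all add: contract_right_hom contract_right_lact contract_right_ract_End End_left_hom)
    have g: "(\<lambda>a. a \<triangleright>\<^bsub>AA\<^esub> u i) \<in> bimodule_hom (carrier A) B (regular A) AA" if "i < n" for i
      using gu that
      by (intro bimodule_homI) (simp_all add: lact_scalar_hom centralizedD lact_lact AA.MN.act_assoc[symmetric] flip: centralizedD(2))
    have id': "X = finprod AA (\<lambda>i. contract_right (\<gamma> i) X \<triangleright>\<^bsub>AA\<^esub> u i) {..<n}" if "X \<in> carrier AA" for X
      using that gu id by (intro quasibasis_expansion) auto
    show "\<exists>n (f :: nat \<Rightarrow> ('a, 'a) tensor \<Rightarrow> 'a) g.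
      (\<forall>i<n. f i \<in> bimodule_hom (carrier A) B AA (regular A) \<and> g i \<in> bimodule_hom (carrier A) B (regular A) AA) \<and>
       (\<forall>X\<in>carrier AA. X = finprod AA (\<lambda>i. g i (f i X)) {..<n})"
      by (intro exI[of _ n] exI[of _ "\<lambda>i. contract_right (\<gamma> i)"] exI[of _ "\<lambda>i a. a \<triangleright>\<^bsub>AA\<^esub> u i"]
          conjI allI impI ballI c g id')
  qed
  finally show ?thesis .
qed

text \<open>The mirror image for right multiplication: an identity for \<open>a \<otimes> 1\<close>
  extends to all tensors, with \<open>contract_left\<close> supplying the coordinates.\<close>

lemma left_depth_twoI:
  fixes n :: nat
  assumes dt: "\<forall>i<n. \<delta> i \<in> End \<and> t i \<in> centralized"
    and id: "\<forall>a\<in>carrier A. a \<otimes>\<^sub>B \<one> = finprod AA (\<lambda>i. t i \<triangleleft>\<^bsub>AA\<^esub> \<delta> i a) {..<n}"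
  shows "left_depth_two A B"
proof -
  have bimods: "bimod B (carrier A) AA" "bimod B (carrier A) (regular A)"
    by (intro AA.MN.bimod_subset reg.bimod_subset B_subset order_refl)+
  have c: "contract_left (\<delta> i) \<in> bimodule_hom B (carrier A) AA (regular A)" if "i < n" for i
    using dt that
    by (intro bimodule_homI) (simp_all add: contract_left_hom contract_left_ract contract_left_lact_End End_right_hom)
  have g: "(\<lambda>a. t i \<triangleleft>\<^bsub>AA\<^esub> a) \<in> bimodule_hom B (carrier A) (regular A) AA" if "i < n" for i
    using dt that
    by (intro bimodule_homI) (simp_all add: ract_scalar_hom centralizedD ract_ract AA.MN.act_assoc flip: ract_ract)
  have id': "X = finprod AA (\<lambda>i. t i \<triangleleft>\<^bsub>AA\<^esub> contract_left (\<delta> i) X) {..<n}" if X: "X \<in> carrier AA" for X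
  proof (rule AA.hom_ext[OF _ _ _ X])
    show "(\<lambda>X. X) \<in> hom AA AA" by (rule homI) auto
    have "(\<lambda>X. t i \<triangleleft>\<^bsub>AA\<^esub> contract_left (\<delta> i) X) \<in> hom AA AA" if "i < n" for i
      using bimodule_homD(1)[OF bimodule_hom_compose[OF c g]] that by blast
    then show "(\<lambda>X. finprod AA (\<lambda>i. t i \<triangleleft>\<^bsub>AA\<^esub> contract_left (\<delta> i) X) {..<n}) \<in> hom AA AA"
      by (intro AA.MN.hom_finprod_pointwise AA.MN.is_group) simp
    fix p q assume pq: "p \<in> carrier (regular A)" "q \<in> carrier (regular A)"
    have u: "t i \<in> carrier AA" "\<delta> i p \<in> carrier A" if "i < n" for i using dt centralizedD EndD(3) that pq by auto
    have "p \<otimes>\<^sub>B q = (p \<otimes>\<^sub>B \<one>) \<triangleleft>\<^bsub>AA\<^esub> q" using pq AA.ract_pure[of q p \<one>] by simp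
    also have "\<dots> = finprod AA (\<lambda>i. t i \<triangleleft>\<^bsub>AA\<^esub> \<delta> i p) {..<n} \<triangleleft>\<^bsub>AA\<^esub> q" using id pq by simp
    also have "\<dots> = finprod AA (\<lambda>i. (t i \<triangleleft>\<^bsub>AA\<^esub> \<delta> i p) \<triangleleft>\<^bsub>AA\<^esub> q) {..<n}"
      using pq u by (intro comm_group_hom_finprod AA.MN.comm_group_axioms AA.MN.ract_hom) auto
    also have "\<dots> = finprod AA (\<lambda>i. t i \<triangleleft>\<^bsub>AA\<^esub> contract_left (\<delta> i) (p \<otimes>\<^sub>B q)) {..<n}"
      using pq u dt by (intro AA.MN.finprod_cong) (auto simp: simp_implies_def ract_ract contract_left_pure End_right_hom)
    finally show "p \<otimes>\<^sub>B q = finprod AA (\<lambda>i. t i \<triangleleft>\<^bsub>AA\<^esub> contract_left (\<delta> i) (p \<otimes>\<^sub>B q)) {..<n}" .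
  qed
  show ?thesis
    unfolding left_depth_two_def tensor_square_summand_def tensor_square_def Let_def
      summand_of_copies_iff[OF bimods]
    by (intro exI[of _ n] exI[of _ "\<lambda>i. contract_left (\<delta> i)"] exI[of _ "\<lambda>i a. t i \<triangleleft>\<^bsub>AA\<^esub> a"]
        conjI allI impI ballI c g id')
qed

end

section \<open>Frobenius systems and the passage from right to left depth two\<close>

context ring_extension
begin

text \<open>Right modules are treated as bimodules with an empty set of left scalars, so the
  decomposition of the identity applies. A right B-linear map out of B is left multiplication by its
  value at 1; these values are the x.\<close>

lemma right_dual_basis:
  assumes "right_fg_projective (A\<lparr>carrier := B\<rparr>) (regular A)"
  obtains n :: nat and x f where "\<And>i. i < n \<Longrightarrow> x i \<in> carrier A"
    and "\<And>i. i < n \<Longrightarrow> f i \<in> right_hom B (regular A) (regular (A\<lparr>carrier := B\<rparr>))"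
    and "\<And>a. a \<in> carrier A \<Longrightarrow> a = finprod (regular A) (\<lambda>i. x i \<otimes> f i a) {..<n}"
proof -
  let ?N = "regular (A\<lparr>carrier := B\<rparr>)"
  have N: "bimod B B ?N"
    using bimod_regular[OF A.subring_is_ring[OF subring]] by simp
  have bimods: "bimod {} B (regular A)" "bimod {} B ?N"
    by (auto intro!: reg.bimod_subset B_subset bimod.bimod_subset[OF N])
  have subs: "sub_bimodule {} B F = right_submodule B F" for F :: "('a, 'a, nat \<Rightarrow> 'a) bimodule"
    by (auto simp: sub_bimodule_def left_submodule_def right_submodule_def fun_eq_iff)
  have homs: "bimodule_hom {} B M K = right_hom B M K" for M :: "('a, 'a, 'm) bimodule" and K :: "('a, 'a, 'n) bimodule"
    by (auto simp: bimodule_hom_def left_hom_def right_hom_def)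
  obtain n where "iso_to_summand (bimodule_hom {} B (regular A) (copies n ?N))
      (sub_bimodule {} B (copies n ?N)) (regular A) (copies n ?N)"
    using assms unfolding right_fg_projective_def Let_def homs subs by auto
  then obtain f g where fg': "\<forall>i<n. f i \<in> bimodule_hom {} B (regular A) ?N \<and> g i \<in> bimodule_hom {} B ?N (regular A)"
    and id: "\<forall>a\<in>carrier (regular A). a = finprod (regular A) (\<lambda>i. g i (f i a)) {..<n}"
    unfolding summand_of_copies_iff[OF bimods] by blast
  have fg: "f i \<in> bimodule_hom {} B (regular A) ?N" "g i \<in> bimodule_hom {} B ?N (regular A)" if "i < n" for i
    using fg' that by auto
  have one: "\<one> \<in> B" using subring by (rule subringE(3))
  have fB: "f i a \<in> B" if "i < n" "a \<in> carrier A" for i a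
    using bimodule_homD(4)[OF fg(1)] that by simp
  have gx: "g i b = g i \<one> \<otimes> b" if "i < n" "b \<in> B" for i b
    using bimodule_homD(3)[OF fg(2)[OF that(1)], of b \<one>] that one by simp
  show ?thesis
  proof
    show "g i \<one> \<in> carrier A" if "i < n" for i
      using bimodule_homD(4)[OF fg(2)] that one by simp
    show "f i \<in> right_hom B (regular A) ?N" if "i < n" for i
      using fg(1) that by (simp add: homs)
    show "a = finprod (regular A) (\<lambda>i. g i \<one> \<otimes> f i a) {..<n}" if a: "a \<in> carrier A" for a
    proof -
      have "a = finprod (regular A) (\<lambda>i. g i (f i a)) {..<n}" using bspec[OF id, of a] a by simp
      also have "\<dots> = finprod (regular A) (\<lambda>i. g i \<one> \<otimes> f i a) {..<n}"
      proof (rule reg.finprod_cong'[OF refl])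
        show "g i (f i a) = g i \<one> \<otimes> f i a" if "i \<in> {..<n}" for i
          using that a by (intro gx fB) auto
        show "(\<lambda>i. g i \<one> \<otimes> f i a) \<in> {..<n} \<rightarrow> carrier (regular A)"
          using a fB one bimodule_homD(4)[OF fg(2), of _ \<one>] by auto
      qed
      finally show ?thesis .
    qed
  qed
qed

text \<open>E is the image of 1 under the Frobenius isomorphism, and right A-linearity makes the
  image of any a the functional \<open>z \<mapsto> E (a z)\<close>. The functionals of a dual basis
  are then all of this form, which produces the y.\<close>

lemma frobenius_system:
  assumes "frobenius_extension A B"
  obtains n :: nat and x y E where "\<And>i. i < n \<Longrightarrow> x i \<in> carrier A" "\<And>i. i < n \<Longrightarrow> y i \<in> carrier A"
    and "E \<in> End" "\<And>a. a \<in> carrier A \<Longrightarrow> E a \<in> B"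
    and "\<And>a. a \<in> carrier A \<Longrightarrow> a = finprod (regular A) (\<lambda>i. x i \<otimes> E (y i \<otimes> a)) {..<n}"
    and "\<And>a. a \<in> carrier A \<Longrightarrow> a = finprod (regular A) (\<lambda>i. E (a \<otimes> x i) \<otimes> y i) {..<n}"
proof -
  let ?D = "dual_bimodule A B"
  obtain n :: nat and x f where x: "\<And>i. i < n \<Longrightarrow> x i \<in> carrier A"
    and f: "\<And>i. i < n \<Longrightarrow> f i \<in> right_hom B (regular A) (regular (A\<lparr>carrier := B\<rparr>))"
    and id: "\<And>a. a \<in> carrier A \<Longrightarrow> a = finprod (regular A) (\<lambda>i. x i \<otimes> f i a) {..<n}"
    using assms right_dual_basis unfolding frobenius_extension_def by blast
  obtain \<psi> where \<psi>: "\<psi> \<in> bimodule_hom B (carrier A) (regular A) ?D"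
    and bij: "bij_betw \<psi> (carrier A) (carrier ?D)"
    using assms unfolding frobenius_extension_def by blast
  define E where "E = \<psi> \<one>"
  have one: "\<one> \<in> B" using subring by (rule subringE(3))
  have \<psi>_eq: "\<psi> a = (\<lambda>z\<in>carrier A. E (a \<otimes> z))" if "a \<in> carrier A" for a
    using bimodule_homD(3)[OF \<psi>, of a \<one>] that by (simp add: E_def dual_bimodule_def)
  have "E \<in> carrier ?D" using bimodule_homD(4)[OF \<psi>, of \<one>] by (simp add: E_def)
  then have E_hom: "E \<in> right_hom B (regular A) (regular (A\<lparr>carrier := B\<rparr>))"
    by (simp add: dual_bimodule_def)
  then have E_B: "E a \<in> B" and E_add: "c \<in> carrier A \<Longrightarrow> E (a \<oplus> c) = E a \<oplus> E c"
    and E_right: "b \<in> B \<Longrightarrow> E (a \<otimes> b) = E a \<otimes> b" if "a \<in> carrier A" for a b c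
    using that by (auto simp: right_hom_def hom_def)
  \<comment> \<open>The image of b is computed twice, by right A-linearity from 1 and by left
    B-linearity from 1.\<close>
  have E_left: "E (b \<otimes> a) = b \<otimes> E a" if "b \<in> B" "a \<in> carrier A" for a b
  proof -
    have "E (b \<otimes> a) = \<psi> b a" using that \<psi>_eq[of b] by simp
    also have "\<psi> b = b \<triangleright>\<^bsub>?D\<^esub> E" using bimodule_homD(2)[OF \<psi>, of b \<one>] that by (simp add: E_def)
    also have "(b \<triangleright>\<^bsub>?D\<^esub> E) a = b \<otimes> E a" using that by (simp add: dual_bimodule_def)
    finally show ?thesis .
  qed
  have E_End: "E \<in> End"
    by (rule bimodule_homI) (auto intro!: homI simp: E_add E_B E_left E_right)
  \<comment> \<open>Surjectivity of the Frobenius isomorphism represents the functional f i; the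
    element c is the future y i.\<close>
  have "\<exists>c\<in>carrier A. \<forall>z\<in>carrier A. E (c \<otimes> z) = f i z" if "i < n" for i
  proof -
    have "restrict (f i) (carrier A) \<in> carrier ?D"
      using f[OF that] by (auto simp: dual_bimodule_def right_hom_def hom_def)
    then obtain c where c: "c \<in> carrier A" "\<psi> c = restrict (f i) (carrier A)"
      using bij by (metis bij_betw_iff_bijections)
    then have "E (c \<otimes> z) = f i z" if "z \<in> carrier A" for z
      using that \<psi>_eq[OF c(1)] by (metis restrict_apply')
    then show ?thesis using c(1) by blast
  qed
  then obtain y where y: "\<And>i. i < n \<Longrightarrow> y i \<in> carrier A" "\<And>i z. i < n \<Longrightarrow> z \<in> carrier A \<Longrightarrow> E (y i \<otimes> z) = f i z"
    by metis
  have Ec: "E a \<in> carrier A" if "a \<in> carrier A" for a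
    using E_B[OF that] by blast
  have id': "a = finprod (regular A) (\<lambda>i. x i \<otimes> E (y i \<otimes> a)) {..<n}" if "a \<in> carrier A" for a
  proof -
    have "a = finprod (regular A) (\<lambda>i. x i \<otimes> f i a) {..<n}" using id that .
    also have "\<dots> = finprod (regular A) (\<lambda>i. x i \<otimes> E (y i \<otimes> a)) {..<n}"
      using that x y(1) Ec by (intro reg.finprod_cong'[OF refl]) (auto simp: y(2)[symmetric])
    finally show ?thesis .
  qed
  have E_mult_hom: "(\<lambda>w. E (a \<otimes> w)) \<in> hom (regular A) (regular A)" "(\<lambda>w. E (w \<otimes> a)) \<in> hom (regular A) (regular A)"
    if "a \<in> carrier A" for a
    using that by (auto intro!: homI simp: A.r_distr A.l_distr Ec E_add)
  note E_finprod = E_mult_hom[THEN comm_group_hom_finprod[OF reg.comm_group_axioms reg.comm_group_axioms]]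
  have "a = finprod (regular A) (\<lambda>i. E (a \<otimes> x i) \<otimes> y i) {..<n}" (is "a = ?s") if a: "a \<in> carrier A" for a
  proof -
    have s: "?s \<in> carrier A"
      using reg.finprod_closed[of "\<lambda>i. E (a \<otimes> x i) \<otimes> y i" "{..<n}"] a x y E_B by auto
    \<comment> \<open>The second dual basis identity comes from injectivity: a and \<open>?s\<close>
      give the same functional, as the first identity applied to z shows.\<close>
    have "E (?s \<otimes> z) = E (a \<otimes> z)" if z: "z \<in> carrier A" for z
    proof -
      have "E (?s \<otimes> z) = finprod (regular A) (\<lambda>i. E (E (a \<otimes> x i) \<otimes> y i \<otimes> z)) {..<n}"
        using a x y(1) z Ec by (intro E_finprod(2)) auto
      also have "\<dots> = finprod (regular A) (\<lambda>i. E (a \<otimes> (x i \<otimes> E (y i \<otimes> z)))) {..<n}"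
      proof (rule reg.finprod_cong'[OF refl])
        show "E (E (a \<otimes> x i) \<otimes> y i \<otimes> z) = E (a \<otimes> (x i \<otimes> E (y i \<otimes> z)))" if "i \<in> {..<n}" for i
        proof -
          have i: "x i \<in> carrier A" "y i \<in> carrier A" using x y(1) that by auto
          have "E (E (a \<otimes> x i) \<otimes> y i \<otimes> z) = E (a \<otimes> x i) \<otimes> E (y i \<otimes> z)"
            using i a z Ec E_B by (simp add: A.m_assoc E_left)
          also have "\<dots> = E ((a \<otimes> x i) \<otimes> E (y i \<otimes> z))"
            using i a z E_B by (simp add: E_right)
          finally show ?thesis using i a z Ec by (simp add: A.m_assoc)
        qed
      qed (use a x y(1) z Ec in auto)
      also have "\<dots> = E (a \<otimes> finprod (regular A) (\<lambda>i. x i \<otimes> E (y i \<otimes> z)) {..<n})"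
        using a x y(1) z Ec by (intro E_finprod(1)[symmetric]) auto
      finally show ?thesis using id' z by simp
    qed
    then have "\<psi> a = \<psi> ?s" using a s by (auto simp: \<psi>_eq intro!: restrict_ext)
    then show ?thesis using bij a s by (auto simp: bij_betw_def inj_on_def)
  qed
  then show ?thesis using that x y(1) E_End E_B id' by blast
qed

text \<open>The dual bases move an element of B, and then an arbitrary a, from one side of the
  tensor sign to the other: values of E lie in B and may cross it.\<close>

lemma left_depth_two_if_right:
  assumes "frobenius_extension A B" "right_depth_two A B"
  shows "left_depth_two A B"
proof -
  obtain m :: nat and x y E where x: "\<And>k. k < m \<Longrightarrow> x k \<in> carrier A" and y: "\<And>k. k < m \<Longrightarrow> y k \<in> carrier A"
    and E: "E \<in> End" and E_B: "\<And>a. a \<in> carrier A \<Longrightarrow> E a \<in> B"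
    and id1: "\<And>a. a \<in> carrier A \<Longrightarrow> a = finprod (regular A) (\<lambda>k. x k \<otimes> E (y k \<otimes> a)) {..<m}"
    and id2: "\<And>a. a \<in> carrier A \<Longrightarrow> a = finprod (regular A) (\<lambda>k. E (a \<otimes> x k) \<otimes> y k) {..<m}"
    using frobenius_system[OF assms(1)] by blast
  obtain n :: nat and \<gamma> u where \<gamma>: "\<And>j. j < n \<Longrightarrow> \<gamma> j \<in> End" and u: "\<And>j. j < n \<Longrightarrow> u j \<in> centralized"
    and id: "\<And>a. a \<in> carrier A \<Longrightarrow> \<one> \<otimes>\<^sub>B a = finprod AA (\<lambda>j. \<gamma> j a \<triangleright>\<^bsub>AA\<^esub> u j) {..<n}"
    using assms(2) unfolding right_depth_two_iff by blast
  note E_simps = EndD[OF E]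
  have shift: "(\<lambda>q. E (q \<otimes> z)) \<in> left_hom B (regular A) (regular A)" if "z \<in> carrier A" for z
    using that by (auto simp: left_hom_def A.l_distr A.m_assoc E_simps intro!: homI)
  define \<delta> where "\<delta> j z = contract_right (\<lambda>q. E (q \<otimes> z)) (u j)" for j z
  define t where "t j = finprod AA (\<lambda>k. x k \<otimes>\<^sub>B \<gamma> j (y k)) {..<m}" for j
  have u': "u j \<in> carrier AA" and \<gamma>': "a \<in> carrier A \<Longrightarrow> \<gamma> j a \<in> carrier A" if "j < n" for j a
    using centralizedD(1)[OF u] EndD(3)[OF \<gamma>] that by auto
  have t': "t j \<in> carrier AA" if "j < n" for j
    unfolding t_def using that x y \<gamma>' by (intro AA.MN.finprod_closed) auto
  have \<delta>': "\<delta> j a \<in> carrier A" if "j < n" "a \<in> carrier A" for j a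
    unfolding \<delta>_def using shift u' that by auto
  \<comment> \<open>The quasibasis identity for \<open>1 \<otimes> a\<close>, contracted with the
    left B-linear map \<open>q \<mapsto> E (q z)\<close>.\<close>
  have E_mult: "E (a \<otimes> z) = finprod (regular A) (\<lambda>j. \<gamma> j a \<otimes> \<delta> j z) {..<n}"
    if "a \<in> carrier A" "z \<in> carrier A" for a z
  proof -
    have "E (a \<otimes> z) = contract_right (\<lambda>q. E (q \<otimes> z)) (\<one> \<otimes>\<^sub>B a)"
      using that shift E_simps by (simp add: contract_right_pure)
    also have "\<dots> = finprod (regular A) (\<lambda>j. contract_right (\<lambda>q. E (q \<otimes> z)) (\<gamma> j a \<triangleright>\<^bsub>AA\<^esub> u j)) {..<n}"
      unfolding id[OF that(1)] using that u' \<gamma>'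
      by (intro comm_group_hom_finprod AA.MN.comm_group_axioms reg.comm_group_axioms contract_right_hom shift) auto
    also have "\<dots> = finprod (regular A) (\<lambda>j. \<gamma> j a \<otimes> \<delta> j z) {..<n}"
      using that u' \<gamma>' shift
      by (intro reg.finprod_cong'[OF refl]) (auto simp: contract_right_lact \<delta>_def)
    finally show ?thesis .
  qed
  have "\<delta> j \<in> End" if j: "j < n" for j
  proof (rule bimodule_homI)
    have add: "contract_right (\<lambda>q. E (q \<otimes> (a \<oplus> c))) X =
      contract_right (\<lambda>q. E (q \<otimes> a)) X \<oplus> contract_right (\<lambda>q. E (q \<otimes> c)) X"
      if "a \<in> carrier A" "c \<in> carrier A" "X \<in> carrier AA" for a c X
      using that(3,1,2) shift E_simps
      by (induction rule: AA.tensor_induct)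
        (simp_all add: contract_right_pure contract_right_add A.r_distr A.a_ac)
    then show "\<delta> j \<in> hom (regular A) (regular A)"
      using u' j \<delta>' by (intro homI) (simp_all add: \<delta>_def)
    have "contract_right (\<lambda>q. E (q \<otimes> (b \<otimes> a))) X = contract_right (\<lambda>q. E (q \<otimes> a)) (X \<triangleleft>\<^bsub>AA\<^esub> b)"
      if "a \<in> carrier A" "b \<in> B" "X \<in> carrier AA" for a b X
      using that(3,1,2) shift E_simps
      by (induction rule: AA.tensor_induct)
        (simp_all add: contract_right_pure contract_right_add AA.ract_pure AA.MN.ract_add A.m_assoc)
    then show "\<delta> j (l \<triangleright>\<^bsub>regular A\<^esub> a) = l \<triangleright>\<^bsub>regular A\<^esub> \<delta> j a" if "l \<in> B" "a \<in> carrier (regular A)" for l a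
      using that u' j shift
      by (simp add: \<delta>_def centralizedD(2)[OF u, symmetric] contract_right_lact)
    have E_ab: "E (q \<otimes> (a \<otimes> b)) = E (q \<otimes> a) \<otimes> b"
      if "q \<in> carrier A" "a \<in> carrier A" "b \<in> B" for q a b
      using that E_simps(5)[of b "q \<otimes> a"] by (simp add: A.m_assoc)
    have "contract_right (\<lambda>q. E (q \<otimes> (a \<otimes> b))) X = contract_right (\<lambda>q. E (q \<otimes> a)) X \<otimes> b"
      if "a \<in> carrier A" "b \<in> B" "X \<in> carrier AA" for a b X
      using that(3,1,2) shift E_simps
      by (induction rule: AA.tensor_induct)
        (simp_all add: contract_right_pure contract_right_add E_ab A.l_distr A.m_assoc)
    then show "\<delta> j (a \<triangleleft>\<^bsub>regular A\<^esub> r) = \<delta> j a \<triangleleft>\<^bsub>regular A\<^esub> r" if "r \<in> B" "a \<in> carrier (regular A)" for r a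
      using that u' j by (simp add: \<delta>_def)
  qed
  moreover have "t j \<in> centralized" if j: "j < n" for j
  proof -
    note hom1 = comm_group_hom_finprod[OF reg.comm_group_axioms AA.MN.comm_group_axioms]
    note hom2 = comm_group_hom_finprod[OF AA.MN.comm_group_axioms AA.MN.comm_group_axioms]
    have "b \<triangleright>\<^bsub>AA\<^esub> t j = t j \<triangleleft>\<^bsub>AA\<^esub> b" if b: "b \<in> B" for b
    proof -
      have bc: "b \<in> carrier A" using b by blast
      \<comment> \<open>The matrix of multiplication by b in the dual bases. It expresses b x_k
        through the x_l and at the same time y_l b through the y_k; its entries lie in B, so they
        cross the tensor sign.\<close>
      define e where "e l k = E (y l \<otimes> (b \<otimes> x k))" for l k
      have eB: "e l k \<in> B" if "l < m" "k < m" for l k using that x y bc by (simp add: e_def E_B)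
      have "b \<triangleright>\<^bsub>AA\<^esub> t j = finprod AA (\<lambda>k. b \<triangleright>\<^bsub>AA\<^esub> (x k \<otimes>\<^sub>B \<gamma> j (y k))) {..<m}"
        unfolding t_def using bc x y \<gamma>'[OF j] by (intro hom2 AA.MN.lact_hom) auto
      also have "\<dots> = finprod AA (\<lambda>k. finprod AA (\<lambda>l. x l \<otimes>\<^sub>B \<gamma> j (e l k \<otimes> y k)) {..<m}) {..<m}"
      proof (rule AA.MN.finprod_cong'[OF refl])
        fix k assume "k \<in> {..<m}"
        then have k: "k < m" by simp
        have "b \<triangleright>\<^bsub>AA\<^esub> (x k \<otimes>\<^sub>B \<gamma> j (y k)) = (b \<otimes> x k) \<otimes>\<^sub>B \<gamma> j (y k)"
          using AA.lact_pure[of b "x k" "\<gamma> j (y k)"] bc x y k \<gamma>'[OF j] by simp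
        also have "b \<otimes> x k = finprod (regular A) (\<lambda>l. x l \<otimes> e l k) {..<m}"
          unfolding e_def using bc x k by (intro id1) auto
        also have "\<dots> \<otimes>\<^sub>B \<gamma> j (y k) = finprod AA (\<lambda>l. (x l \<otimes> e l k) \<otimes>\<^sub>B \<gamma> j (y k)) {..<m}"
          using x y k \<gamma>'[OF j] eB by (intro hom1 AA.pure_hom_left) auto
        also have "\<dots> = finprod AA (\<lambda>l. x l \<otimes>\<^sub>B \<gamma> j (e l k \<otimes> y k)) {..<m}"
          using x y k \<gamma>'[OF j] eB
          by (intro AA.MN.finprod_cong'[OF refl]) (auto simp: pure_shift EndD[OF \<gamma>[OF j]] intro!: AA.pure_closed)
        finally show "b \<triangleright>\<^bsub>AA\<^esub> (x k \<otimes>\<^sub>B \<gamma> j (y k)) = finprod AA (\<lambda>l. x l \<otimes>\<^sub>B \<gamma> j (e l k \<otimes> y k)) {..<m}" .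
      qed (use x y \<gamma>'[OF j] eB in \<open>auto intro!: AA.MN.finprod_closed AA.pure_closed\<close>)
      \<comment> \<open>After the exchange the inner sum runs over k and can be collapsed to y_l b
        inside the additive map \<open>\<gamma> j\<close>.\<close>
      also have "\<dots> = finprod AA (\<lambda>l. finprod AA (\<lambda>k. x l \<otimes>\<^sub>B \<gamma> j (e l k \<otimes> y k)) {..<m}) {..<m}"
        using x y \<gamma>'[OF j] eB by (intro AA.MN.finprod_swap) (auto intro!: AA.pure_closed)
      also have "\<dots> = finprod AA (\<lambda>l. (x l \<otimes>\<^sub>B \<gamma> j (y l)) \<triangleleft>\<^bsub>AA\<^esub> b) {..<m}"
      proof (rule AA.MN.finprod_cong'[OF refl])
        fix l assume "l \<in> {..<m}"
        then have l: "l < m" by simp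
        have "finprod AA (\<lambda>k. x l \<otimes>\<^sub>B \<gamma> j (e l k \<otimes> y k)) {..<m} = x l \<otimes>\<^sub>B \<gamma> j (finprod (regular A) (\<lambda>k. e l k \<otimes> y k) {..<m})"
        proof (rule hom1[symmetric])
          show "(\<lambda>w. x l \<otimes>\<^sub>B \<gamma> j w) \<in> hom (regular A) AA"
            using x[OF l] \<gamma>'[OF j] AA.pure_add_right[of "x l"] EndD(4)[OF \<gamma>[OF j]] by (intro homI) simp_all
        qed (use x y eB l in auto)
        also have "finprod (regular A) (\<lambda>k. e l k \<otimes> y k) {..<m} = finprod (regular A) (\<lambda>k. E (y l \<otimes> b \<otimes> x k) \<otimes> y k) {..<m}"
          unfolding e_def using x y l bc E_simps
          by (intro reg.finprod_cong'[OF refl]) (auto simp: A.m_assoc)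
        also have "\<dots> = y l \<otimes> b" using id2[of "y l \<otimes> b"] y l bc by simp
        also have "x l \<otimes>\<^sub>B \<gamma> j (y l \<otimes> b) = (x l \<otimes>\<^sub>B \<gamma> j (y l)) \<triangleleft>\<^bsub>AA\<^esub> b"
          using AA.ract_pure[of b "x l" "\<gamma> j (y l)"] x y l b \<gamma>'[OF j] EndD[OF \<gamma>[OF j]] by simp
        finally show "finprod AA (\<lambda>k. x l \<otimes>\<^sub>B \<gamma> j (e l k \<otimes> y k)) {..<m} = (x l \<otimes>\<^sub>B \<gamma> j (y l)) \<triangleleft>\<^bsub>AA\<^esub> b" .
      qed (use x y \<gamma>'[OF j] bc in \<open>auto intro!: AA.pure_closed\<close>)
      also have "\<dots> = t j \<triangleleft>\<^bsub>AA\<^esub> b"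
        unfolding t_def using bc x y \<gamma>'[OF j] by (intro hom2[symmetric] AA.MN.ract_hom) auto
      finally show ?thesis .
    qed
    then show ?thesis using t'[OF j] by (simp add: centralized_def)
  qed
  moreover have "a \<otimes>\<^sub>B \<one> = finprod AA (\<lambda>j. t j \<triangleleft>\<^bsub>AA\<^esub> \<delta> j a) {..<n}" if a: "a \<in> carrier A" for a
  proof -
    note hom1 = comm_group_hom_finprod[OF reg.comm_group_axioms AA.MN.comm_group_axioms]
    have "a \<otimes>\<^sub>B \<one> = finprod (regular A) (\<lambda>k. x k \<otimes> E (y k \<otimes> a)) {..<m} \<otimes>\<^sub>B \<one>"
      using id1[OF a] by simp
    also have "\<dots> = finprod AA (\<lambda>k. (x k \<otimes> E (y k \<otimes> a)) \<otimes>\<^sub>B \<one>) {..<m}"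
      using a x y E_simps by (intro hom1 AA.pure_hom_left) auto
    also have "\<dots> = finprod AA (\<lambda>k. finprod AA (\<lambda>j. (x k \<otimes>\<^sub>B \<gamma> j (y k)) \<triangleleft>\<^bsub>AA\<^esub> \<delta> j a) {..<n}) {..<m}"
    proof (rule AA.MN.finprod_cong'[OF refl])
      fix k assume "k \<in> {..<m}"
      then have k: "x k \<in> carrier A" "y k \<in> carrier A" using x y by auto
      \<comment> \<open>The coefficient E (y_k a) lies in B and moves to the right factor, where
        \<open>E_mult\<close> splits it into the parts that make up t and
        \<open>\<delta>\<close>.\<close>
      have "(x k \<otimes> E (y k \<otimes> a)) \<otimes>\<^sub>B \<one> = x k \<otimes>\<^sub>B E (y k \<otimes> a)"
        using k a E_B pure_shift[of "x k" "E (y k \<otimes> a)" \<one>] by simp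
      also have "\<dots> = finprod AA (\<lambda>j. x k \<otimes>\<^sub>B (\<gamma> j (y k) \<otimes> \<delta> j a)) {..<n}"
        unfolding E_mult[OF k(2) a] using k a \<gamma>' \<delta>' by (intro hom1 AA.pure_hom_right) auto
      also have "\<dots> = finprod AA (\<lambda>j. (x k \<otimes>\<^sub>B \<gamma> j (y k)) \<triangleleft>\<^bsub>AA\<^esub> \<delta> j a) {..<n}"
        using k a \<gamma>' \<delta>' AA.ract_pure
        by (intro AA.MN.finprod_cong'[OF refl]) (auto intro!: AA.pure_closed)
      finally show "(x k \<otimes> E (y k \<otimes> a)) \<otimes>\<^sub>B \<one> = finprod AA (\<lambda>j. (x k \<otimes>\<^sub>B \<gamma> j (y k)) \<triangleleft>\<^bsub>AA\<^esub> \<delta> j a) {..<n}" .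
    qed (use a x y \<gamma>' \<delta>' in \<open>auto intro!: AA.MN.finprod_closed AA.pure_closed AA.MN.ract_closed\<close>)
    also have "\<dots> = finprod AA (\<lambda>j. finprod AA (\<lambda>k. (x k \<otimes>\<^sub>B \<gamma> j (y k)) \<triangleleft>\<^bsub>AA\<^esub> \<delta> j a) {..<m}) {..<n}"
      using a x y \<gamma>' \<delta>' by (intro AA.MN.finprod_swap) (auto intro!: AA.pure_closed AA.MN.ract_closed)
    also have "\<dots> = finprod AA (\<lambda>j. t j \<triangleleft>\<^bsub>AA\<^esub> \<delta> j a) {..<n}"
    proof (rule AA.MN.finprod_cong'[OF refl])
      fix j assume "j \<in> {..<n}"
      then show "finprod AA (\<lambda>k. (x k \<otimes>\<^sub>B \<gamma> j (y k)) \<triangleleft>\<^bsub>AA\<^esub> \<delta> j a) {..<m} = t j \<triangleleft>\<^bsub>AA\<^esub> \<delta> j a"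
        unfolding t_def using a x y \<gamma>' \<delta>'
        by (intro comm_group_hom_finprod[symmetric] AA.MN.comm_group_axioms AA.MN.ract_hom) auto
    qed (use a t' \<delta>' in auto)
    finally show ?thesis .
  qed
  ultimately show ?thesis
    by (intro left_depth_twoI[of n \<delta> t]) blast+
qed

end

section \<open>Galois extensions are of depth two and balanced\<close>

lemma bimodule_hom_left_scalars:
  "bimodule_hom L {} M N = left_hom L M N"
  "sub_bimodule L {} M = left_submodule L M"
  by (auto simp: bimodule_hom_def left_hom_def right_hom_def sub_bimodule_def
      left_submodule_def right_submodule_def fun_eq_iff)

text \<open>The decomposition of the identity with empty right scalars; a left linear map out of R
  is given by its value at 1.\<close>

lemma left_dual_basis:
  fixes R :: "('r, 'x) ring_scheme" and M :: "('r, 'r, 'm) bimodule"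
  assumes R: "ring R" and M: "bimod (carrier R) K M" and fgp: "left_fg_projective R M"
  obtains n :: nat and \<phi> u where "\<And>i. i < n \<Longrightarrow> \<phi> i \<in> left_hom (carrier R) M (regular R)"
    and "\<And>i. i < n \<Longrightarrow> u i \<in> carrier M"
    and "\<And>m. m \<in> carrier M \<Longrightarrow> m = finprod M (\<lambda>i. \<phi> i m \<triangleright>\<^bsub>M\<^esub> u i) {..<n}"
proof -
  interpret R: ring R by fact
  interpret M: bimod "carrier R" K M by fact
  have bimods: "bimod (carrier R) {} M" "bimod (carrier R) {} (regular R)"
    by (auto intro!: M.bimod_subset bimod.bimod_subset[OF bimod_regular[OF R]])
  obtain n where "iso_to_summand (bimodule_hom (carrier R) {} M (copies n (regular R)))
      (sub_bimodule (carrier R) {} (copies n (regular R))) M (copies n (regular R))"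
    using fgp unfolding left_fg_projective_def Let_def bimodule_hom_left_scalars by auto
  then obtain f g where fg: "\<forall>i<n. f i \<in> left_hom (carrier R) M (regular R) \<and> g i \<in> left_hom (carrier R) (regular R) M"
    and id: "\<forall>m\<in>carrier M. m = finprod M (\<lambda>i. g i (f i m)) {..<n}"
    unfolding summand_of_copies_iff[OF bimods] unfolding bimodule_hom_left_scalars by blast
  have f: "f i m \<in> carrier R" if "i < n" "m \<in> carrier M" for i m
    using fg that by (auto simp: left_hom_def hom_def)
  have g: "g i \<one>\<^bsub>R\<^esub> \<in> carrier M" "r \<in> carrier R \<Longrightarrow> g i r = r \<triangleright>\<^bsub>M\<^esub> g i \<one>\<^bsub>R\<^esub>" if "i < n" for i r
  proof -
    have "g i \<in> left_hom (carrier R) (regular R) M" using fg that by blast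
    then show "g i \<one>\<^bsub>R\<^esub> \<in> carrier M" by (auto simp: left_hom_def hom_def)
    assume "r \<in> carrier R"
    moreover have "\<forall>l\<in>carrier R. \<forall>m\<in>carrier R. g i (l \<otimes>\<^bsub>R\<^esub> m) = l \<triangleright>\<^bsub>M\<^esub> g i m"
      using \<open>g i \<in> left_hom (carrier R) (regular R) M\<close> by (simp add: left_hom_def)
    ultimately have "g i (r \<otimes>\<^bsub>R\<^esub> \<one>\<^bsub>R\<^esub>) = r \<triangleright>\<^bsub>M\<^esub> g i \<one>\<^bsub>R\<^esub>" by blast
    then show "g i r = r \<triangleright>\<^bsub>M\<^esub> g i \<one>\<^bsub>R\<^esub>" using \<open>r \<in> carrier R\<close> by simp
  qed
  show ?thesis
  proof
    show "f i \<in> left_hom (carrier R) M (regular R)" if "i < n" for i using fg that by blast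
    show "g i \<one>\<^bsub>R\<^esub> \<in> carrier M" if "i < n" for i using g(1) that .
    show "m = finprod M (\<lambda>i. f i m \<triangleright>\<^bsub>M\<^esub> g i \<one>\<^bsub>R\<^esub>) {..<n}" if m: "m \<in> carrier M" for m
    proof -
      have "m = finprod M (\<lambda>i. g i (f i m)) {..<n}" using bspec[OF id m] .
      also have "\<dots> = finprod M (\<lambda>i. f i m \<triangleright>\<^bsub>M\<^esub> g i \<one>\<^bsub>R\<^esub>) {..<n}"
      proof (rule M.finprod_cong'[OF refl])
        show "g i (f i m) = f i m \<triangleright>\<^bsub>M\<^esub> g i \<one>\<^bsub>R\<^esub>" if "i \<in> {..<n}" for i
          using that m by (intro g(2) f) auto
      qed (use f g(1) m in auto)
      finally show ?thesis .
    qed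
  qed
qed

text \<open>Covers \<open>A \<otimes>\<^sub>R T\<close> and \<open>T \<otimes>\<^sub>R T\<close>
  together: in both, the scalars over which the tensor product is taken act by right
  multiplications, on the left factor through \<open>\<sigma>\<close> and on the right factor
  through \<open>\<tau>\<close>. The outer actions \<open>lf\<close> and \<open>rf\<close> differ
  between the cases and are left open.\<close>

locale algebra_pair =
  S: ring S + A: ring A + T: ring T
  for S :: "('s, 'u) ring_scheme" and A :: "('a, 'v) ring_scheme" and T :: "('t, 'w) ring_scheme"
    and \<sigma> :: "'s \<Rightarrow> 'a" and \<tau> :: "'s \<Rightarrow> 't"
    and L :: "'l set" and R :: "'r set" and lf :: "'l \<Rightarrow> 'a \<Rightarrow> 'a" and rf :: "'t \<Rightarrow> 'r \<Rightarrow> 't" +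
  assumes \<sigma>_hom: "\<sigma> \<in> ring_hom S A"
    and \<tau>_closed: "r \<in> carrier S \<Longrightarrow> \<tau> r \<in> carrier T"
    and bimod_M: "bimod L (carrier S) (bimodule_on A lf (\<lambda>a r. a \<otimes>\<^bsub>A\<^esub> \<sigma> r))"
    and bimod_N: "bimod (carrier S) R (bimodule_on T (\<lambda>r x. x \<otimes>\<^bsub>T\<^esub> \<tau> r) rf)"
begin

abbreviation M :: "('l, 's, 'a) bimodule" where "M \<equiv> bimodule_on A lf (\<lambda>a r. a \<otimes>\<^bsub>A\<^esub> \<sigma> r)"
abbreviation N :: "('s, 'r, 't) bimodule" where "N \<equiv> bimodule_on T (\<lambda>r x. x \<otimes>\<^bsub>T\<^esub> \<tau> r) rf"

sublocale bimod_pair L "carrier S" R M N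
  by (intro bimod_pair.intro bimod_M bimod_N)

lemma \<sigma>_closed: "r \<in> carrier S \<Longrightarrow> \<sigma> r \<in> carrier A"
  and \<sigma>_add: "r \<in> carrier S \<Longrightarrow> r' \<in> carrier S \<Longrightarrow> \<sigma> (r \<oplus>\<^bsub>S\<^esub> r') = \<sigma> r \<oplus>\<^bsub>A\<^esub> \<sigma> r'"
  and \<sigma>_mult: "r \<in> carrier S \<Longrightarrow> r' \<in> carrier S \<Longrightarrow> \<sigma> (r \<otimes>\<^bsub>S\<^esub> r') = \<sigma> r \<otimes>\<^bsub>A\<^esub> \<sigma> r'"
  and \<sigma>_one: "\<sigma> \<one>\<^bsub>S\<^esub> = \<one>\<^bsub>A\<^esub>"
  using \<sigma>_hom by (auto simp: ring_hom_def)

lemma pure_closed': "a \<in> carrier A \<Longrightarrow> x \<in> carrier T \<Longrightarrow> pure a x \<in> carrier MN"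
  using pure_closed[of a x] by simp

lemma pure_scalar: "a \<in> carrier A \<Longrightarrow> r \<in> carrier S \<Longrightarrow> x \<in> carrier T \<Longrightarrow>
    pure (a \<otimes>\<^bsub>A\<^esub> \<sigma> r) x = pure a (x \<otimes>\<^bsub>T\<^esub> \<tau> r)"
  using pure_balanced[of a r x] by simp

text \<open>The map \<open>id \<otimes> \<phi>\<close> followed by the identification of
  \<open>A \<otimes>\<^sub>S S\<close> with A. For the counit it is the map in the counit axiom, for
  a dual basis it gives coordinates.\<close>

definition coord :: "('t \<Rightarrow> 's) \<Rightarrow> ('a, 't) tensor \<Rightarrow> 'a" where
  "coord \<phi> = tensor_lift M (\<lambda>a x. a \<triangleleft>\<^bsub>M\<^esub> \<phi> x)"

lemma
  assumes \<phi>: "\<phi> \<in> left_hom (carrier S) N (regular S)"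
  shows coord_hom: "coord \<phi> \<in> hom MN M"
    and coord_pure: "a \<in> carrier A \<Longrightarrow> x \<in> carrier T \<Longrightarrow> coord \<phi> (pure a x) = a \<otimes>\<^bsub>A\<^esub> \<sigma> (\<phi> x)"
proof -
  have \<phi>_closed: "\<phi> x \<in> carrier S" if "x \<in> carrier T" for x
    using \<phi> that by (auto simp: left_hom_def hom_def)
  have \<phi>_add: "\<phi> (x \<oplus>\<^bsub>T\<^esub> x') = \<phi> x \<oplus>\<^bsub>S\<^esub> \<phi> x'" if "x \<in> carrier T" "x' \<in> carrier T" for x x'
    using \<phi> that by (auto simp: left_hom_def hom_def)
  have \<phi>_lact: "\<phi> (x \<otimes>\<^bsub>T\<^esub> \<tau> r) = r \<otimes>\<^bsub>S\<^esub> \<phi> x" if "x \<in> carrier T" "r \<in> carrier S" for x r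
    using \<phi> that by (auto simp: left_hom_def)
  have "balanced_map (carrier S) M N M (\<lambda>a x. a \<triangleleft>\<^bsub>M\<^esub> \<phi> x)"
    by (rule balanced_mapI)
      (simp_all add: \<phi>_closed \<phi>_add \<phi>_lact \<sigma>_closed \<sigma>_add \<sigma>_mult A.l_distr A.r_distr A.m_assoc)
  note bal = M.comm_group_axioms this
  show "coord \<phi> \<in> hom MN M"
    unfolding coord_def by (rule lift_hom[OF bal])
  show "a \<in> carrier A \<Longrightarrow> x \<in> carrier T \<Longrightarrow> coord \<phi> (pure a x) = a \<otimes>\<^bsub>A\<^esub> \<sigma> (\<phi> x)"
    using lift_pure[OF bal, of a x] by (simp add: coord_def)
qed

lemma coord_closed: "\<phi> \<in> left_hom (carrier S) N (regular S) \<Longrightarrow> X \<in> carrier MN \<Longrightarrow> coord \<phi> X \<in> carrier A"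
  using coord_hom by (fastforce simp: hom_def)

lemma coord_add: "\<phi> \<in> left_hom (carrier S) N (regular S) \<Longrightarrow> X \<in> carrier MN \<Longrightarrow> Y \<in> carrier MN \<Longrightarrow>
    coord \<phi> (X \<otimes>\<^bsub>MN\<^esub> Y) = coord \<phi> X \<oplus>\<^bsub>A\<^esub> coord \<phi> Y"
  using hom_mult[OF coord_hom] by simp

text \<open>Expanding the right factor in a dual basis and moving the scalars across the tensor sign
  leaves only the dual basis elements on the right.\<close>

lemma coord_expansion:
  fixes n :: nat
  assumes \<phi>: "\<And>i. i < n \<Longrightarrow> \<phi> i \<in> left_hom (carrier S) N (regular S)"
    and u: "\<And>i. i < n \<Longrightarrow> u i \<in> carrier T"
    and id: "\<And>x. x \<in> carrier T \<Longrightarrow> x = finprod N (\<lambda>i. \<phi> i x \<triangleright>\<^bsub>N\<^esub> u i) {..<n}"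
    and X: "X \<in> carrier MN"
  shows "X = finprod MN (\<lambda>i. pure (coord (\<phi> i) X) (u i)) {..<n}"
proof (rule hom_ext[OF _ _ _ X])
  show "(\<lambda>X. X) \<in> hom MN MN" by (rule homI) auto
  have "(\<lambda>X. pure (coord (\<phi> i) X) (u i)) \<in> hom MN MN" if "i < n" for i
    using hom_compose[OF coord_hom[OF \<phi>[OF that]] pure_hom_left, of "u i"] u[OF that] by (simp add: comp_def)
  then show "(\<lambda>X. finprod MN (\<lambda>i. pure (coord (\<phi> i) X) (u i)) {..<n}) \<in> hom MN MN"
    by (intro MN.hom_finprod_pointwise MN.is_group) simp
  fix a x assume "a \<in> carrier M" "x \<in> carrier N"
  then have a: "a \<in> carrier A" and x: "x \<in> carrier T" by simp_all
  have \<phi>x: "\<phi> i x \<in> carrier S" if "i < n" for i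
    using \<phi>[OF that] x by (auto simp: left_hom_def hom_def)
  have "pure a x = pure a (finprod N (\<lambda>i. \<phi> i x \<triangleright>\<^bsub>N\<^esub> u i) {..<n})"
    using id[OF x] by simp
  also have "\<dots> = finprod MN (\<lambda>i. pure a (\<phi> i x \<triangleright>\<^bsub>N\<^esub> u i)) {..<n}"
    using a u \<phi>x \<tau>_closed
    by (intro comm_group_hom_finprod N.comm_group_axioms MN.comm_group_axioms pure_hom_right) auto
  also have "\<dots> = finprod MN (\<lambda>i. pure (coord (\<phi> i) (pure a x)) (u i)) {..<n}"
  proof (rule MN.finprod_cong'[OF refl])
    show "pure a (\<phi> i x \<triangleright>\<^bsub>N\<^esub> u i) = pure (coord (\<phi> i) (pure a x)) (u i)" if "i \<in> {..<n}" for i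
      using that a x u \<phi>x \<phi> by (simp add: coord_pure pure_scalar)
    show "(\<lambda>i. pure (coord (\<phi> i) (pure a x)) (u i)) \<in> {..<n} \<rightarrow> carrier MN"
      using a x u \<phi> by (auto intro!: pure_closed' coord_closed)
  qed
  finally show "pure a x = finprod MN (\<lambda>i. pure (coord (\<phi> i) (pure a x)) (u i)) {..<n}" .
qed

text \<open>The product of \<open>a \<otimes> x\<close> with an arbitrary tensor. Left
  multiplications commute with the scalars, which act from the right, so no condition on the tensor
  is involved while a and x are kept fixed.\<close>

definition leg_mult :: "'a \<Rightarrow> 't \<Rightarrow> ('a, 't) tensor \<Rightarrow> ('a, 't) tensor" where
  "leg_mult a x = tensor_map (carrier S) M N (\<lambda>a'. a \<otimes>\<^bsub>A\<^esub> a') (\<lambda>x'. x \<otimes>\<^bsub>T\<^esub> x')"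

lemma left_mult_right_hom: "a \<in> carrier A \<Longrightarrow> (\<lambda>a'. a \<otimes>\<^bsub>A\<^esub> a') \<in> right_hom (carrier S) M M"
  by (auto simp: right_hom_def A.r_distr A.m_assoc \<sigma>_closed intro!: homI)

lemma left_mult_left_hom: "x \<in> carrier T \<Longrightarrow> (\<lambda>x'. x \<otimes>\<^bsub>T\<^esub> x') \<in> left_hom (carrier S) N N"
  by (auto simp: left_hom_def T.r_distr T.m_assoc \<tau>_closed intro!: homI)

lemma id_right_hom: "(\<lambda>a. a) \<in> right_hom (carrier S) M M"
  by (auto simp: right_hom_def intro!: homI)

lemma id_left_hom: "(\<lambda>x. x) \<in> left_hom (carrier S) N N"
  by (auto simp: left_hom_def intro!: homI)

lemmas map_hom = tensor_map_hom[OF bimod_pair_axioms bimod_pair_axioms]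
lemmas map_pure = tensor_map_pure[OF bimod_pair_axioms bimod_pair_axioms, simplified]

lemma
  assumes "a \<in> carrier A" "x \<in> carrier T"
  shows leg_mult_hom: "leg_mult a x \<in> hom MN MN"
    and leg_mult_pure: "a' \<in> carrier A \<Longrightarrow> x' \<in> carrier T \<Longrightarrow>
      leg_mult a x (pure a' x') = pure (a \<otimes>\<^bsub>A\<^esub> a') (x \<otimes>\<^bsub>T\<^esub> x')"
  unfolding leg_mult_def
  using assms by (simp_all add: map_hom map_pure left_mult_right_hom left_mult_left_hom)

lemma leg_mult_closed: "a \<in> carrier A \<Longrightarrow> x \<in> carrier T \<Longrightarrow> X \<in> carrier MN \<Longrightarrow> leg_mult a x X \<in> carrier MN"
  using leg_mult_hom by (auto simp: hom_def)

lemma leg_mult_add: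
  assumes "a \<in> carrier A" "x \<in> carrier T" "X \<in> carrier MN" "Y \<in> carrier MN"
  shows "leg_mult a x (X \<otimes>\<^bsub>MN\<^esub> Y) = leg_mult a x X \<otimes>\<^bsub>MN\<^esub> leg_mult a x Y"
  using hom_mult[OF leg_mult_hom] assms by simp

text \<open>Membership in the Takeuchi product, stated with the maps that occur in the axioms;
  \<open>takeuchi_elem_iff\<close> restates it through \<open>leg_mult\<close>, whose composition
  law is available.\<close>

definition takeuchi_elem :: "('a, 't) tensor \<Rightarrow> bool" where
  "takeuchi_elem Y \<longleftrightarrow> Y \<in> carrier MN \<and> (\<forall>r\<in>carrier S.
     tensor_map (carrier S) M N (\<lambda>a. \<sigma> r \<otimes>\<^bsub>A\<^esub> a) (\<lambda>x. x) Y =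
     tensor_map (carrier S) M N (\<lambda>a. a) (\<lambda>x. \<tau> r \<otimes>\<^bsub>T\<^esub> x) Y)"

lemma takeuchi_elem_iff:
  "takeuchi_elem Y \<longleftrightarrow> Y \<in> carrier MN \<and> (\<forall>r\<in>carrier S. leg_mult (\<sigma> r) \<one>\<^bsub>T\<^esub> Y = leg_mult \<one>\<^bsub>A\<^esub> (\<tau> r) Y)"
proof -
  have "tensor_map (carrier S) M N (\<lambda>a. \<sigma> r \<otimes>\<^bsub>A\<^esub> a) (\<lambda>x. x) Y = leg_mult (\<sigma> r) \<one>\<^bsub>T\<^esub> Y"
    if Y: "Y \<in> carrier MN" and r: "r \<in> carrier S" for r
  proof -
    note homs = left_mult_right_hom[OF \<sigma>_closed[OF r]] id_left_hom
    show ?thesis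
      by (rule hom_ext[OF map_hom[OF homs] leg_mult_hom[OF \<sigma>_closed[OF r] T.one_closed] _ Y])
        (simp add: map_pure[OF homs] leg_mult_pure \<sigma>_closed[OF r])
  qed
  moreover have "tensor_map (carrier S) M N (\<lambda>a. a) (\<lambda>x. \<tau> r \<otimes>\<^bsub>T\<^esub> x) Y = leg_mult \<one>\<^bsub>A\<^esub> (\<tau> r) Y"
    if Y: "Y \<in> carrier MN" and r: "r \<in> carrier S" for r
  proof -
    note homs = id_right_hom left_mult_left_hom[OF \<tau>_closed[OF r]]
    show ?thesis
      by (rule hom_ext[OF map_hom[OF homs] leg_mult_hom[OF A.one_closed \<tau>_closed[OF r]] _ Y])
        (simp add: map_pure[OF homs] leg_mult_pure \<tau>_closed[OF r])
  qed
  ultimately show ?thesis unfolding takeuchi_elem_def by auto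
qed

lemma leg_mult_leg_mult:
  assumes "a \<in> carrier A" "x \<in> carrier T" "a' \<in> carrier A" "x' \<in> carrier T" "Y \<in> carrier MN"
  shows "leg_mult a x (leg_mult a' x' Y) = leg_mult (a \<otimes>\<^bsub>A\<^esub> a') (x \<otimes>\<^bsub>T\<^esub> x') Y"
  using assms(5,1-4)
  by (induction rule: tensor_induct)
    (simp_all add: leg_mult_pure leg_mult_add leg_mult_closed A.m_assoc T.m_assoc)

text \<open>The factor \<open>\<sigma> r\<close> or \<open>\<tau> r\<close> that a balancing scalar
  contributes can be split off as a separate left multiplication of Y, and the Takeuchi condition
  exchanges the two. This is what makes the componentwise product well defined.\<close>

lemma leg_mult_balanced:
  assumes Y: "takeuchi_elem Y"
  shows "balanced_map (carrier S) M N MN (\<lambda>a x. leg_mult a x Y)"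
proof -
  have YM: "Y \<in> carrier MN" using Y by (simp add: takeuchi_elem_def)
  show ?thesis
  proof (rule balanced_mapI)
    show "leg_mult a x Y \<in> carrier MN" if "a \<in> carrier M" "x \<in> carrier N" for a x
      using that YM by (simp add: leg_mult_closed)
    show "leg_mult (a \<otimes>\<^bsub>M\<^esub> a') x Y = leg_mult a x Y \<otimes>\<^bsub>MN\<^esub> leg_mult a' x Y"
      if "a \<in> carrier M" "a' \<in> carrier M" "x \<in> carrier N" for a a' x
      using YM that pure_add_left
      by (induction rule: tensor_induct)
        (simp_all add: leg_mult_pure leg_mult_add leg_mult_closed A.l_distr MN.m_ac)
    show "leg_mult a (x \<otimes>\<^bsub>N\<^esub> x') Y = leg_mult a x Y \<otimes>\<^bsub>MN\<^esub> leg_mult a x' Y"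
      if "a \<in> carrier M" "x \<in> carrier N" "x' \<in> carrier N" for a x x'
      using YM that pure_add_right
      by (induction rule: tensor_induct)
        (simp_all add: leg_mult_pure leg_mult_add leg_mult_closed T.l_distr MN.m_ac)
    show "leg_mult (a \<triangleleft>\<^bsub>M\<^esub> r) x Y = leg_mult a (r \<triangleright>\<^bsub>N\<^esub> x) Y"
      if "a \<in> carrier M" "x \<in> carrier N" "r \<in> carrier S" for a x r
    proof -
      have "leg_mult (a \<otimes>\<^bsub>A\<^esub> \<sigma> r) x Y = leg_mult a x (leg_mult (\<sigma> r) \<one>\<^bsub>T\<^esub> Y)"
        using that YM \<sigma>_closed by (simp add: leg_mult_leg_mult)
      also have "leg_mult (\<sigma> r) \<one>\<^bsub>T\<^esub> Y = leg_mult \<one>\<^bsub>A\<^esub> (\<tau> r) Y"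
        using Y that by (simp add: takeuchi_elem_iff)
      also have "leg_mult a x \<dots> = leg_mult a (x \<otimes>\<^bsub>T\<^esub> \<tau> r) Y"
        using that YM \<tau>_closed by (simp add: leg_mult_leg_mult)
      finally show ?thesis by simp
    qed
  qed
qed

lemma
  assumes Y: "takeuchi_elem Y"
  shows tensor_mult_hom: "(\<lambda>X. tensor_mult (carrier S) M N A T X Y) \<in> hom MN MN"
    and tensor_mult_pure: "a \<in> carrier A \<Longrightarrow> x \<in> carrier T \<Longrightarrow>
      tensor_mult (carrier S) M N A T (pure a x) Y = leg_mult a x Y"
  using lift_hom[OF MN.comm_group_axioms leg_mult_balanced[OF Y]]
    lift_pure[OF MN.comm_group_axioms leg_mult_balanced[OF Y], of a x]
  by (simp_all add: tensor_mult_def leg_mult_def)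

end

section \<open>Tensor products over the base of a bialgebroid\<close>

context source_target
begin

lemma source_closed: "r \<in> carrier R \<Longrightarrow> s r \<in> carrier T"
  using source_hom by (auto simp: ring_hom_def)

lemma target_closed: "r \<in> carrier R \<Longrightarrow> t r \<in> carrier T"
  and target_mult: "r \<in> carrier R \<Longrightarrow> r' \<in> carrier R \<Longrightarrow> t (r \<otimes>\<^bsub>R\<^esub> r') = t r' \<otimes>\<^bsub>T\<^esub> t r"
  using target_antihom by (auto simp: ring_hom_def)

lemma bimod_Tbim: "bimod (carrier R) (carrier R) Tbim"
proof -
  interpret comm_group Tbim
    unfolding Tbim_def by (rule comm_group_bimodule_on) (rule T.ring_axioms)
  show ?thesis
    by unfold_locales
      (auto simp: Tbim_def source_closed target_closed T.l_distr T.m_assoc source_target_commute)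
qed

lemma algebra_pair_TT: "algebra_pair R T T s t (carrier R) (carrier R) (\<lambda>r x. x \<otimes>\<^bsub>T\<^esub> t r) (\<lambda>x r. x \<otimes>\<^bsub>T\<^esub> s r)"
  using bimod_Tbim unfolding Tbim_def
  by (intro algebra_pair.intro algebra_pair_axioms.intro R.ring_axioms T.ring_axioms source_hom target_closed)

text \<open>The rewrite keeps all inherited facts in terms of \<open>Tbim\<close>, in which the
  bialgebroid axioms are phrased.\<close>

sublocale TT_pair: algebra_pair R T T s t "carrier R" "carrier R" "\<lambda>r x. x \<otimes>\<^bsub>T\<^esub> t r" "\<lambda>x r. x \<otimes>\<^bsub>T\<^esub> s r"
  rewrites "bimodule_on T (\<lambda>r x. x \<otimes>\<^bsub>T\<^esub> t r) (\<lambda>x r. x \<otimes>\<^bsub>T\<^esub> s r) = Tbim"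
  by (rule algebra_pair_TT) (simp add: Tbim_def)

end

context algebra_over_base
begin

lemma bimod_Abim: "bimod (carrier A) (carrier R) Abim"
proof -
  interpret comm_group Abim
    unfolding Abim_def by (rule comm_group_bimodule_on) (rule A.ring_axioms)
  have "\<eta> r \<in> carrier A" if "r \<in> carrier R" for r using base_hom that by (auto simp: ring_hom_def)
  then show ?thesis
    by unfold_locales (auto simp: Abim_def A.l_distr A.r_distr A.m_assoc)
qed

lemma algebra_pair_AT: "algebra_pair R A T \<eta> t (carrier A) (carrier R) (monoid.mult A) (\<lambda>x r. x \<otimes>\<^bsub>T\<^esub> s r)"
  using bimod_Tbim bimod_Abim unfolding Tbim_def Abim_def
  by (intro algebra_pair.intro algebra_pair_axioms.intro R.ring_axioms T.ring_axioms A.ring_axioms base_hom target_closed)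

sublocale AT_pair: algebra_pair R A T \<eta> t "carrier A" "carrier R" "monoid.mult A" "\<lambda>x r. x \<otimes>\<^bsub>T\<^esub> s r"
  rewrites "bimodule_on T (\<lambda>r x. x \<otimes>\<^bsub>T\<^esub> t r) (\<lambda>x r. x \<otimes>\<^bsub>T\<^esub> s r) = Tbim"
    and "bimodule_on A (monoid.mult A) (\<lambda>a r. a \<otimes>\<^bsub>A\<^esub> \<eta> r) = Abim"
  by (rule algebra_pair_AT) (simp_all add: Tbim_def Abim_def)

end

lemma (in source_target) Tbim_simps [simp]:
  "carrier Tbim = carrier T" "monoid.mult Tbim = add T" "\<one>\<^bsub>Tbim\<^esub> = \<zero>\<^bsub>T\<^esub>"
  "r \<triangleright>\<^bsub>Tbim\<^esub> x = x \<otimes>\<^bsub>T\<^esub> t r" "x \<triangleleft>\<^bsub>Tbim\<^esub> r = x \<otimes>\<^bsub>T\<^esub> s r"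
  by (simp_all add: Tbim_def)


lemma (in algebra_over_base) Abim_simps [simp]:
  "carrier Abim = carrier A" "monoid.mult Abim = add A" "\<one>\<^bsub>Abim\<^esub> = \<zero>\<^bsub>A\<^esub>"
  "a \<triangleright>\<^bsub>Abim\<^esub> c = a \<otimes>\<^bsub>A\<^esub> c" "a \<triangleleft>\<^bsub>Abim\<^esub> r = a \<otimes>\<^bsub>A\<^esub> \<eta> r"
  by (simp_all add: Abim_def)

lemma (in algebra_over_base) AT_lact_lact:
  assumes "a \<in> carrier A" "b \<in> carrier A" "X \<in> carrier AT"
  shows "a \<triangleright>\<^bsub>AT\<^esub> (b \<triangleright>\<^bsub>AT\<^esub> X) = (a \<otimes>\<^bsub>A\<^esub> b) \<triangleright>\<^bsub>AT\<^esub> X"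
  using assms(3,1,2) unfolding AT_def
  by (induction rule: AT_pair.tensor_induct) (simp_all add: AT_pair.lact_pure A.m_assoc AT_pair.MN.lact_add)

lemma (in algebra_over_base) AT_lact_add_scalar:
  assumes "a \<in> carrier A" "b \<in> carrier A" "X \<in> carrier AT"
  shows "(a \<oplus>\<^bsub>A\<^esub> b) \<triangleright>\<^bsub>AT\<^esub> X = a \<triangleright>\<^bsub>AT\<^esub> X \<otimes>\<^bsub>AT\<^esub> b \<triangleright>\<^bsub>AT\<^esub> X"
  using assms(3,1,2) unfolding AT_def
proof (induction rule: AT_pair.tensor_induct)
  case (pure m n)
  then show ?case using AT_pair.pure_add_left[of "a \<otimes>\<^bsub>A\<^esub> m" "b \<otimes>\<^bsub>A\<^esub> m" n] by (simp add: AT_pair.lact_pure A.l_distr)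
qed (simp add: AT_pair.MN.lact_add AT_pair.MN.m_ac)

lemma (in algebra_over_base) AT_lact_leg_mult:
  assumes "a \<in> carrier A" "X \<in> carrier AT"
  shows "a \<triangleright>\<^bsub>AT\<^esub> X = AT_pair.leg_mult a \<one>\<^bsub>T\<^esub> X"
  using assms(2,1) unfolding AT_def
  by (induction rule: AT_pair.tensor_induct)
    (simp_all add: AT_pair.lact_pure AT_pair.MN.lact_add AT_pair.leg_mult_pure AT_pair.leg_mult_add)

text \<open>Bijectivity of the Galois map is left out on purpose: the converse implication
  interprets this locale in order to prove it.\<close>

locale coinvariant_extension =
  right_comodule_algebra R T s t \<Delta> \<epsilon> A \<eta> \<delta> + ring_extension A B
  for R :: "('r, 'x) ring_scheme" and T :: "('t, 'y) ring_scheme" and s t \<Delta> \<epsilon>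
    and A :: "('a, 'z) ring_scheme" (structure) and \<eta> \<delta> B +
  assumes coinvariants: "coinvariants = B"
begin

notation pureAT (infixl "\<otimes>\<^sub>R" 72)

lemma \<epsilon>_left_hom: "\<epsilon> \<in> left_hom (carrier R) Tbim (regular R)"
  using counit_hom by (simp add: bimodule_hom_def)

lemma \<delta>_closed: "a \<in> carrier A \<Longrightarrow> \<delta> a \<in> carrier AT"
  and \<delta>_add: "a \<in> carrier A \<Longrightarrow> c \<in> carrier A \<Longrightarrow> \<delta> (a \<oplus> c) = \<delta> a \<otimes>\<^bsub>AT\<^esub> \<delta> c"
  using coaction_hom by (auto simp: right_hom_def hom_def)

lemma B_coinvariant: "b \<in> carrier A \<Longrightarrow> b \<in> B \<longleftrightarrow> \<delta> b = b \<otimes>\<^sub>R \<one>\<^bsub>T\<^esub>"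
  using coinvariants by (auto simp: coinvariants_def)

lemma takeuchi_\<delta>: "a \<in> carrier A \<Longrightarrow> AT_pair.takeuchi_elem (\<delta> a)"
  using coaction_takeuchi \<delta>_closed by (simp add: AT_pair.takeuchi_elem_def AT_def)

text \<open>The counit gives a left inverse of \<open>a \<mapsto> a \<otimes> 1\<close>, because it
  maps 1 to 1.\<close>

lemma pure_one_inject:
  assumes "a \<in> carrier A" "c \<in> carrier A" "a \<otimes>\<^sub>R \<one>\<^bsub>T\<^esub> = c \<otimes>\<^sub>R \<one>\<^bsub>T\<^esub>"
  shows "a = c"
proof -
  have "AT_pair.coord \<epsilon> (a \<otimes>\<^sub>R \<one>\<^bsub>T\<^esub>) = a" if "a \<in> carrier A" for a
    using that AT_pair.coord_pure[OF \<epsilon>_left_hom, of a "\<one>\<^bsub>T\<^esub>"]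
    by (simp add: pureAT_def counit_one AT_pair.\<sigma>_one)
  then show ?thesis using assms by metis
qed

text \<open>The Takeuchi condition for the coaction of b, which is \<open>b \<otimes> 1\<close>,
  puts \<open>\<eta> r\<close> in front of b on the one side and \<open>t r\<close> in the second
  leg on the other; the latter moves back across the tensor sign as \<open>\<eta> r\<close> behind
  b.\<close>

lemma base_commute:
  assumes "b \<in> B" "r \<in> carrier R"
  shows "\<eta> r \<otimes> b = b \<otimes> \<eta> r"
proof (rule pure_one_inject)
  have b: "b \<in> carrier A" and \<delta>b: "\<delta> b = b \<otimes>\<^sub>R \<one>\<^bsub>T\<^esub>" using assms B_coinvariant by blast+
  have r: "\<eta> r \<in> carrier A" "t r \<in> carrier T" using assms AT_pair.\<sigma>_closed target_closed by auto
  have "AT_pair.leg_mult (\<eta> r) \<one>\<^bsub>T\<^esub> (\<delta> b) = AT_pair.leg_mult \<one> (t r) (\<delta> b)"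
    using takeuchi_\<delta>[OF b] assms unfolding AT_pair.takeuchi_elem_iff by blast
  then have "(\<eta> r \<otimes> b) \<otimes>\<^sub>R \<one>\<^bsub>T\<^esub> = b \<otimes>\<^sub>R t r"
    using b r by (simp add: \<delta>b pureAT_def AT_pair.leg_mult_pure)
  also have "\<dots> = (b \<otimes> \<eta> r) \<otimes>\<^sub>R \<one>\<^bsub>T\<^esub>"
    using AT_pair.pure_scalar[of b r "\<one>\<^bsub>T\<^esub>"] b r assms by (simp add: pureAT_def)
  finally show "(\<eta> r \<otimes> b) \<otimes>\<^sub>R \<one>\<^bsub>T\<^esub> = (b \<otimes> \<eta> r) \<otimes>\<^sub>R \<one>\<^bsub>T\<^esub>" .
qed (use assms AT_pair.\<sigma>_closed in auto)

lemma \<delta>_left: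
  assumes "b \<in> B" "a \<in> carrier A"
  shows "\<delta> (b \<otimes> a) = b \<triangleright>\<^bsub>AT\<^esub> \<delta> a"
proof -
  have "\<delta> (b \<otimes> a) = tensor_mult (carrier R) Abim Tbim A T (b \<otimes>\<^sub>R \<one>\<^bsub>T\<^esub>) (\<delta> a)"
    using assms coaction_mult[of b a] B_coinvariant[of b] by simp
  also have "\<dots> = AT_pair.leg_mult b \<one>\<^bsub>T\<^esub> (\<delta> a)"
    using assms takeuchi_\<delta> by (simp add: pureAT_def AT_pair.tensor_mult_pure)
  also have "\<dots> = b \<triangleright>\<^bsub>AT\<^esub> \<delta> a"
    using assms \<delta>_closed by (simp add: AT_lact_leg_mult)
  finally show ?thesis .
qed

text \<open>Multiplication by \<open>b \<otimes> 1\<close> from the right. It is well defined for b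
  in B, where this element is a value of the coaction and so satisfies the Takeuchi condition; it is
  the right B-action that the Galois map respects.\<close>

definition right_mult :: "('a, 't) tensor \<Rightarrow> 'a \<Rightarrow> ('a, 't) tensor" where
  "right_mult X b = tensor_mult (carrier R) Abim Tbim A T X (b \<otimes>\<^sub>R \<one>\<^bsub>T\<^esub>)"

lemma
  assumes "b \<in> B"
  shows right_mult_hom: "(\<lambda>X. right_mult X b) \<in> hom AT AT"
    and right_mult_pure: "a \<in> carrier A \<Longrightarrow> x \<in> carrier T \<Longrightarrow> right_mult (a \<otimes>\<^sub>R x) b = (a \<otimes> b) \<otimes>\<^sub>R x"
proof -
  have "AT_pair.takeuchi_elem (b \<otimes>\<^sub>R \<one>\<^bsub>T\<^esub>)"
    using takeuchi_\<delta>[of b] B_coinvariant[of b] assms by simp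
  note m = AT_pair.tensor_mult_hom[OF this] AT_pair.tensor_mult_pure[OF this]
  show "(\<lambda>X. right_mult X b) \<in> hom AT AT" using m(1) by (simp add: right_mult_def AT_def)
  show "a \<in> carrier A \<Longrightarrow> x \<in> carrier T \<Longrightarrow> right_mult (a \<otimes>\<^sub>R x) b = (a \<otimes> b) \<otimes>\<^sub>R x"
    using m(2)[of a x] assms by (simp add: right_mult_def pureAT_def AT_pair.leg_mult_pure)
qed

lemma \<delta>_right: "a \<in> carrier A \<Longrightarrow> b \<in> B \<Longrightarrow> \<delta> (a \<otimes> b) = right_mult (\<delta> a) b"
  using coaction_mult[of a b] B_coinvariant[of b] by (simp add: right_mult_def)

lemma right_mult_lact:
  assumes "b \<in> B" "a \<in> carrier A" "X \<in> carrier AT"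
  shows "right_mult (a \<triangleright>\<^bsub>AT\<^esub> X) b = a \<triangleright>\<^bsub>AT\<^esub> right_mult X b"
proof -
  have lact: "(\<lambda>X. a \<triangleright>\<^bsub>AT\<^esub> X) \<in> hom AT AT"
    using AT_pair.MN.lact_hom assms by (simp add: AT_def)
  have X: "X \<in> carrier AT_pair.MN" using assms by (simp add: AT_def)
  show ?thesis
  proof (rule AT_pair.hom_ext[OF _ _ _ X])
    show "(\<lambda>X. right_mult (a \<triangleright>\<^bsub>AT\<^esub> X) b) \<in> hom AT_pair.MN AT"
      using hom_compose[OF lact right_mult_hom[OF assms(1)]] by (simp add: comp_def AT_def)
    show "(\<lambda>X. a \<triangleright>\<^bsub>AT\<^esub> right_mult X b) \<in> hom AT_pair.MN AT"
      using hom_compose[OF right_mult_hom[OF assms(1)] lact] by (simp add: comp_def AT_def)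
    show "right_mult (a \<triangleright>\<^bsub>AT\<^esub> AT_pair.pure m n) b = a \<triangleright>\<^bsub>AT\<^esub> right_mult (AT_pair.pure m n) b"
      if "m \<in> carrier Abim" "n \<in> carrier Tbim" for m n
      using that assms right_mult_pure[of b m n] right_mult_pure[of b "a \<otimes> m" n]
      by (simp add: AT_def pureAT_def AT_pair.lact_pure A.m_assoc)
  qed
qed

text \<open>The balancing condition is left B-linearity of the coaction, that is, multiplicativity
  at a coinvariant left factor.\<close>

lemma
  shows galois_hom: "galois_map \<in> hom AA AT"
    and galois_pure: "a \<in> carrier A \<Longrightarrow> c \<in> carrier A \<Longrightarrow> galois_map (a \<otimes>\<^sub>B c) = a \<triangleright>\<^bsub>AT\<^esub> \<delta> c"
proof -
  interpret AT: bimod "carrier A" "carrier R" AT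
    unfolding AT_def by (rule AT_pair.bimod_tensor)
  have "balanced_map B (regular A) (regular A) AT (\<lambda>a c. a \<triangleright>\<^bsub>AT\<^esub> \<delta> c)"
    by (rule balanced_mapI)
      (simp_all add: \<delta>_closed \<delta>_add \<delta>_left AT_lact_add_scalar AT_lact_lact AT.lact_add)
  note bal = AT.comm_group_axioms this
  show "galois_map \<in> hom AA AT"
    unfolding galois_map_def by (rule AA.lift_hom[OF bal])
  show "a \<in> carrier A \<Longrightarrow> c \<in> carrier A \<Longrightarrow> galois_map (a \<otimes>\<^sub>B c) = a \<triangleright>\<^bsub>AT\<^esub> \<delta> c"
    using AA.lift_pure[OF bal, of a c] by (simp add: galois_map_def)
qed

end

section \<open>Depth two and balancedness from a bijective Galois map\<close>

locale galois_ring_extension = coinvariant_extension +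
  assumes left_finite_projective: "left_fg_projective R Tbim"
    and galois_bij: "bij_betw galois_map (carrier (tensor_square A B)) (carrier AT)"
begin

lemma galois_bij_AA: "bij_betw galois_map (carrier AA) (carrier AT)"
  using galois_bij by (simp add: tensor_square_def)

lemma galois_lact:
  assumes "a \<in> carrier A" "X \<in> carrier AA"
  shows "galois_map (a \<triangleright>\<^bsub>AA\<^esub> X) = a \<triangleright>\<^bsub>AT\<^esub> galois_map X"
proof -
  have lact: "(\<lambda>X. a \<triangleright>\<^bsub>AT\<^esub> X) \<in> hom AT AT"
    using AT_pair.MN.lact_hom assms by (simp add: AT_def)
  show ?thesis
  proof (rule AA.hom_ext[OF _ _ _ assms(2)])
    show "(\<lambda>X. galois_map (a \<triangleright>\<^bsub>AA\<^esub> X)) \<in> hom AA AT"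
      using hom_compose[OF AA.MN.lact_hom galois_hom] assms by (simp add: comp_def)
    show "(\<lambda>X. a \<triangleright>\<^bsub>AT\<^esub> galois_map X) \<in> hom AA AT"
      using hom_compose[OF galois_hom lact] by (simp add: comp_def)
  qed (use assms in \<open>simp add: AA.lact_pure galois_pure AT_lact_lact \<delta>_closed\<close>)
qed

lemma galois_ract:
  assumes "b \<in> B" "X \<in> carrier AA"
  shows "galois_map (X \<triangleleft>\<^bsub>AA\<^esub> b) = right_mult (galois_map X) b"
proof -
  show ?thesis
  proof (rule AA.hom_ext[OF _ _ _ assms(2)])
    show "(\<lambda>X. galois_map (X \<triangleleft>\<^bsub>AA\<^esub> b)) \<in> hom AA AT"
      using hom_compose[OF AA.MN.ract_hom galois_hom] assms by (simp add: comp_def)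
    show "(\<lambda>X. right_mult (galois_map X) b) \<in> hom AA AT"
      using hom_compose[OF galois_hom right_mult_hom[OF assms(1)]] by (simp add: comp_def)
  qed (use assms in \<open>simp add: AA.ract_pure galois_pure right_mult_lact \<delta>_closed \<delta>_right\<close>)
qed

lemma galois_inject: "X \<in> carrier AA \<Longrightarrow> Y \<in> carrier AA \<Longrightarrow> galois_map X = galois_map Y \<Longrightarrow> X = Y"
  using galois_bij_AA by (auto simp: bij_betw_def inj_on_def)

lemma right_depth_two: "right_depth_two A B"
proof -
  interpret AT: bimod "carrier A" "carrier R" AT
    unfolding AT_def by (rule AT_pair.bimod_tensor)
  obtain n :: nat and \<phi> \<tau> where \<phi>: "\<And>i. i < n \<Longrightarrow> \<phi> i \<in> left_hom (carrier R) Tbim (regular R)"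
    and \<tau>: "\<And>i. i < n \<Longrightarrow> \<tau> i \<in> carrier Tbim"
    and id: "\<And>x. x \<in> carrier Tbim \<Longrightarrow> x = finprod Tbim (\<lambda>i. \<phi> i x \<triangleright>\<^bsub>Tbim\<^esub> \<tau> i) {..<n}"
    using left_dual_basis[OF R.ring_axioms bimod_Tbim left_finite_projective] by blast
  define u where "u i = inv_into (carrier AA) galois_map (\<one> \<otimes>\<^sub>R \<tau> i)" for i
  define \<gamma> where "\<gamma> i a = AT_pair.coord (\<phi> i) (\<delta> a)" for i a
  have pure_closed: "a \<otimes>\<^sub>R x \<in> carrier AT" if "a \<in> carrier A" "x \<in> carrier T" for a x
    using AT_pair.pure_closed' that by (simp add: AT_def pureAT_def)
  have u: "u i \<in> carrier AA" "galois_map (u i) = \<one> \<otimes>\<^sub>R \<tau> i" if "i < n" for i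
    using that \<tau> pure_closed[of \<one>] galois_bij_AA unfolding u_def
    by (auto simp: bij_betw_def intro!: inv_into_into f_inv_into_f)
  have lact_pure: "a \<triangleright>\<^bsub>AT\<^esub> (c \<otimes>\<^sub>R x) = (a \<otimes> c) \<otimes>\<^sub>R x" if "a \<in> carrier A" "c \<in> carrier A" "x \<in> carrier T" for a c x
    using that AT_pair.lact_pure[of a c x] by (simp add: AT_def pureAT_def)
  \<comment> \<open>The Galois map intertwines both B-actions, and on its image
    \<open>1 \<otimes> \<tau> i\<close> both give \<open>b \<otimes> \<tau> i\<close>.\<close>
  have "u i \<in> centralized" if i: "i < n" for i
  proof -
    have "b \<triangleright>\<^bsub>AA\<^esub> u i = u i \<triangleleft>\<^bsub>AA\<^esub> b" if b: "b \<in> B" for b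
      by (rule galois_inject)
        (use b i u \<tau> in \<open>simp_all add: galois_lact galois_ract lact_pure right_mult_pure\<close>)
    then show ?thesis using u i by (simp add: centralized_def)
  qed
  moreover have \<gamma>_closed: "\<gamma> i a \<in> carrier A" if "i < n" "a \<in> carrier A" for i a
    using AT_pair.coord_closed[OF \<phi>] \<delta>_closed that by (simp add: \<gamma>_def AT_def)
  moreover have "\<gamma> i \<in> End" if i: "i < n" for i
  proof (rule bimodule_homI)
    note coord_simps = AT_pair.coord_pure[OF \<phi>[OF i]] AT_pair.coord_add[OF \<phi>[OF i]] AT_pair.coord_closed[OF \<phi>[OF i]]
    have \<phi>_closed: "\<phi> i x \<in> carrier R" if "x \<in> carrier T" for x
      using \<phi>[OF i] that by (auto simp: left_hom_def hom_def)
    show "\<gamma> i \<in> hom (regular A) (regular A)"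
      using \<gamma>_closed[OF i] \<delta>_closed by (intro homI) (simp_all add: \<gamma>_def \<delta>_add AT_def coord_simps)
    have "AT_pair.coord (\<phi> i) (b \<triangleright>\<^bsub>AT\<^esub> X) = b \<otimes> AT_pair.coord (\<phi> i) X" if "b \<in> carrier A" "X \<in> carrier AT" for b X
      using that(2,1) unfolding AT_def
      by (induction rule: AT_pair.tensor_induct)
        (simp_all add: coord_simps AT_pair.lact_pure AT_pair.MN.lact_add A.m_assoc A.r_distr AT_pair.\<sigma>_closed \<phi>_closed)
    then show "\<gamma> i (l \<triangleright>\<^bsub>regular A\<^esub> a) = l \<triangleright>\<^bsub>regular A\<^esub> \<gamma> i a" if "l \<in> B" "a \<in> carrier (regular A)" for l a
      using that \<delta>_closed by (simp add: \<gamma>_def \<delta>_left)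
    \<comment> \<open>Here b has to pass the image of \<open>\<phi> i x\<close> in A, which is what
      \<open>base_commute\<close> allows.\<close>
    have "AT_pair.coord (\<phi> i) (right_mult X b) = AT_pair.coord (\<phi> i) X \<otimes> b" if b: "b \<in> B" and X: "X \<in> carrier AT" for b X
      using X unfolding AT_def
    proof (induction rule: AT_pair.tensor_induct)
      case (pure m n)
      then show ?case
        using b right_mult_pure[OF b, of m n] base_commute[OF b \<phi>_closed, of n] \<phi>_closed AT_pair.\<sigma>_closed
        by (simp add: coord_simps pureAT_def A.m_assoc)
    next
      case (add X Y)
      have "right_mult X b \<in> carrier AT" "right_mult Y b \<in> carrier AT"
        "right_mult (X \<otimes>\<^bsub>AT\<^esub> Y) b = right_mult X b \<otimes>\<^bsub>AT\<^esub> right_mult Y b"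
        using add right_mult_hom[OF b] by (auto simp: hom_def AT_def)
      then show ?case using add b by (simp add: AT_def coord_simps A.l_distr)
    qed
    then show "\<gamma> i (a \<triangleleft>\<^bsub>regular A\<^esub> r) = \<gamma> i a \<triangleleft>\<^bsub>regular A\<^esub> r" if "r \<in> B" "a \<in> carrier (regular A)" for r a
      using that \<delta>_closed by (simp add: \<gamma>_def \<delta>_right)
  qed
  moreover have "\<one> \<otimes>\<^sub>B a = finprod AA (\<lambda>i. \<gamma> i a \<triangleright>\<^bsub>AA\<^esub> u i) {..<n}" if a: "a \<in> carrier A" for a
  proof (rule galois_inject)
    \<comment> \<open>Under the Galois map the claimed identity becomes the expansion of
      \<open>\<delta> a\<close> in the dual basis of T.\<close>
    have "galois_map (finprod AA (\<lambda>i. \<gamma> i a \<triangleright>\<^bsub>AA\<^esub> u i) {..<n}) = finprod AT (\<lambda>i. galois_map (\<gamma> i a \<triangleright>\<^bsub>AA\<^esub> u i)) {..<n}"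
      using u \<gamma>_closed a by (intro comm_group_hom_finprod AA.MN.comm_group_axioms AT.comm_group_axioms galois_hom) auto
    also have "\<dots> = finprod AT (\<lambda>i. \<gamma> i a \<otimes>\<^sub>R \<tau> i) {..<n}"
      using u \<gamma>_closed a \<tau>
      by (intro AT.finprod_cong'[OF refl]) (auto simp: galois_lact lact_pure intro!: pure_closed)
    also have "\<dots> = \<delta> a"
      using AT_pair.coord_expansion[of n \<phi> \<tau> "\<delta> a"] \<phi> \<tau> id \<delta>_closed[OF a]
      unfolding \<gamma>_def pureAT_def AT_def by simp
    also have "\<dots> = galois_map (\<one> \<otimes>\<^sub>B a)"
      using a \<delta>_closed AT_lact_leg_mult[of \<one> "\<delta> a"] takeuchi_\<delta>[OF a]
      by (simp add: galois_pure) (simp add: \<delta>_left[of \<one> a, symmetric] subringE(3)[OF subring])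
    finally show "galois_map (\<one> \<otimes>\<^sub>B a) = galois_map (finprod AA (\<lambda>i. \<gamma> i a \<triangleright>\<^bsub>AA\<^esub> u i) {..<n})" by simp
  qed (use a u \<gamma>_closed in \<open>auto intro!: AA.MN.finprod_closed AA.pure_closed\<close>)
  ultimately show ?thesis
    unfolding right_depth_two_iff by (intro exI[of _ n] exI[of _ \<gamma>] exI[of _ u]) blast
qed

lemma balanced_if_fg_projective:
  assumes "right_fg_projective (A\<lparr>carrier := B\<rparr>) (regular A)"
  shows "balanced A B"
  unfolding balanced_def
proof (intro ballI impI)
  fix g assume g: "g \<in> hom (add_monoid A) (add_monoid A)"
    and comm: "\<forall>f\<in>right_End A B. \<forall>x\<in>carrier A. g (f x) = f (g x)"
  define b where "b = g \<one>"
  have b: "b \<in> carrier A" using g by (auto simp: b_def hom_def)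
  \<comment> \<open>Left multiplication by x is right B-linear, so g commutes with it; evaluate at
    1.\<close>
  have gx: "g x = x \<otimes> b" if "x \<in> carrier A" for x
  proof -
    have "(\<lambda>a. x \<otimes> a) \<in> right_End A B"
      using that by (auto simp: right_End_def right_hom_def A.r_distr A.m_assoc intro!: homI)
    then show ?thesis using comm that unfolding b_def by (metis A.one_closed A.r_one)
  qed
  obtain n :: nat and x f where x: "\<And>i. i < n \<Longrightarrow> x i \<in> carrier A"
    and f: "\<And>i. i < n \<Longrightarrow> f i \<in> right_hom B (regular A) (regular (A\<lparr>carrier := B\<rparr>))"
    and id: "\<And>a. a \<in> carrier A \<Longrightarrow> a = finprod (regular A) (\<lambda>i. x i \<otimes> f i a) {..<n}"
    using right_dual_basis[OF assms] by blast
  have fB: "f i a \<in> B" if "i < n" "a \<in> carrier A" for i a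
    using f[OF that(1)] that(2) by (auto simp: right_hom_def hom_def)
  \<comment> \<open>The functional f i takes values in B and hence is also an endomorphism of A,
    with which g commutes.\<close>
  have fb: "f i b = f i \<one> \<otimes> b" if "i < n" for i
  proof -
    have "f i \<in> right_End A B"
      using f[OF that] by (auto simp: right_End_def right_hom_def hom_def)
    then have "g (f i \<one>) = f i b" using comm by (simp add: b_def)
    then show ?thesis using gx[of "f i \<one>"] fB[OF that, of \<one>] by auto
  qed
  note hom1 = comm_group_hom_finprod[OF reg.comm_group_axioms AA.MN.comm_group_axioms]
  \<comment> \<open>Expand 1 in the dual basis: the coefficient f i 1 crosses to b, turns into f i b
    by \<open>fb\<close>, and crosses back because this again lies in B.\<close>
  have "\<one> \<otimes>\<^sub>B b = finprod (regular A) (\<lambda>i. x i \<otimes> f i \<one>) {..<n} \<otimes>\<^sub>B b"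
    using id[of \<one>] by simp
  also have "\<dots> = finprod AA (\<lambda>i. (x i \<otimes> f i \<one>) \<otimes>\<^sub>B b) {..<n}"
    using x fB b by (intro hom1 AA.pure_hom_left) auto
  also have "\<dots> = finprod AA (\<lambda>i. (x i \<otimes> f i b) \<otimes>\<^sub>B \<one>) {..<n}"
  proof (rule AA.MN.finprod_cong'[OF refl])
    show "(x i \<otimes> f i \<one>) \<otimes>\<^sub>B b = (x i \<otimes> f i b) \<otimes>\<^sub>B \<one>" if "i \<in> {..<n}" for i
    proof -
      have i: "i < n" using that by simp
      have "(x i \<otimes> f i \<one>) \<otimes>\<^sub>B b = x i \<otimes>\<^sub>B (f i \<one> \<otimes> b)"
        using x[OF i] fB[OF i] b by (simp add: pure_shift)
      also have "\<dots> = x i \<otimes>\<^sub>B f i b" by (simp add: fb[OF i])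
      also have "\<dots> = (x i \<otimes> f i b) \<otimes>\<^sub>B \<one>"
        using pure_shift[of "x i" "f i b" \<one>] x[OF i] fB[OF i b] by simp
      finally show ?thesis .
    qed
    show "(\<lambda>i. (x i \<otimes> f i b) \<otimes>\<^sub>B \<one>) \<in> {..<n} \<rightarrow> carrier AA"
      using x fB b by (auto intro!: AA.pure_closed)
  qed
  also have "\<dots> = finprod (regular A) (\<lambda>i. x i \<otimes> f i b) {..<n} \<otimes>\<^sub>B \<one>"
    using x fB b by (intro hom1[symmetric] AA.pure_hom_left) auto
  also have "\<dots> = b \<otimes>\<^sub>B \<one>" using id[OF b] by simp
  finally have "galois_map (\<one> \<otimes>\<^sub>B b) = galois_map (b \<otimes>\<^sub>B \<one>)" by simp
  then have "\<delta> b = b \<otimes>\<^sub>R \<one>\<^bsub>T\<^esub>"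
    using b \<delta>_left[of \<one> b] subringE(3)[OF subring] AT_pair.lact_pure[of b \<one> "\<one>\<^bsub>T\<^esub>"]
    by (simp add: galois_pure coaction_one AT_def pureAT_def)
  then have "b \<in> B" using B_coinvariant[OF b] by simp
  then show "\<exists>b\<in>B. \<forall>x\<in>carrier A. g x = x \<otimes> b" using gx by blast
qed

end

section \<open>The bialgebroid of a depth two extension\<close>

context ring_extension
begin

text \<open>The centralizer of B in A. It is a fresh record and not an update of A, as the base ring
  is to have type \<open>'a ring\<close> whatever further fields A carries.\<close>

definition base :: "'a ring" where
  "base = \<lparr>carrier = {r \<in> carrier A. \<forall>b\<in>B. b \<otimes> r = r \<otimes> b}, monoid.mult = monoid.mult A, one = \<one>,
     zero = \<zero>, add = add A\<rparr>"

lemma base_simps [simp]: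
  "monoid.mult base = monoid.mult A" "\<one>\<^bsub>base\<^esub> = \<one>" "\<zero>\<^bsub>base\<^esub> = \<zero>" "add base = add A"
  by (simp_all add: base_def)

lemma base_carrier: "r \<in> carrier base \<longleftrightarrow> r \<in> carrier A \<and> (\<forall>b\<in>B. b \<otimes> r = r \<otimes> b)"
  by (simp add: base_def)

lemma baseD: "r \<in> carrier base \<Longrightarrow> r \<in> carrier A" "r \<in> carrier base \<Longrightarrow> b \<in> B \<Longrightarrow> b \<otimes> r = r \<otimes> b"
  by (auto simp: base_carrier)

lemma base_comm2: "r \<in> carrier base \<Longrightarrow> b \<in> B \<Longrightarrow> a \<in> carrier A \<Longrightarrow> b \<otimes> (r \<otimes> a) = r \<otimes> (b \<otimes> a)"
  using baseD[of r] by (simp flip: A.m_assoc)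

lemma ring_base: "ring base"
proof (rule ringI)
  show "abelian_group base"
  proof (rule abelian_groupI)
    fix x assume x: "x \<in> carrier base"
    then have "\<ominus> x \<in> carrier base" by (auto simp: base_carrier A.l_minus A.r_minus)
    then show "\<exists>y\<in>carrier base. y \<oplus>\<^bsub>base\<^esub> x = \<zero>\<^bsub>base\<^esub>"
      using x by (intro bexI[of _ "\<ominus> x"]) (auto simp: base_carrier A.l_neg)
  qed (auto simp: base_carrier A.a_ac A.l_distr A.r_distr)
  show "monoid base"
  proof (rule monoidI)
    fix x y assume xy: "x \<in> carrier base" "y \<in> carrier base"
    have "b \<otimes> (x \<otimes> y) = x \<otimes> y \<otimes> b" if "b \<in> B" for b
      using that baseD(1)[OF xy(1)] baseD(1)[OF xy(2)] baseD(2)[OF xy(2) that] base_comm2[OF xy(1) that, of y]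
      by (simp add: A.m_assoc)
    then show "x \<otimes>\<^bsub>base\<^esub> y \<in> carrier base" using xy by (auto simp: base_carrier)
  qed (auto simp: base_carrier A.m_assoc)
qed (auto simp: base_carrier A.l_distr A.r_distr)

text \<open>The product of the bialgebroid, inserting X between the two legs of the second factor.
  Only X has to be centralized for this to be balanced, so identities can be proved by induction
  over an arbitrary second factor.\<close>

definition sandwich :: "('a, 'a) tensor \<Rightarrow> ('a, 'a) tensor \<Rightarrow> ('a, 'a) tensor" where
  "sandwich X = tensor_lift AA (\<lambda>p q. p \<triangleright>\<^bsub>AA\<^esub> (X \<triangleleft>\<^bsub>AA\<^esub> q))"

lemma
  assumes X: "X \<in> centralized"
  shows sandwich_hom: "sandwich X \<in> hom AA AA"
    and sandwich_pure: "p \<in> carrier A \<Longrightarrow> q \<in> carrier A \<Longrightarrow>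
      sandwich X (p \<otimes>\<^sub>B q) = p \<triangleright>\<^bsub>AA\<^esub> (X \<triangleleft>\<^bsub>AA\<^esub> q)"
proof -
  note X' = centralizedD[OF X]
  have "balanced_map B (regular A) (regular A) AA (\<lambda>p q. p \<triangleright>\<^bsub>AA\<^esub> (X \<triangleleft>\<^bsub>AA\<^esub> q))"
  proof (rule balanced_mapI)
    fix m n b assume "m \<in> carrier (regular A)" "n \<in> carrier (regular A)" and b: "b \<in> B"
    then have mn: "m \<in> carrier A" "n \<in> carrier A" by simp_all
    have "(m \<otimes> b) \<triangleright>\<^bsub>AA\<^esub> (X \<triangleleft>\<^bsub>AA\<^esub> n) = m \<triangleright>\<^bsub>AA\<^esub> ((b \<triangleright>\<^bsub>AA\<^esub> X) \<triangleleft>\<^bsub>AA\<^esub> n)"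
      using mn b X' AA.MN.act_assoc[of b X n] by (simp add: lact_lact[symmetric] del: X'(2))
    also have "\<dots> = m \<triangleright>\<^bsub>AA\<^esub> (X \<triangleleft>\<^bsub>AA\<^esub> (b \<otimes> n))"
      using mn b X' by (simp add: ract_ract)
    finally show "(m \<triangleleft>\<^bsub>regular A\<^esub> b) \<triangleright>\<^bsub>AA\<^esub> (X \<triangleleft>\<^bsub>AA\<^esub> n) = m \<triangleright>\<^bsub>AA\<^esub> (X \<triangleleft>\<^bsub>AA\<^esub> (b \<triangleright>\<^bsub>regular A\<^esub> n))" by simp
  qed (simp_all add: X' lact_add_scalar ract_add_scalar AA.MN.lact_add)
  note bal = AA.MN.comm_group_axioms this
  show "sandwich X \<in> hom AA AA"
    unfolding sandwich_def by (rule AA.lift_hom[OF bal])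
  show "p \<in> carrier A \<Longrightarrow> q \<in> carrier A \<Longrightarrow> sandwich X (p \<otimes>\<^sub>B q) = p \<triangleright>\<^bsub>AA\<^esub> (X \<triangleleft>\<^bsub>AA\<^esub> q)"
    using AA.lift_pure[OF bal, of p q] by (simp add: sandwich_def)
qed

lemma sandwich_closed: "X \<in> centralized \<Longrightarrow> Y \<in> carrier AA \<Longrightarrow> sandwich X Y \<in> carrier AA"
  using sandwich_hom by (auto simp: hom_def)

lemma sandwich_add: "X \<in> centralized \<Longrightarrow> Y \<in> carrier AA \<Longrightarrow> Z \<in> carrier AA \<Longrightarrow>
    sandwich X (Y \<otimes>\<^bsub>AA\<^esub> Z) = sandwich X Y \<otimes>\<^bsub>AA\<^esub> sandwich X Z"
  using hom_mult[OF sandwich_hom] .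

lemma sandwich_lact:
  assumes "X \<in> centralized" "a \<in> carrier A" "Y \<in> carrier AA"
  shows "sandwich X (a \<triangleright>\<^bsub>AA\<^esub> Y) = a \<triangleright>\<^bsub>AA\<^esub> sandwich X Y"
  using assms(3,1,2)
  by (induction rule: AA.tensor_induct)
    (simp_all add: AA.lact_pure AA.MN.lact_add sandwich_pure sandwich_add sandwich_closed lact_lact centralizedD)

lemma sandwich_ract:
  assumes "X \<in> centralized" "a \<in> carrier A" "Y \<in> carrier AA"
  shows "sandwich X (Y \<triangleleft>\<^bsub>AA\<^esub> a) = sandwich X Y \<triangleleft>\<^bsub>AA\<^esub> a"
  using assms(3,1,2)
  by (induction rule: AA.tensor_induct)
    (simp_all add: AA.ract_pure AA.MN.ract_add sandwich_pure sandwich_add sandwich_closed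
      ract_ract centralizedD AA.MN.act_assoc[symmetric])

lemma centralizedI:
  "X \<in> carrier AA \<Longrightarrow> (\<And>b. b \<in> B \<Longrightarrow> b \<triangleright>\<^bsub>AA\<^esub> X = X \<triangleleft>\<^bsub>AA\<^esub> b) \<Longrightarrow> X \<in> centralized"
  by (simp add: centralized_def)

lemma sandwich_centralized:
  assumes "X \<in> centralized" "Y \<in> centralized"
  shows "sandwich X Y \<in> centralized"
proof (rule centralizedI)
  note Y = centralizedD[OF assms(2)]
  show "sandwich X Y \<in> carrier AA" using assms(1) Y(1) by (rule sandwich_closed)
  show "b \<triangleright>\<^bsub>AA\<^esub> sandwich X Y = sandwich X Y \<triangleleft>\<^bsub>AA\<^esub> b" if b: "b \<in> B" for b
    using sandwich_lact[OF assms(1) B_closed[OF b] Y(1)] sandwich_ract[OF assms(1) B_closed[OF b] Y(1)] Y(2)[OF b]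
    by simp
qed

lemma sandwich_sandwich:
  assumes "X \<in> centralized" "Y \<in> centralized" "Z \<in> carrier AA"
  shows "sandwich (sandwich X Y) Z = sandwich X (sandwich Y Z)"
  using assms(3,1,2)
  by (induction rule: AA.tensor_induct)
    (simp_all add: sandwich_pure sandwich_add sandwich_closed sandwich_lact sandwich_ract
      sandwich_centralized centralizedD)

lemma centralized_add: "X \<in> centralized \<Longrightarrow> Y \<in> centralized \<Longrightarrow> X \<otimes>\<^bsub>AA\<^esub> Y \<in> centralized"
  by (auto simp: centralized_def AA.MN.lact_add AA.MN.ract_add)

lemma sandwich_add_left:
  assumes "X \<in> centralized" "Y \<in> centralized" "Z \<in> carrier AA"
  shows "sandwich (X \<otimes>\<^bsub>AA\<^esub> Y) Z = sandwich X Z \<otimes>\<^bsub>AA\<^esub> sandwich Y Z"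
  using assms(3,1,2)
  by (induction rule: AA.tensor_induct)
    (simp_all add: sandwich_pure sandwich_add sandwich_closed centralized_add centralizedD
      AA.MN.lact_add AA.MN.ract_add AA.MN.m_ac)

lemma pure_centralized:
  assumes "r \<in> carrier base" "r' \<in> carrier base"
  shows "r \<otimes>\<^sub>B r' \<in> centralized"
proof -
  have "b \<triangleright>\<^bsub>AA\<^esub> (r \<otimes>\<^sub>B r') = (r \<otimes>\<^sub>B r') \<triangleleft>\<^bsub>AA\<^esub> b" if "b \<in> B" for b
  proof -
    have "b \<triangleright>\<^bsub>AA\<^esub> (r \<otimes>\<^sub>B r') = (r \<otimes> b) \<otimes>\<^sub>B r'"
      using that assms baseD[OF assms(1)] baseD[OF assms(2)] AA.lact_pure[of b r r'] by simp
    also have "\<dots> = r \<otimes>\<^sub>B (b \<otimes> r')" using that assms baseD(1) by (intro pure_shift) auto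
    also have "\<dots> = (r \<otimes>\<^sub>B r') \<triangleleft>\<^bsub>AA\<^esub> b"
      using that assms baseD[OF assms(1)] baseD[OF assms(2)] AA.ract_pure[of b r r'] by simp
    finally show ?thesis .
  qed
  then show ?thesis using assms baseD(1) by (auto simp: centralized_def)
qed

lemma one_base: "\<one> \<in> carrier base"
  by (simp add: base_carrier)

lemma zero_centralized: "\<one>\<^bsub>AA\<^esub> \<in> centralized"
proof -
  have "\<one>\<^bsub>AA\<^esub> = \<zero> \<otimes>\<^sub>B \<one>"
    using hom_one[OF AA.pure_hom_left[of \<one>] reg.is_group AA.MN.is_group] by simp
  moreover have "\<zero> \<in> carrier base" by (simp add: base_carrier)
  ultimately show ?thesis using pure_centralized[OF _ one_base] by simp
qed

definition tring :: "('a, 'a) tensor ring" where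
  "tring = \<lparr>carrier = centralized, monoid.mult = sandwich, one = \<one> \<otimes>\<^sub>B \<one>, zero = \<one>\<^bsub>AA\<^esub>,
     add = monoid.mult AA\<rparr>"

lemma tring_simps [simp]:
  "carrier tring = centralized" "monoid.mult tring = sandwich" "\<one>\<^bsub>tring\<^esub> = \<one> \<otimes>\<^sub>B \<one>"
  "\<zero>\<^bsub>tring\<^esub> = \<one>\<^bsub>AA\<^esub>" "add tring = monoid.mult AA"
  by (simp_all add: tring_def)

lemma sandwich_one_left:
  assumes "Y \<in> carrier AA"
  shows "sandwich (\<one> \<otimes>\<^sub>B \<one>) Y = Y"
  using assms
  by (induction rule: AA.tensor_induct)
    (simp_all add: sandwich_pure sandwich_add pure_centralized one_base AA.lact_pure AA.ract_pure)

lemma sandwich_one_right: "X \<in> centralized \<Longrightarrow> sandwich X (\<one> \<otimes>\<^sub>B \<one>) = X"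
  by (simp add: sandwich_pure one_lact ract_one centralizedD)

lemma ring_tring: "ring tring"
proof (rule ringI)
  show "abelian_group tring"
  proof (rule abelian_groupI)
    fix X assume "X \<in> carrier tring"
    then have X: "X \<in> carrier AA" "\<And>b. b \<in> B \<Longrightarrow> b \<triangleright>\<^bsub>AA\<^esub> X = X \<triangleleft>\<^bsub>AA\<^esub> b"
      using centralizedD[of X] by auto
    have "b \<triangleright>\<^bsub>AA\<^esub> inv\<^bsub>AA\<^esub> X = inv\<^bsub>AA\<^esub> X \<triangleleft>\<^bsub>AA\<^esub> b" if b: "b \<in> B" for b
    proof -
      interpret l: group_hom AA AA "\<lambda>X. b \<triangleright>\<^bsub>AA\<^esub> X"
        using AA.MN.lact_hom[of b] b by unfold_locales auto
      interpret r: group_hom AA AA "\<lambda>X. X \<triangleleft>\<^bsub>AA\<^esub> b"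
        using AA.MN.ract_hom[of b] b by unfold_locales auto
      show ?thesis using X b by simp
    qed
    then have "inv\<^bsub>AA\<^esub> X \<in> centralized" using X by (simp add: centralized_def)
    then show "\<exists>Y\<in>carrier tring. Y \<oplus>\<^bsub>tring\<^esub> X = \<zero>\<^bsub>tring\<^esub>"
      using X by (intro bexI[of _ "inv\<^bsub>AA\<^esub> X"]) auto
  qed (auto simp: centralized_add zero_centralized centralizedD AA.MN.m_ac)
  show "monoid tring"
    by (rule monoidI)
      (simp_all add: sandwich_centralized pure_centralized one_base sandwich_sandwich centralizedD
        sandwich_one_left sandwich_one_right)
qed (simp_all add: sandwich_add sandwich_add_left centralizedD)

definition src :: "'a \<Rightarrow> ('a, 'a) tensor" where "src r = \<one> \<otimes>\<^sub>B r"

definition tgt :: "'a \<Rightarrow> ('a, 'a) tensor" where "tgt r = r \<otimes>\<^sub>B \<one>"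

lemma src_centralized: "r \<in> carrier base \<Longrightarrow> src r \<in> centralized"
  and tgt_centralized: "r \<in> carrier base \<Longrightarrow> tgt r \<in> centralized"
  by (simp_all add: src_def tgt_def pure_centralized one_base)

text \<open>Multiplication by source and target values is the outer action on the tensor square, so
  the R-R-bimodule underlying T is a sub-bimodule of \<open>A \<otimes>\<^sub>B A\<close>.\<close>

lemma sandwich_src: "X \<in> centralized \<Longrightarrow> r \<in> carrier base \<Longrightarrow> sandwich X (src r) = X \<triangleleft>\<^bsub>AA\<^esub> r"
  and sandwich_tgt: "X \<in> centralized \<Longrightarrow> r \<in> carrier base \<Longrightarrow> sandwich X (tgt r) = r \<triangleright>\<^bsub>AA\<^esub> X"
  using baseD(1)[of r]
  by (simp_all add: src_def tgt_def sandwich_pure one_lact ract_one centralizedD)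

lemma source_target: "source_target base tring src tgt"
proof -
  have add: "src (r \<oplus> r') = src r \<otimes>\<^bsub>AA\<^esub> src r'" "tgt (r \<oplus> r') = tgt r \<otimes>\<^bsub>AA\<^esub> tgt r'"
    if "r \<in> carrier base" "r' \<in> carrier base" for r r'
    using that baseD(1) AA.pure_add_right[of \<one> r r'] AA.pure_add_left[of r r' \<one>]
    by (simp_all add: src_def tgt_def)
  have mult: "sandwich (src r) (src r') = src (r \<otimes> r')" "sandwich (tgt r') (tgt r) = tgt (r \<otimes> r')"
    "sandwich (src r) (tgt r') = sandwich (tgt r') (src r)"
    if "r \<in> carrier base" "r' \<in> carrier base" for r r'
    using that baseD(1)[of r] baseD(1)[of r'] AA.ract_pure[of r' \<one> r] AA.lact_pure[of r r' \<one>]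
      AA.lact_pure[of r' \<one> r] AA.ract_pure[of r r' \<one>]
    by (simp_all add: sandwich_src sandwich_tgt src_centralized tgt_centralized)
      (simp_all add: src_def tgt_def)
  show ?thesis
    by (intro source_target.intro source_target_axioms.intro ring_base ring_tring ring_hom_memI)
      (simp_all add: src_centralized tgt_centralized add mult, simp_all add: src_def tgt_def)
qed

sublocale ST: source_target base tring src tgt
  by (rule source_target)

lemma Tbim_incl: "(\<lambda>x. x) \<in> hom ST.Tbim AA"
  by (rule homI) (simp_all add: centralizedD)

lemma bimod_tring: "bimod (carrier base) (carrier base) ST.Tbim"
  by (rule ST.bimod_Tbim)

text \<open>Lets expansions obtained in the whole tensor square be read inside T.\<close>

lemma finprod_Tbim:
  assumes "f \<in> I \<rightarrow> centralized"
  shows "finprod ST.Tbim f I = finprod AA f I"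
  using comm_group_hom_finprod[OF bimod.axioms(1)[OF bimod_tring] AA.MN.comm_group_axioms Tbim_incl, of f I] assms by simp

text \<open>An element b is moved from the left of X to its right and then out through the right
  B-linear f.\<close>

lemma End_base:
  assumes "f \<in> End" "X \<in> centralized"
  shows "contract_right f X \<in> carrier base"
proof -
  have "b \<otimes> contract_right f X = contract_right f X \<otimes> b" if "b \<in> B" for b
    using that assms centralizedD[OF assms(2)] contract_right_lact[OF End_left_hom[OF assms(1)], of b X]
      contract_right_ract_End[OF assms(1) that, of X] by simp
  then show ?thesis using assms by (auto simp: base_carrier End_left_hom centralizedD)
qed

text \<open>The pairing of S with T: every f in \<open>End\<close> becomes a functional on T with
  values in R, ready to be used as a coordinate.\<close>

lemma contract_right_left_hom:
  assumes "f \<in> End"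
  shows "contract_right f \<in> left_hom (carrier base) ST.Tbim (regular base)"
  unfolding left_hom_def
  using assms baseD(1)
  by (auto intro!: homI simp: End_base contract_right_add End_left_hom centralizedD sandwich_tgt contract_right_lact)

definition apply_right :: "('a \<Rightarrow> 'a) \<Rightarrow> ('a, 'a) tensor \<Rightarrow> ('a, 'a) tensor" where
  "apply_right f = tensor_map B (regular A) (regular A) (\<lambda>a. a) f"

lemma
  assumes "f \<in> End"
  shows apply_right_hom: "apply_right f \<in> hom AA AA"
    and apply_right_pure: "a \<in> carrier A \<Longrightarrow> c \<in> carrier A \<Longrightarrow> apply_right f (a \<otimes>\<^sub>B c) = a \<otimes>\<^sub>B f c"
proof -
  have id: "(\<lambda>a. a) \<in> right_hom B (regular A) (regular A)"
    by (auto simp: right_hom_def intro!: homI)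
  note m = tensor_map_hom[OF bimod_pair_regular bimod_pair_regular id End_left_hom[OF assms]]
    tensor_map_pure[OF bimod_pair_regular bimod_pair_regular id End_left_hom[OF assms]]
  show "apply_right f \<in> hom AA AA" using m(1) by (simp add: apply_right_def)
  show "a \<in> carrier A \<Longrightarrow> c \<in> carrier A \<Longrightarrow> apply_right f (a \<otimes>\<^sub>B c) = a \<otimes>\<^sub>B f c"
    using m(2)[of a c] by (simp add: apply_right_def)
qed

lemma apply_right_closed: "f \<in> End \<Longrightarrow> X \<in> carrier AA \<Longrightarrow> apply_right f X \<in> carrier AA"
  using apply_right_hom by (auto simp: hom_def)

lemma apply_right_add: "f \<in> End \<Longrightarrow> X \<in> carrier AA \<Longrightarrow> Y \<in> carrier AA \<Longrightarrow>
    apply_right f (X \<otimes>\<^bsub>AA\<^esub> Y) = apply_right f X \<otimes>\<^bsub>AA\<^esub> apply_right f Y"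
  using hom_mult[OF apply_right_hom] .

lemma apply_right_lact:
  assumes "f \<in> End" "a \<in> carrier A" "X \<in> carrier AA"
  shows "apply_right f (a \<triangleright>\<^bsub>AA\<^esub> X) = a \<triangleright>\<^bsub>AA\<^esub> apply_right f X"
  using assms(3,1,2)
  by (induction rule: AA.tensor_induct)
    (simp_all add: AA.lact_pure AA.MN.lact_add apply_right_pure apply_right_add apply_right_closed EndD)

lemma apply_right_ract:
  assumes "f \<in> End" "b \<in> B" "X \<in> carrier AA"
  shows "apply_right f (X \<triangleleft>\<^bsub>AA\<^esub> b) = apply_right f X \<triangleleft>\<^bsub>AA\<^esub> b"
  using assms(3,1,2)
  by (induction rule: AA.tensor_induct)
    (simp_all add: AA.ract_pure AA.MN.ract_add apply_right_pure apply_right_add apply_right_closed EndD)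

lemma apply_right_centralized:
  assumes "f \<in> End" "X \<in> centralized"
  shows "apply_right f X \<in> centralized"
proof (rule centralizedI)
  note X = centralizedD[OF assms(2)]
  show "apply_right f X \<in> carrier AA" using assms(1) X(1) by (rule apply_right_closed)
  show "b \<triangleright>\<^bsub>AA\<^esub> apply_right f X = apply_right f X \<triangleleft>\<^bsub>AA\<^esub> b" if b: "b \<in> B" for b
    using apply_right_lact[OF assms(1) B_closed[OF b] X(1)] apply_right_ract[OF assms(1) b X(1)] X(2)[OF b]
    by simp
qed

lemma id_End: "(\<lambda>a. a) \<in> End"
  by (rule bimodule_homI) (auto intro!: homI)

lemma comp_End: "f \<in> End \<Longrightarrow> g \<in> End \<Longrightarrow> (\<lambda>a. f (g a)) \<in> End"
  using bimodule_hom_compose[of g B B "regular A" "regular A" f "regular A"] by blast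

lemma right_mult_End: "r \<in> carrier base \<Longrightarrow> (\<lambda>a. a \<otimes> r) \<in> End"
  using baseD[of r] by (intro bimodule_homI homI) (simp_all add: A.l_distr A.m_assoc)

lemma left_mult_End: "r \<in> carrier base \<Longrightarrow> (\<lambda>a. r \<otimes> a) \<in> End"
  using baseD[of r] base_comm2[of r] by (intro bimodule_homI homI) (simp_all add: A.r_distr A.m_assoc)

text \<open>The map \<open>a \<mapsto> X\<^sup>1 f(X\<^sup>2 a)\<close>. For X = u j these are the
  second legs of the coproduct of f in S, and \<open>\<gamma> j\<close> the first ones;
  \<open>End_mult\<close> is the corresponding product rule.\<close>

definition slice :: "('a \<Rightarrow> 'a) \<Rightarrow> ('a, 'a) tensor \<Rightarrow> 'a \<Rightarrow> 'a" where
  "slice f X a = contract_right f (X \<triangleleft>\<^bsub>AA\<^esub> a)"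

lemma slice_End:
  assumes f: "f \<in> End" and X: "X \<in> centralized"
  shows "slice f X \<in> End"
proof (rule bimodule_homI)
  note X' = centralizedD[OF X] and f' = End_left_hom[OF f]
  show "slice f X \<in> hom (regular A) (regular A)"
    by (rule homI) (simp_all add: slice_def X' f' ract_add_scalar contract_right_add)
  show "slice f X (l \<triangleright>\<^bsub>regular A\<^esub> m) = l \<triangleright>\<^bsub>regular A\<^esub> slice f X m" if "l \<in> B" "m \<in> carrier (regular A)" for l m
  proof -
    have "slice f X (l \<otimes> m) = contract_right f (l \<triangleright>\<^bsub>AA\<^esub> (X \<triangleleft>\<^bsub>AA\<^esub> m))"
      using that X' AA.MN.act_assoc[of l X m] by (simp add: slice_def ract_ract)
    then show ?thesis using that X' f' by (simp add: slice_def contract_right_lact)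
  qed
  show "slice f X (m \<triangleleft>\<^bsub>regular A\<^esub> r) = slice f X m \<triangleleft>\<^bsub>regular A\<^esub> r" if "r \<in> B" "m \<in> carrier (regular A)" for r m
    using that X' f by (simp add: slice_def contract_right_ract_End flip: ract_ract)
qed

lemma contract_right_comp:
  assumes "f \<in> End" "g \<in> End" "X \<in> carrier AA"
  shows "contract_right f (apply_right g X) = contract_right (\<lambda>a. f (g a)) X"
  using assms(3,1,2)
  by (induction rule: AA.tensor_induct)
    (simp_all add: apply_right_pure apply_right_add apply_right_closed contract_right_pure contract_right_add
      End_left_hom comp_End EndD)

text \<open>Under the pairing with S, left multiplication by X in T is adjoint to
  \<open>f \<mapsto> slice f X\<close>. On pure tensors p, q both sides are
  \<open>p X\<^sup>1 f(X\<^sup>2 q)\<close>.\<close>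

lemma contract_right_sandwich:
  assumes "f \<in> End" "X \<in> centralized" "Y \<in> carrier AA"
  shows "contract_right f (sandwich X Y) = contract_right (slice f X) Y"
  using assms(3,1,2)
proof (induction rule: AA.tensor_induct)
  case (pure m n)
  then show ?case
    using slice_End[of f X] by (simp add: sandwich_pure contract_right_lact End_left_hom centralizedD contract_right_pure)
      (simp add: slice_def)
qed (simp_all add: sandwich_add sandwich_closed contract_right_add End_left_hom slice_End)

lemma contract_right_tgt:
  assumes "f \<in> End" "r \<in> carrier base" "X \<in> carrier AA"
  shows "contract_right f (sandwich (tgt r) X) = contract_right (\<lambda>a. r \<otimes> f a) X"
  using assms(3,1,2) baseD(1)[OF assms(2)] comp_End[OF left_mult_End[OF assms(2)] assms(1)]
proof (induction rule: AA.tensor_induct)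
  case (pure m n)
  then have "contract_right f (sandwich (tgt r) (m \<otimes>\<^sub>B n)) = contract_right f (m \<triangleright>\<^bsub>AA\<^esub> (r \<otimes>\<^sub>B n))"
    using AA.ract_pure[of n r \<one>] by (simp add: sandwich_pure tgt_centralized) (simp add: tgt_def)
  then show ?case
    using pure by (simp add: contract_right_lact contract_right_pure End_left_hom EndD)
qed (simp_all add: sandwich_add sandwich_closed tgt_centralized contract_right_add End_left_hom)

lemma contract_right_ract:
  assumes "f \<in> End" "r \<in> carrier base" "X \<in> carrier AA"
  shows "contract_right f (X \<triangleleft>\<^bsub>AA\<^esub> r) = contract_right (\<lambda>a. f (a \<otimes> r)) X"
  using assms(3,1,2) baseD(1)[OF assms(2)] comp_End[OF assms(1) right_mult_End[OF assms(2)]]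
  by (induction rule: AA.tensor_induct)
    (simp_all add: AA.ract_pure AA.MN.ract_add contract_right_pure contract_right_add End_left_hom)

lemma apply_right_comp:
  assumes "f \<in> End" "g \<in> End" "X \<in> carrier AA"
  shows "apply_right (\<lambda>a. f (g a)) X = apply_right f (apply_right g X)"
  using assms(3,1,2)
  by (induction rule: AA.tensor_induct)
    (simp_all add: apply_right_pure apply_right_add apply_right_closed comp_End EndD)

lemma apply_right_id:
  assumes "X \<in> carrier AA"
  shows "apply_right (\<lambda>a. a) X = X"
  using assms by (induction rule: AA.tensor_induct) (simp_all add: apply_right_pure apply_right_add id_End)

lemma apply_right_right_mult:
  assumes "r \<in> carrier base" "X \<in> carrier AA"
  shows "apply_right (\<lambda>a. a \<otimes> r) X = X \<triangleleft>\<^bsub>AA\<^esub> r"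
  using assms(2,1) baseD(1)[OF assms(1)]
  by (induction rule: AA.tensor_induct)
    (simp_all add: apply_right_pure apply_right_add right_mult_End AA.ract_pure AA.MN.ract_add)

lemma apply_right_left_mult:
  assumes "r \<in> carrier base" "X \<in> carrier AA"
  shows "apply_right (\<lambda>a. r \<otimes> a) X = sandwich (src r) X"
  using assms(2,1) baseD(1)[OF assms(1)]
proof (induction rule: AA.tensor_induct)
  case (pure m n)
  then show ?case using AA.ract_pure[of n \<one> r] AA.lact_pure[of m \<one> "r \<otimes> n"]
    by (simp add: apply_right_pure left_mult_End sandwich_pure src_centralized) (simp add: src_def)
qed (simp_all add: apply_right_add sandwich_add left_mult_End src_centralized)

end

text \<open>Kept folded from here on, since the product also occurs inside the bimodule record of the bialgebroid.\<close>

declare (in ring_extension) tring_simps(2) [simp del]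

section \<open>Coactions defined by a quasibasis\<close>

locale right_d2 = ring_extension A B
  for A :: "('a, 'x) ring_scheme" (structure) and B +
  fixes n :: nat and \<gamma> :: "nat \<Rightarrow> 'a \<Rightarrow> 'a" and u :: "nat \<Rightarrow> ('a, 'a) tensor"
  assumes \<gamma>: "i < n \<Longrightarrow> \<gamma> i \<in> End" and u: "i < n \<Longrightarrow> u i \<in> centralized"
    and quasibasis: "a \<in> carrier A \<Longrightarrow> \<one> \<otimes>\<^sub>B a = finprod AA (\<lambda>i. \<gamma> i a \<triangleright>\<^bsub>AA\<^esub> u i) {..<n}"
begin

lemma expansion: "X \<in> carrier AA \<Longrightarrow> X = finprod AA (\<lambda>i. contract_right (\<gamma> i) X \<triangleright>\<^bsub>AA\<^esub> u i) {..<n}"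
  using \<gamma> u quasibasis by (intro quasibasis_expansion) auto

text \<open>On centralized elements the coefficients of the quasibasis expansion lie in R, so it
  becomes a dual basis of T as a left R-module.\<close>

lemma Tbim_expansion:
  assumes "x \<in> centralized"
  shows "x = finprod ST.Tbim (\<lambda>i. contract_right (\<gamma> i) x \<triangleright>\<^bsub>ST.Tbim\<^esub> u i) {..<n}"
proof -
  have eq: "contract_right (\<gamma> i) x \<triangleright>\<^bsub>ST.Tbim\<^esub> u i = contract_right (\<gamma> i) x \<triangleright>\<^bsub>AA\<^esub> u i" if "i < n" for i
    using that assms by (simp add: tring_simps(2) sandwich_tgt u End_base \<gamma>)
  have closed: "contract_right (\<gamma> i) x \<triangleright>\<^bsub>ST.Tbim\<^esub> u i \<in> centralized" if "i < n" for i
    using that assms by (simp add: tring_simps(2) sandwich_centralized u End_base \<gamma> tgt_centralized)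
  have "x = finprod AA (\<lambda>i. contract_right (\<gamma> i) x \<triangleright>\<^bsub>AA\<^esub> u i) {..<n}"
    using centralizedD(1)[OF assms] by (rule expansion)
  also have "\<dots> = finprod AA (\<lambda>i. contract_right (\<gamma> i) x \<triangleright>\<^bsub>ST.Tbim\<^esub> u i) {..<n}"
  proof (rule AA.MN.finprod_cong'[OF refl])
    show "contract_right (\<gamma> i) x \<triangleright>\<^bsub>AA\<^esub> u i = contract_right (\<gamma> i) x \<triangleright>\<^bsub>ST.Tbim\<^esub> u i" if "i \<in> {..<n}" for i
      using eq[of i] that by simp
    show "(\<lambda>i. contract_right (\<gamma> i) x \<triangleright>\<^bsub>ST.Tbim\<^esub> u i) \<in> {..<n} \<rightarrow> carrier AA"
      using closed centralizedD(1) by blast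
  qed
  also have "\<dots> = finprod ST.Tbim (\<lambda>i. contract_right (\<gamma> i) x \<triangleright>\<^bsub>ST.Tbim\<^esub> u i) {..<n}"
    using closed by (intro finprod_Tbim[symmetric]) auto
  finally show ?thesis .
qed

text \<open>How f acts on a product. Expand \<open>1 \<otimes> c\<close> by the quasibasis, multiply
  by q on the right and contract with f; this is the source of multiplicativity of the
  coaction.\<close>

lemma End_mult:
  assumes "f \<in> End" "c \<in> carrier A" "q \<in> carrier A"
  shows "f (c \<otimes> q) = finprod (regular A) (\<lambda>j. \<gamma> j c \<otimes> slice f (u j) q) {..<n}"
proof -
  have hom: "(\<lambda>Z. contract_right f (Z \<triangleleft>\<^bsub>AA\<^esub> q)) \<in> hom AA (regular A)"
    using hom_compose[OF AA.MN.ract_hom[OF assms(3)] contract_right_hom[OF End_left_hom[OF assms(1)]]]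
    by (simp add: comp_def)
  have "f (c \<otimes> q) = contract_right f ((\<one> \<otimes>\<^sub>B c) \<triangleleft>\<^bsub>AA\<^esub> q)"
    using assms EndD[OF assms(1)] AA.ract_pure[of q \<one> c] by (simp add: contract_right_pure End_left_hom)
  also have "\<dots> = finprod (regular A) (\<lambda>j. contract_right f ((\<gamma> j c \<triangleright>\<^bsub>AA\<^esub> u j) \<triangleleft>\<^bsub>AA\<^esub> q)) {..<n}"
    unfolding quasibasis[OF assms(2)] using assms centralizedD(1)[OF u] EndD(3)[OF \<gamma>]
    by (intro comm_group_hom_finprod[OF AA.MN.comm_group_axioms reg.comm_group_axioms hom]) auto
  also have "\<dots> = finprod (regular A) (\<lambda>j. \<gamma> j c \<otimes> slice f (u j) q) {..<n}"
    using assms centralizedD(1)[OF u] EndD(3)[OF \<gamma>] End_left_hom[OF assms(1)]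
    by (intro reg.finprod_cong'[OF refl])
      (auto simp: slice_def contract_right_lact simp flip: AA.MN.act_assoc)
  finally show ?thesis .
qed

end

text \<open>
  The ring \<open>C\<close> is \<open>A\<close> or the bialgebroid itself, with \<open>G f\<close> the endomorphism of \<open>C\<close> induced by
  a \<open>B\<close>-\<open>B\<close>-bimodule endomorphism \<open>f\<close> of \<open>A\<close>. The coaction is \<open>m \<mapsto> \<Sum>\<^sub>j G \<gamma>\<^sub>j m \<otimes> u\<^sub>j\<close>, and the
  comodule algebra axioms are checked on the coordinates of an element of \<open>C \<otimes>\<^sub>R T\<close>, which are its
  images under the maps \<open>m \<otimes> x \<mapsto> m (x\<^sup>1 f(x\<^sup>2))\<close>.
\<close>

locale d2_module = right_d2 A B n \<gamma> u
  for A :: "('a, 'x) ring_scheme" (structure) and B n \<gamma> u +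
  fixes C :: "('m, 'w) ring_scheme" and \<sigma> :: "'a \<Rightarrow> 'm" and L :: "'l set" and lf :: "'l \<Rightarrow> 'm \<Rightarrow> 'm"
    and G :: "('a \<Rightarrow> 'a) \<Rightarrow> 'm \<Rightarrow> 'm"
  assumes pair: "algebra_pair base C tring \<sigma> tgt L (carrier base) lf (\<lambda>x r. x \<otimes>\<^bsub>tring\<^esub> src r)"
    and G_closed: "f \<in> End \<Longrightarrow> m \<in> carrier C \<Longrightarrow> G f m \<in> carrier C"
    and G_add: "f \<in> End \<Longrightarrow> m \<in> carrier C \<Longrightarrow> m' \<in> carrier C \<Longrightarrow> G f (m \<oplus>\<^bsub>C\<^esub> m') = G f m \<oplus>\<^bsub>C\<^esub> G f m'"
    and G_comp: "f \<in> End \<Longrightarrow> g \<in> End \<Longrightarrow> m \<in> carrier C \<Longrightarrow> G (\<lambda>a. f (g a)) m = G f (G g m)"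
    and G_id: "m \<in> carrier C \<Longrightarrow> G (\<lambda>a. a) m = m"
    and G_right: "r \<in> carrier base \<Longrightarrow> m \<in> carrier C \<Longrightarrow> G (\<lambda>a. a \<otimes> r) m = m \<otimes>\<^bsub>C\<^esub> \<sigma> r"
    and G_left: "r \<in> carrier base \<Longrightarrow> m \<in> carrier C \<Longrightarrow> G (\<lambda>a. r \<otimes> a) m = \<sigma> r \<otimes>\<^bsub>C\<^esub> m"
    and G_mult: "f \<in> End \<Longrightarrow> m \<in> carrier C \<Longrightarrow> m' \<in> carrier C \<Longrightarrow>
      G f (m \<otimes>\<^bsub>C\<^esub> m') = finprod (bimodule_on C lf (\<lambda>a r. a \<otimes>\<^bsub>C\<^esub> \<sigma> r))
        (\<lambda>j. G (\<gamma> j) m \<otimes>\<^bsub>C\<^esub> G (slice f (u j)) m') {..<n}"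
    and G_one: "f \<in> End \<Longrightarrow> G f \<one>\<^bsub>C\<^esub> = \<sigma> (f \<one>)"
begin

sublocale P: algebra_pair base C tring \<sigma> tgt L "carrier base" lf "\<lambda>x r. x \<otimes>\<^bsub>tring\<^esub> src r"
  rewrites "bimodule_on tring (\<lambda>r x. x \<otimes>\<^bsub>tring\<^esub> tgt r) (\<lambda>x r. x \<otimes>\<^bsub>tring\<^esub> src r) = ST.Tbim"
  by (rule pair) (simp add: ST.Tbim_def)

lemmas coord_pure = P.coord_pure[OF contract_right_left_hom]
lemmas coord_hom = P.coord_hom[OF contract_right_left_hom]
lemmas coord_closed = P.coord_closed[OF contract_right_left_hom]
lemmas coord_add = P.coord_add[OF contract_right_left_hom]

lemma base_value: "f \<in> End \<Longrightarrow> r \<in> carrier base \<Longrightarrow> f r \<in> carrier base"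
  using End_base[of f "src r"] baseD(1)[of r]
  by (simp add: src_centralized) (simp add: src_def contract_right_pure End_left_hom EndD)

text \<open>The product rule \<open>G_mult\<close> with second factor 1: the value of
  \<open>slice f (u j)\<close> at 1 is the pairing of f with u j.\<close>

lemma G_rec:
  assumes "f \<in> End" "m \<in> carrier C"
  shows "finprod P.M (\<lambda>j. G (\<gamma> j) m \<otimes>\<^bsub>C\<^esub> \<sigma> (contract_right f (u j))) {..<n} = G f m"
proof -
  have "finprod P.M (\<lambda>j. G (\<gamma> j) m \<otimes>\<^bsub>C\<^esub> G (slice f (u j)) \<one>\<^bsub>C\<^esub>) {..<n} =
      finprod P.M (\<lambda>j. G (\<gamma> j) m \<otimes>\<^bsub>C\<^esub> \<sigma> (contract_right f (u j))) {..<n}"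
    using assms u \<gamma>
    by (intro P.M.finprod_cong'[OF refl])
      (auto simp: G_one slice_End G_closed End_base P.\<sigma>_closed slice_def ract_one centralizedD)
  then show ?thesis using G_mult[OF assms P.A.one_closed] assms by simp
qed

text \<open>Already the coordinates along the \<open>\<gamma> i\<close> determine an element, by the
  dual basis of T. The hypothesis ranges over all of \<open>End\<close> because the coordinate
  formulas below hold for every f and change f along the way.\<close>

lemma coord_ext:
  assumes X: "X \<in> carrier P.MN" and Y: "Y \<in> carrier P.MN"
    and eq: "\<And>f. f \<in> End \<Longrightarrow> P.coord (contract_right f) X = P.coord (contract_right f) Y"
  shows "X = Y"
proof -
  have exp: "Z = finprod P.MN (\<lambda>i. P.pure (P.coord (contract_right (\<gamma> i)) Z) (u i)) {..<n}"
    if "Z \<in> carrier P.MN" for Z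
    using that u \<gamma> Tbim_expansion
    by (intro P.coord_expansion) (auto intro: contract_right_left_hom)
  have eqs: "finprod P.MN (\<lambda>i. P.pure (P.coord (contract_right (\<gamma> i)) X) (u i)) {..<n} =
      finprod P.MN (\<lambda>i. P.pure (P.coord (contract_right (\<gamma> i)) Y) (u i)) {..<n}"
    using X Y u \<gamma> by (intro P.MN.finprod_cong'[OF refl]) (auto simp: eq intro!: P.pure_closed' coord_closed)
  show ?thesis by (rule trans[OF trans[OF exp[OF X] eqs] exp[OF Y, symmetric]])
qed

definition coact :: "'m \<Rightarrow> ('m, ('a, 'a) tensor) tensor" where
  "coact m = finprod P.MN (\<lambda>j. P.pure (G (\<gamma> j) m) (u j)) {..<n}"

lemma coact_closed: "m \<in> carrier C \<Longrightarrow> coact m \<in> carrier P.MN"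
  unfolding coact_def using \<gamma> u by (intro P.MN.finprod_closed) (auto intro!: P.pure_closed' G_closed)

lemma coact_map:
  assumes "comm_group H" "h \<in> hom P.MN H" "m \<in> carrier C"
  shows "h (coact m) = finprod H (\<lambda>j. h (P.pure (G (\<gamma> j) m) (u j))) {..<n}"
  unfolding coact_def using assms \<gamma> u
  by (intro comm_group_hom_finprod P.MN.comm_group_axioms) (auto intro!: P.pure_closed' G_closed)

text \<open>Together with \<open>coord_ext\<close> this characterizes the coaction without reference
  to the quasibasis, and the axioms below are all derived from it.\<close>

lemma coord_coact:
  assumes "f \<in> End" "m \<in> carrier C"
  shows "P.coord (contract_right f) (coact m) = G f m"
proof -
  have "P.coord (contract_right f) (coact m) =
      finprod P.M (\<lambda>j. P.coord (contract_right f) (P.pure (G (\<gamma> j) m) (u j))) {..<n}"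
    using assms by (intro coact_map P.M.comm_group_axioms coord_hom)
  also have "\<dots> = finprod P.M (\<lambda>j. G (\<gamma> j) m \<otimes>\<^bsub>C\<^esub> \<sigma> (contract_right f (u j))) {..<n}"
    using assms u \<gamma>
    by (intro P.M.finprod_cong'[OF refl]) (auto simp: coord_pure G_closed End_base P.\<sigma>_closed)
  finally show ?thesis using assms by (simp add: G_rec)
qed

lemma coact_right_hom: "coact \<in> right_hom (carrier base) P.M P.MN"
proof -
  have add: "coact (m \<oplus>\<^bsub>C\<^esub> m') = coact m \<otimes>\<^bsub>P.MN\<^esub> coact m'" if "m \<in> carrier C" "m' \<in> carrier C" for m m'
    using that by (intro coord_ext) (simp_all add: coact_closed coord_add coord_coact G_add)
  \<comment> \<open>The scalar r multiplies the second leg on its right, where it is absorbed into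
    the argument of f.\<close>
  have shift: "P.coord (contract_right f) (X \<triangleleft>\<^bsub>P.MN\<^esub> r) = P.coord (contract_right (\<lambda>a. f (a \<otimes> r))) X"
    if "X \<in> carrier P.MN" "f \<in> End" "r \<in> carrier base" for X f r
    using that(1) comp_End[OF that(2) right_mult_End[OF that(3)]]
  proof (induction rule: P.tensor_induct)
    case (pure m x)
    have "x \<otimes>\<^bsub>tring\<^esub> src r \<in> centralized"
      using pure that by (simp add: tring_simps(2) sandwich_centralized src_centralized)
    then show ?case using pure that
      by (simp add: P.ract_pure coord_pure)
        (simp add: tring_simps(2) sandwich_src contract_right_ract centralizedD)
  qed (use that in \<open>simp_all add: P.MN.ract_add coord_add\<close>)
  have "coact (m \<otimes>\<^bsub>C\<^esub> \<sigma> r) = coact m \<triangleleft>\<^bsub>P.MN\<^esub> r" if "m \<in> carrier C" "r \<in> carrier base" for m r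
  proof (rule coord_ext)
    fix f assume f: "f \<in> End"
    show "P.coord (contract_right f) (coact (m \<otimes>\<^bsub>C\<^esub> \<sigma> r)) = P.coord (contract_right f) (coact m \<triangleleft>\<^bsub>P.MN\<^esub> r)"
      using that f comp_End[OF f right_mult_End[OF that(2)]]
      by (simp add: shift coact_closed coord_coact P.\<sigma>_closed G_comp[OF f right_mult_End] G_right)
  qed (use that in \<open>simp_all add: coact_closed P.\<sigma>_closed\<close>)
  then show ?thesis
    by (auto simp: right_hom_def add coact_closed intro!: homI)
qed

text \<open>The factor a comes out on the left, and x is absorbed into the functional by the
  adjointness in \<open>contract_right_sandwich\<close>.\<close>

lemma coord_leg_mult:
  assumes f: "f \<in> End" and a: "a \<in> carrier C" and x: "x \<in> centralized" and X: "X \<in> carrier P.MN"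
  shows "P.coord (contract_right f) (P.leg_mult a x X) = a \<otimes>\<^bsub>C\<^esub> P.coord (contract_right (slice f x)) X"
  using X
proof (induction rule: P.tensor_induct)
  case (pure m y)
  then have y: "y \<in> centralized" by simp
  have xy: "x \<otimes>\<^bsub>tring\<^esub> y \<in> centralized"
    using x y by (simp add: tring_simps(2) sandwich_centralized)
  show ?case using pure a x f slice_End[OF f x] xy End_base[of "slice f x" y]
    by (simp add: P.leg_mult_pure coord_pure)
      (simp add: tring_simps(2) contract_right_sandwich centralizedD P.\<sigma>_closed P.A.m_assoc)
qed (use assms slice_End[OF f x] in \<open>simp_all add: P.leg_mult_add coord_add P.leg_mult_closed coord_closed P.A.r_distr\<close>)

text \<open>Along f both sides have the coordinate \<open>\<sigma> r\<close> times G f m: on one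
  side the factor stands in the first leg, on the other tgt r replaces f by
  \<open>a \<mapsto> r f(a)\<close>, and G turns this into left multiplication by
  \<open>\<sigma> r\<close>.\<close>

lemma takeuchi_coact:
  assumes m: "m \<in> carrier C"
  shows "P.takeuchi_elem (coact m)"
  unfolding P.takeuchi_elem_iff
proof (intro conjI ballI)
  show "coact m \<in> carrier P.MN" using m by (rule coact_closed)
  fix r assume r: "r \<in> carrier base"
  have shift: "P.coord (contract_right f) (P.leg_mult \<one>\<^bsub>C\<^esub> (tgt r) X) = P.coord (contract_right (\<lambda>a. r \<otimes> f a)) X"
    if f: "f \<in> End" and X: "X \<in> carrier P.MN" for f X
    using X comp_End[OF left_mult_End[OF r] f]
  proof (induction rule: P.tensor_induct)
    case (pure m y)
    then have y: "y \<in> centralized" by simp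
    have ty: "tgt r \<otimes>\<^bsub>tring\<^esub> y \<in> centralized"
      using y r by (simp add: tring_simps(2) sandwich_centralized tgt_centralized)
    show ?case using pure f ty r
      by (simp add: P.leg_mult_pure coord_pure tgt_centralized)
        (simp add: tring_simps(2) contract_right_tgt centralizedD)
  qed (use f r in \<open>simp_all add: P.leg_mult_add coord_add P.leg_mult_closed tgt_centralized\<close>)
  \<comment> \<open>Proved directly and not taken from \<open>coord_leg_mult\<close>, since slicing
    f by the unit is known to return f only on the carrier of A.\<close>
  have slice_one: "P.coord (contract_right f) (P.leg_mult (\<sigma> r) (\<one> \<otimes>\<^sub>B \<one>) X) = \<sigma> r \<otimes>\<^bsub>C\<^esub> P.coord (contract_right f) X"
    if f: "f \<in> End" and X: "X \<in> carrier P.MN" for f X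
    using X
  proof (induction rule: P.tensor_induct)
    case (pure m y)
    then show ?case using f r ST.T.l_one[of y]
      by (simp add: P.leg_mult_pure coord_pure pure_centralized one_base P.\<sigma>_closed P.A.m_assoc End_base)
  qed (use f r in \<open>simp_all add: P.leg_mult_add coord_add P.leg_mult_closed coord_closed pure_centralized one_base P.\<sigma>_closed P.A.r_distr\<close>)
  show "P.leg_mult (\<sigma> r) \<one>\<^bsub>tring\<^esub> (coact m) = P.leg_mult \<one>\<^bsub>C\<^esub> (tgt r) (coact m)"
  proof (rule coord_ext)
    fix f assume f: "f \<in> End"
    show "P.coord (contract_right f) (P.leg_mult (\<sigma> r) \<one>\<^bsub>tring\<^esub> (coact m)) =
        P.coord (contract_right f) (P.leg_mult \<one>\<^bsub>C\<^esub> (tgt r) (coact m))"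
      using m f r comp_End[OF left_mult_End[OF r] f]
      by (simp add: slice_one shift coact_closed coord_coact G_comp[OF left_mult_End f] G_left G_closed)
  qed (use m r in \<open>simp_all add: P.leg_mult_closed coact_closed P.\<sigma>_closed tgt_centralized pure_centralized one_base\<close>)
qed

text \<open>The coordinate along f of the product on the right is the sum of the
  \<open>G (\<gamma> j) m\<close> times \<open>G (slice f (u j)) m'\<close>, that is, G f applied to
  the product by \<open>G_mult\<close>.\<close>

lemma coact_mult:
  assumes "m \<in> carrier C" "m' \<in> carrier C"
  shows "coact (m \<otimes>\<^bsub>C\<^esub> m') = tensor_mult (carrier base) P.M ST.Tbim C tring (coact m) (coact m')"
proof (rule coord_ext)
  let ?mult = "\<lambda>X. tensor_mult (carrier base) P.M ST.Tbim C tring X (coact m')"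
  note hom = P.tensor_mult_hom[OF takeuchi_coact[OF assms(2)]]
  show "?mult (coact m) \<in> carrier P.MN"
    using hom coact_closed[OF assms(1)] by (auto simp: hom_def)
  fix f assume f: "f \<in> End"
  have "P.coord (contract_right f) (?mult (coact m)) =
      finprod P.M (\<lambda>j. P.coord (contract_right f) (?mult (P.pure (G (\<gamma> j) m) (u j)))) {..<n}"
    using hom_compose[OF hom coord_hom[OF f]] assms
    by (intro coact_map P.M.comm_group_axioms) (simp_all add: comp_def)
  also have "\<dots> = finprod P.M (\<lambda>j. G (\<gamma> j) m \<otimes>\<^bsub>C\<^esub> G (slice f (u j)) m') {..<n}"
    using assms f \<gamma> u
    by (intro P.M.finprod_cong'[OF refl])
      (auto simp: P.tensor_mult_pure takeuchi_coact G_closed coord_leg_mult coact_closed slice_End coord_coact)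
  also have "\<dots> = P.coord (contract_right f) (coact (m \<otimes>\<^bsub>C\<^esub> m'))"
    using assms f by (simp add: coord_coact G_mult)
  finally show "P.coord (contract_right f) (coact (m \<otimes>\<^bsub>C\<^esub> m')) = P.coord (contract_right f) (?mult (coact m))" ..
qed (use assms in \<open>simp add: coact_closed\<close>)

text \<open>Both sides have the coordinate \<open>\<sigma> (f 1)\<close> along f.\<close>

lemma coact_one: "coact \<one>\<^bsub>C\<^esub> = P.pure \<one>\<^bsub>C\<^esub> \<one>\<^bsub>tring\<^esub>"
proof (rule coord_ext)
  fix f assume f: "f \<in> End"
  have "f \<one> \<in> carrier base" using base_value[OF f one_base] .
  then show "P.coord (contract_right f) (coact \<one>\<^bsub>C\<^esub>) = P.coord (contract_right f) (P.pure \<one>\<^bsub>C\<^esub> \<one>\<^bsub>tring\<^esub>)"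
    using f by (simp add: coord_coact G_one coord_pure pure_centralized one_base P.\<sigma>_closed
        contract_right_pure End_left_hom EndD)
qed (simp_all add: coact_closed P.pure_closed' pure_centralized one_base)

lemma coact_counit: "m \<in> carrier C \<Longrightarrow> P.coord (contract_right (\<lambda>a. a)) (coact m) = m"
  by (simp add: coord_coact id_End G_id)

end

section \<open>The two instances: the bialgebroid itself and the ring A\<close>

context right_d2
begin

text \<open>The product rule \<open>End_mult\<close>, applied in the second factor of a
  tensor.\<close>

lemma apply_right_ract_expansion:
  assumes f: "f \<in> End" and X: "X \<in> carrier AA" and q: "q \<in> carrier A"
  shows "apply_right f (X \<triangleleft>\<^bsub>AA\<^esub> q) =
    finprod AA (\<lambda>j. apply_right (\<gamma> j) X \<triangleleft>\<^bsub>AA\<^esub> slice f (u j) q) {..<n}"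
proof (rule AA.hom_ext[OF _ _ _ X])
  have s: "slice f (u j) q \<in> carrier A" if "j < n" for j
    using EndD(3)[OF slice_End[OF f u[OF that]] q] .
  show "(\<lambda>X. apply_right f (X \<triangleleft>\<^bsub>AA\<^esub> q)) \<in> hom AA AA"
    using hom_compose[OF AA.MN.ract_hom[OF q] apply_right_hom[OF f]] by (simp add: comp_def)
  have "(\<lambda>X. apply_right (\<gamma> j) X \<triangleleft>\<^bsub>AA\<^esub> slice f (u j) q) \<in> hom AA AA" if "j < n" for j
    using hom_compose[OF apply_right_hom[OF \<gamma>[OF that]] AA.MN.ract_hom[OF s[OF that]]] by (simp add: comp_def)
  then show "(\<lambda>X. finprod AA (\<lambda>j. apply_right (\<gamma> j) X \<triangleleft>\<^bsub>AA\<^esub> slice f (u j) q) {..<n}) \<in> hom AA AA"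
    by (intro AA.MN.hom_finprod_pointwise AA.MN.is_group) simp
  fix a c assume "a \<in> carrier (regular A)" "c \<in> carrier (regular A)"
  then have ac: "a \<in> carrier A" "c \<in> carrier A" by simp_all
  have "apply_right f ((a \<otimes>\<^sub>B c) \<triangleleft>\<^bsub>AA\<^esub> q) = a \<otimes>\<^sub>B f (c \<otimes> q)"
    using ac q f AA.ract_pure[of q a c] by (simp add: apply_right_pure)
  also have "\<dots> = finprod AA (\<lambda>j. a \<otimes>\<^sub>B (\<gamma> j c \<otimes> slice f (u j) q)) {..<n}"
    unfolding End_mult[OF f ac(2) q] using ac s EndD(3)[OF \<gamma>]
    by (intro comm_group_hom_finprod[OF reg.comm_group_axioms AA.MN.comm_group_axioms] AA.pure_hom_right) auto
  also have "\<dots> = finprod AA (\<lambda>j. apply_right (\<gamma> j) (a \<otimes>\<^sub>B c) \<triangleleft>\<^bsub>AA\<^esub> slice f (u j) q) {..<n}"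
  proof (rule AA.MN.finprod_cong'[OF refl])
    show "a \<otimes>\<^sub>B (\<gamma> j c \<otimes> slice f (u j) q) = apply_right (\<gamma> j) (a \<otimes>\<^sub>B c) \<triangleleft>\<^bsub>AA\<^esub> slice f (u j) q" if "j \<in> {..<n}" for j
      using ac s[of j] that EndD(3)[OF \<gamma>[of j]] AA.ract_pure[of "slice f (u j) q" a "\<gamma> j c"] \<gamma>[of j]
      by (simp add: apply_right_pure)
    show "(\<lambda>j. apply_right (\<gamma> j) (a \<otimes>\<^sub>B c) \<triangleleft>\<^bsub>AA\<^esub> slice f (u j) q) \<in> {..<n} \<rightarrow> carrier AA"
      using ac s \<gamma> by (auto intro!: apply_right_closed AA.pure_closed AA.MN.ract_closed)
  qed
  finally show "apply_right f ((a \<otimes>\<^sub>B c) \<triangleleft>\<^bsub>AA\<^esub> q) =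
    finprod AA (\<lambda>j. apply_right (\<gamma> j) (a \<otimes>\<^sub>B c) \<triangleleft>\<^bsub>AA\<^esub> slice f (u j) q) {..<n}" .
qed

text \<open>The product rule for the action of S on T: since the product of T multiplies the second
  legs in the order of A, it follows from the rule in A after left multiplication by p.\<close>

lemma apply_right_sandwich:
  assumes f: "f \<in> End" and X: "X \<in> centralized" and Y: "Y \<in> carrier AA"
  shows "apply_right f (sandwich X Y) =
    finprod AA (\<lambda>j. sandwich (apply_right (\<gamma> j) X) (apply_right (slice f (u j)) Y)) {..<n}"
proof (rule AA.hom_ext[OF _ _ _ Y])
  note X' = centralizedD(1)[OF X]
  have E: "apply_right (\<gamma> j) X \<in> centralized" if "j < n" for j
    using \<gamma>[OF that] X by (rule apply_right_centralized)
  have S: "slice f (u j) \<in> End" if "j < n" for j using slice_End[OF f u[OF that]] .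
  show "(\<lambda>Y. apply_right f (sandwich X Y)) \<in> hom AA AA"
    using hom_compose[OF sandwich_hom[OF X] apply_right_hom[OF f]] by (simp add: comp_def)
  have "(\<lambda>Y. sandwich (apply_right (\<gamma> j) X) (apply_right (slice f (u j)) Y)) \<in> hom AA AA" if "j < n" for j
    using hom_compose[OF apply_right_hom[OF S[OF that]] sandwich_hom[OF E[OF that]]] by (simp add: comp_def)
  then show "(\<lambda>Y. finprod AA (\<lambda>j. sandwich (apply_right (\<gamma> j) X) (apply_right (slice f (u j)) Y)) {..<n}) \<in> hom AA AA"
    by (intro AA.MN.hom_finprod_pointwise AA.MN.is_group) simp
  fix p q assume "p \<in> carrier (regular A)" "q \<in> carrier (regular A)"
  then have pq: "p \<in> carrier A" "q \<in> carrier A" by simp_all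
  have Sq: "slice f (u j) q \<in> carrier A" if "j < n" for j using EndD(3)[OF S[OF that] pq(2)] .
  have "apply_right f (sandwich X (p \<otimes>\<^sub>B q)) = p \<triangleright>\<^bsub>AA\<^esub> apply_right f (X \<triangleleft>\<^bsub>AA\<^esub> q)"
    using pq X X' f by (simp add: sandwich_pure apply_right_lact)
  also have "\<dots> = finprod AA (\<lambda>j. p \<triangleright>\<^bsub>AA\<^esub> (apply_right (\<gamma> j) X \<triangleleft>\<^bsub>AA\<^esub> slice f (u j) q)) {..<n}"
    unfolding apply_right_ract_expansion[OF f X' pq(2)] using pq E[THEN centralizedD(1)] Sq
    by (intro comm_group_hom_finprod[OF AA.MN.comm_group_axioms AA.MN.comm_group_axioms] AA.MN.lact_hom) auto
  also have "\<dots> = finprod AA (\<lambda>j. sandwich (apply_right (\<gamma> j) X) (apply_right (slice f (u j)) (p \<otimes>\<^sub>B q))) {..<n}"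
    using pq E centralizedD(1)[OF E] S Sq
    by (intro AA.MN.finprod_cong'[OF refl]) (auto simp: apply_right_pure sandwich_pure)
  finally show "apply_right f (sandwich X (p \<otimes>\<^sub>B q)) =
    finprod AA (\<lambda>j. sandwich (apply_right (\<gamma> j) X) (apply_right (slice f (u j)) (p \<otimes>\<^sub>B q))) {..<n}" .
qed

text \<open>S acts on T through the second leg. There right multiplication by r is right
  multiplication by src r in T, which explains why the base is embedded by the source map.\<close>

lemma d2_module_tring:
  "d2_module A B n \<gamma> u tring src (carrier base) (\<lambda>r x. x \<otimes>\<^bsub>tring\<^esub> tgt r) apply_right"
proof (intro d2_module.intro right_d2_axioms d2_module_axioms.intro)
  show "algebra_pair base tring tring src tgt (carrier base) (carrier base)
    (\<lambda>r x. x \<otimes>\<^bsub>tring\<^esub> tgt r) (\<lambda>x r. x \<otimes>\<^bsub>tring\<^esub> src r)"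
    by (rule ST.algebra_pair_TT)
  show "apply_right f (X \<otimes>\<^bsub>tring\<^esub> Y) = finprod (bimodule_on tring (\<lambda>r x. x \<otimes>\<^bsub>tring\<^esub> tgt r) (\<lambda>a r. a \<otimes>\<^bsub>tring\<^esub> src r))
      (\<lambda>j. apply_right (\<gamma> j) X \<otimes>\<^bsub>tring\<^esub> apply_right (slice f (u j)) Y) {..<n}"
    if "f \<in> End" "X \<in> carrier tring" "Y \<in> carrier tring" for f X Y
    using that \<gamma> u unfolding ST.Tbim_def[symmetric]
    by (subst finprod_Tbim)
      (auto simp: tring_simps(2) apply_right_sandwich centralizedD sandwich_centralized apply_right_centralized slice_End)
  show "apply_right f \<one>\<^bsub>tring\<^esub> = src (f \<one>)" if "f \<in> End" for f
    using that by (simp add: apply_right_pure src_def)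
qed (simp_all add: tring_simps(2) apply_right_centralized apply_right_add apply_right_comp apply_right_id
    apply_right_right_mult apply_right_left_mult sandwich_src centralizedD)

lemma algebra_pair_A:
  "algebra_pair base A tring (\<lambda>r. r) tgt (carrier A) (carrier base) (monoid.mult A) (\<lambda>x r. x \<otimes>\<^bsub>tring\<^esub> src r)"
proof (intro algebra_pair.intro algebra_pair_axioms.intro ring_base ring_tring A.ring_axioms)
  show "(\<lambda>r. r) \<in> ring_hom base A"
    using baseD(1) by (auto intro!: ring_hom_memI)
  have "bimod (carrier A) (carrier base) (regular A)"
    using baseD(1) by (intro reg.bimod_subset) auto
  then show "bimod (carrier A) (carrier base) (bimodule_on A (monoid.mult A) (\<lambda>a r. a \<otimes> r))"
    by (simp add: regular_def)
  show "bimod (carrier base) (carrier base) (bimodule_on tring (\<lambda>r x. x \<otimes>\<^bsub>tring\<^esub> tgt r) (\<lambda>x r. x \<otimes>\<^bsub>tring\<^esub> src r))"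
    using bimod_tring by (simp add: ST.Tbim_def)
qed (simp add: tgt_centralized)

lemma d2_module_A: "d2_module A B n \<gamma> u A (\<lambda>r. r) (carrier A) (monoid.mult A) (\<lambda>f. f)"
proof (intro d2_module.intro right_d2_axioms d2_module_axioms.intro algebra_pair_A)
  show "f (m \<otimes> m') = finprod (bimodule_on A (monoid.mult A) (\<lambda>a r. a \<otimes> r)) (\<lambda>j. \<gamma> j m \<otimes> slice f (u j) m') {..<n}"
    if "f \<in> End" "m \<in> carrier A" "m' \<in> carrier A" for f m m'
    using End_mult[OF that] by (simp add: regular_def)
qed (simp_all add: EndD)

text \<open>The coaction of T on itself for the instance above, spelled with the constants of the
  bialgebroid axioms; \<open>comult_eq\<close> makes the identification.\<close>

definition comult :: "('a, 'a) tensor \<Rightarrow> (('a, 'a) tensor, ('a, 'a) tensor) tensor" where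
  "comult x = finprod ST.TT (\<lambda>j. ST.pureTT (apply_right (\<gamma> j) x) (u j)) {..<n}"

lemma comult_eq:
  "d2_module.coact A B n \<gamma> u tring src (\<lambda>r x. x \<otimes>\<^bsub>tring\<^esub> tgt r) apply_right = comult"
  unfolding d2_module.coact_def[OF d2_module_tring, abs_def] comult_def[abs_def] ST.TT_def ST.pureTT_def ST.Tbim_def ..

lemmas comult_facts =
  d2_module.coact_right_hom[OF d2_module_tring, unfolded comult_eq, folded ST.Tbim_def]
  d2_module.takeuchi_coact[OF d2_module_tring, unfolded comult_eq, folded ST.Tbim_def]
  d2_module.coact_mult[OF d2_module_tring, unfolded comult_eq, folded ST.Tbim_def]
  d2_module.coact_one[OF d2_module_tring, unfolded comult_eq, folded ST.Tbim_def]
  d2_module.coact_counit[OF d2_module_tring, unfolded comult_eq, folded ST.Tbim_def]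

lemma comult_closed: "x \<in> centralized \<Longrightarrow> comult x \<in> carrier ST.TT"
  using comult_facts(1) by (auto simp: right_hom_def hom_def ST.TT_def)

text \<open>Right linearity is part of the general facts on coactions. Left linearity is special to
  T: r multiplies the first leg of a tensor from the left, and \<open>apply_right\<close> does not
  touch that leg.\<close>

lemma comult_bimodule_hom: "comult \<in> bimodule_hom (carrier base) (carrier base) ST.Tbim ST.TT"
proof (rule bimodule_homI)
  show "comult (m \<triangleleft>\<^bsub>ST.Tbim\<^esub> r) = comult m \<triangleleft>\<^bsub>ST.TT\<^esub> r" if "r \<in> carrier base" "m \<in> carrier ST.Tbim" for r m
    using comult_facts(1) that by (simp add: right_hom_def ST.TT_def del: ST.Tbim_simps)
  show "comult \<in> hom ST.Tbim ST.TT"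
    using comult_facts(1) by (simp add: right_hom_def ST.TT_def)
  fix r x assume r: "r \<in> carrier base" and "x \<in> carrier ST.Tbim"
  then have x: "x \<in> centralized" by simp
  have closed: "apply_right (\<gamma> j) x \<in> centralized" "u j \<in> centralized" if "j < n" for j
    using apply_right_centralized[OF \<gamma>[OF that] x] u[OF that] .
  have "r \<triangleright>\<^bsub>ST.TT\<^esub> comult x = finprod ST.TT (\<lambda>j. r \<triangleright>\<^bsub>ST.TT\<^esub> ST.pureTT (apply_right (\<gamma> j) x) (u j)) {..<n}"
    unfolding comult_def ST.TT_def ST.pureTT_def using r closed
    by (intro comm_group_hom_finprod[OF ST.TT_pair.MN.comm_group_axioms ST.TT_pair.MN.comm_group_axioms]
        ST.TT_pair.MN.lact_hom) (auto intro!: ST.TT_pair.pure_closed)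
  also have "\<dots> = comult (r \<triangleright>\<^bsub>ST.Tbim\<^esub> x)"
    unfolding comult_def ST.TT_def ST.pureTT_def
  proof (rule ST.TT_pair.MN.finprod_cong'[OF refl])
    fix j assume "j \<in> {..<n}"
    then have j: "j < n" by simp
    have "apply_right (\<gamma> j) (r \<triangleright>\<^bsub>ST.Tbim\<^esub> x) = r \<triangleright>\<^bsub>ST.Tbim\<^esub> apply_right (\<gamma> j) x"
      using x r closed[OF j] \<gamma>[OF j] baseD(1)[OF r]
      by (simp add: tring_simps(2) sandwich_tgt apply_right_lact centralizedD)
    then show "r \<triangleright>\<^bsub>ST.TT_pair.MN\<^esub> ST.TT_pair.pure (apply_right (\<gamma> j) x) (u j) =
        ST.TT_pair.pure (apply_right (\<gamma> j) (r \<triangleright>\<^bsub>ST.Tbim\<^esub> x)) (u j)"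
      using r closed[OF j] ST.TT_pair.lact_pure[of r "apply_right (\<gamma> j) x" "u j"] by simp
  next
    have "r \<triangleright>\<^bsub>ST.Tbim\<^esub> x \<in> centralized"
      using x r by (simp add: tring_simps(2) sandwich_centralized tgt_centralized)
    then show "(\<lambda>j. ST.TT_pair.pure (apply_right (\<gamma> j) (r \<triangleright>\<^bsub>ST.Tbim\<^esub> x)) (u j)) \<in> {..<n} \<rightarrow> carrier ST.TT_pair.MN"
      using apply_right_centralized[OF \<gamma>] u by (auto intro!: ST.TT_pair.pure_closed simp del: ST.Tbim_simps(4))
  qed
  finally show "comult (r \<triangleright>\<^bsub>ST.Tbim\<^esub> x) = r \<triangleright>\<^bsub>ST.TT\<^esub> comult x" ..
qed

end

section \<open>Coassociativity, for both instances at once\<close>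

context d2_module
begin

text \<open>Both sides are brought to the double sum over i and j of \<open>G (\<gamma> j) m
  \<otimes> ((id \<otimes> \<gamma>\<^sub>i) u\<^sub>j \<otimes> u\<^sub>i)\<close>. For C = T this
  is coassociativity of the comultiplication, for C = A that of the coaction.\<close>

lemma coact_coassoc:
  assumes m: "m \<in> carrier C"
  shows "tensor_assoc (carrier base) P.M ST.Tbim ST.Tbim
      (tensor_map (carrier base) P.MN ST.Tbim coact (\<lambda>x. x) (coact m)) =
    tensor_map (carrier base) P.M ST.TT (\<lambda>x. x) comult (coact m)"
proof -
  interpret K: bimod_pair L "carrier base" "carrier base" P.M ST.TT
    unfolding ST.TT_def by (intro bimod_pair.intro P.M.bimod_axioms ST.TT_pair.bimod_tensor)
  interpret Q: bimod_pair L "carrier base" "carrier base" P.MN ST.Tbim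
    by (intro bimod_pair.intro P.bimod_tensor bimod_tring)
  let ?assoc = "tensor_assoc (carrier base) P.M ST.Tbim ST.Tbim"
  have assoc_hom: "?assoc \<in> hom Q.MN K.MN"
    using tensor_assoc_hom[OF P.M.bimod_axioms bimod_tring bimod_tring] by (simp add: ST.TT_def)
  have assoc_pure: "?assoc (Q.pure (P.pure c x) y) = K.pure c (ST.pureTT x y)"
    if "c \<in> carrier C" "x \<in> centralized" "y \<in> centralized" for c x y
    using tensor_assoc_pure[OF P.M.bimod_axioms bimod_tring bimod_tring, of c x y] that
    by (simp add: ST.TT_def ST.pureTT_def)
  have pureTT_closed: "ST.pureTT x y \<in> carrier ST.TT" if "x \<in> centralized" "y \<in> centralized" for x y
    using ST.TT_pair.pure_closed[of x y] that by (simp add: ST.TT_def ST.pureTT_def)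
  have Gm: "G (\<gamma> j) m \<in> carrier C" if "j < n" for j using that m \<gamma> G_closed by blast
  have E: "apply_right (\<gamma> i) (u j) \<in> centralized" if "i < n" "j < n" for i j
    using apply_right_centralized[OF \<gamma> u] that by blast
  define h where "h i X = ?assoc (Q.pure X (u i))" for i X
  have h_hom: "h i \<in> hom P.MN K.MN" if "i < n" for i
    using hom_compose[OF Q.pure_hom_left assoc_hom, of "u i"] u[OF that] by (simp add: comp_def h_def[abs_def])
  have map1: "tensor_map (carrier base) P.MN ST.Tbim coact (\<lambda>x. x) \<in> hom P.MN Q.MN"
    "c \<in> carrier C \<Longrightarrow> x \<in> centralized \<Longrightarrow>
      tensor_map (carrier base) P.MN ST.Tbim coact (\<lambda>x. x) (P.pure c x) = Q.pure (coact c) x" for c x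
    using tensor_map_hom[OF P.bimod_pair_axioms Q.bimod_pair_axioms coact_right_hom P.id_left_hom]
      tensor_map_pure[OF P.bimod_pair_axioms Q.bimod_pair_axioms coact_right_hom P.id_left_hom, of c x]
    by simp_all
  have comult: "comult \<in> left_hom (carrier base) ST.Tbim ST.TT"
    using comult_bimodule_hom by (simp add: bimodule_hom_def)
  have map2: "tensor_map (carrier base) P.M ST.TT (\<lambda>x. x) comult \<in> hom P.MN K.MN"
    "c \<in> carrier C \<Longrightarrow> x \<in> centralized \<Longrightarrow>
      tensor_map (carrier base) P.M ST.TT (\<lambda>x. x) comult (P.pure c x) = K.pure c (comult x)" for c x
    using tensor_map_hom[OF P.bimod_pair_axioms K.bimod_pair_axioms P.id_right_hom comult]
      tensor_map_pure[OF P.bimod_pair_axioms K.bimod_pair_axioms P.id_right_hom comult, of c x]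
    by simp_all
  \<comment> \<open>Rewrites the coaction of \<open>G (\<gamma> i) m\<close> so that the first leg
    no longer depends on i. Along f both sides have coordinate
    \<open>G (f \<circ> \<gamma> i) m\<close>.\<close>
  have inner: "finprod P.MN (\<lambda>j. P.pure (G (\<gamma> j) m) (apply_right (\<gamma> i) (u j))) {..<n} = coact (G (\<gamma> i) m)"
    if i: "i < n" for i
  proof (rule coord_ext)
    show "finprod P.MN (\<lambda>j. P.pure (G (\<gamma> j) m) (apply_right (\<gamma> i) (u j))) {..<n} \<in> carrier P.MN"
      using Gm E i by (intro P.MN.finprod_closed) (auto intro!: P.pure_closed')
    fix f assume f: "f \<in> End"
    have fi: "(\<lambda>a. f (\<gamma> i a)) \<in> End" using f \<gamma>[OF i] by (rule comp_End)
    have "P.coord (contract_right f) (finprod P.MN (\<lambda>j. P.pure (G (\<gamma> j) m) (apply_right (\<gamma> i) (u j))) {..<n}) =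
       finprod P.M (\<lambda>j. P.coord (contract_right f) (P.pure (G (\<gamma> j) m) (apply_right (\<gamma> i) (u j)))) {..<n}"
      using Gm E i
      by (intro comm_group_hom_finprod[OF P.MN.comm_group_axioms P.M.comm_group_axioms coord_hom[OF f]])
        (auto intro!: P.pure_closed')
    also have "\<dots> = finprod P.M (\<lambda>j. G (\<gamma> j) m \<otimes>\<^bsub>C\<^esub> \<sigma> (contract_right (\<lambda>a. f (\<gamma> i a)) (u j))) {..<n}"
      using Gm E i f fi u \<gamma>[OF i]
      by (intro P.M.finprod_cong'[OF refl])
        (auto simp: coord_pure contract_right_comp centralizedD End_base P.\<sigma>_closed)
    also have "\<dots> = G f (G (\<gamma> i) m)"
      using G_rec[OF fi m] G_comp[OF f \<gamma>[OF i] m] by simp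
    also have "\<dots> = P.coord (contract_right f) (coact (G (\<gamma> i) m))"
      using f Gm[OF i] by (simp add: coord_coact)
    finally show "P.coord (contract_right f) (finprod P.MN (\<lambda>j. P.pure (G (\<gamma> j) m) (apply_right (\<gamma> i) (u j))) {..<n}) =
      P.coord (contract_right f) (coact (G (\<gamma> i) m))" .
  qed (simp add: coact_closed Gm[OF i])
  have "?assoc (tensor_map (carrier base) P.MN ST.Tbim coact (\<lambda>x. x) (coact m)) =
      ?assoc (finprod Q.MN (\<lambda>i. Q.pure (coact (G (\<gamma> i) m)) (u i)) {..<n})"
    unfolding coact_map[OF Q.MN.comm_group_axioms map1(1) m] using Gm u
    by (intro arg_cong[of _ _ ?assoc] Q.MN.finprod_cong'[OF refl]) (auto simp: map1(2) coact_closed intro!: Q.pure_closed)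
  also have "\<dots> = finprod K.MN (\<lambda>i. h i (coact (G (\<gamma> i) m))) {..<n}"
    unfolding h_def using Gm u
    by (intro comm_group_hom_finprod[OF Q.MN.comm_group_axioms K.MN.comm_group_axioms assoc_hom])
      (auto intro!: Q.pure_closed coact_closed)
  also have "\<dots> = finprod K.MN (\<lambda>i. finprod K.MN (\<lambda>j. K.pure (G (\<gamma> j) m) (ST.pureTT (apply_right (\<gamma> i) (u j)) (u i))) {..<n}) {..<n}"
  proof (rule K.MN.finprod_cong'[OF refl])
    fix i assume "i \<in> {..<n}"
    then have i: "i < n" by simp
    have "h i (coact (G (\<gamma> i) m)) = finprod K.MN (\<lambda>j. h i (P.pure (G (\<gamma> j) m) (apply_right (\<gamma> i) (u j)))) {..<n}"
      unfolding inner[OF i, symmetric] using Gm E i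
      by (intro comm_group_hom_finprod[OF P.MN.comm_group_axioms K.MN.comm_group_axioms h_hom[OF i]])
        (auto intro!: P.pure_closed')
    also have "\<dots> = finprod K.MN (\<lambda>j. K.pure (G (\<gamma> j) m) (ST.pureTT (apply_right (\<gamma> i) (u j)) (u i))) {..<n}"
      using Gm E i u
      by (intro K.MN.finprod_cong'[OF refl]) (auto simp: h_def assoc_pure intro!: K.pure_closed pureTT_closed)
    finally show "h i (coact (G (\<gamma> i) m)) = finprod K.MN (\<lambda>j. K.pure (G (\<gamma> j) m) (ST.pureTT (apply_right (\<gamma> i) (u j)) (u i))) {..<n}" .
  qed (use Gm E u in \<open>auto intro!: K.MN.finprod_closed K.pure_closed pureTT_closed\<close>)
  \<comment> \<open>With j outermost, the sum over i is the comultiplication of u j.\<close>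
  also have "\<dots> = finprod K.MN (\<lambda>j. finprod K.MN (\<lambda>i. K.pure (G (\<gamma> j) m) (ST.pureTT (apply_right (\<gamma> i) (u j)) (u i))) {..<n}) {..<n}"
    using Gm E u by (intro K.MN.finprod_swap) (auto intro!: K.pure_closed pureTT_closed)
  also have "\<dots> = finprod K.MN (\<lambda>j. K.pure (G (\<gamma> j) m) (comult (u j))) {..<n}"
  proof (rule K.MN.finprod_cong'[OF refl])
    fix j assume "j \<in> {..<n}"
    then show "finprod K.MN (\<lambda>i. K.pure (G (\<gamma> j) m) (ST.pureTT (apply_right (\<gamma> i) (u j)) (u i))) {..<n} =
        K.pure (G (\<gamma> j) m) (comult (u j))"
      unfolding comult_def using Gm E u
      by (intro comm_group_hom_finprod[symmetric, OF K.N.comm_group_axioms K.MN.comm_group_axioms] K.pure_hom_right)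
        (auto intro!: pureTT_closed)
  qed (use Gm u comult_closed in \<open>auto intro!: K.pure_closed\<close>)
  also have "\<dots> = tensor_map (carrier base) P.M ST.TT (\<lambda>x. x) comult (coact m)"
    unfolding coact_map[OF K.MN.comm_group_axioms map2(1) m] using Gm u comult_closed
    by (intro K.MN.finprod_cong'[OF refl]) (auto simp: map2(2) intro!: K.pure_closed)
  finally show ?thesis .
qed

end

section \<open>The counit, the comodule algebra and the Galois property\<close>

context right_d2
begin

definition counit :: "('a, 'a) tensor \<Rightarrow> 'a" where
  "counit = contract_right (\<lambda>a. a)"

lemma counit_pure: "a \<in> carrier A \<Longrightarrow> c \<in> carrier A \<Longrightarrow> counit (a \<otimes>\<^sub>B c) = a \<otimes> c"
  by (simp add: counit_def contract_right_pure End_left_hom id_End)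

lemma counit_closed: "X \<in> carrier AA \<Longrightarrow> counit X \<in> carrier A"
  by (simp add: counit_def End_left_hom id_End)

lemma counit_add: "X \<in> carrier AA \<Longrightarrow> Y \<in> carrier AA \<Longrightarrow> counit (X \<otimes>\<^bsub>AA\<^esub> Y) = counit X \<oplus> counit Y"
  by (simp add: counit_def End_left_hom id_End contract_right_add)

lemma counit_base: "X \<in> centralized \<Longrightarrow> counit X \<in> carrier base"
  by (simp add: counit_def End_base id_End)

lemma counit_lact: "a \<in> carrier A \<Longrightarrow> X \<in> carrier AA \<Longrightarrow> counit (a \<triangleright>\<^bsub>AA\<^esub> X) = a \<otimes> counit X"
  by (simp add: counit_def End_left_hom id_End contract_right_lact)

lemma counit_ract:
  assumes "a \<in> carrier A" "X \<in> carrier AA"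
  shows "counit (X \<triangleleft>\<^bsub>AA\<^esub> a) = counit X \<otimes> a"
  using assms(2,1)
  by (induction rule: AA.tensor_induct)
    (simp_all add: AA.ract_pure AA.MN.ract_add counit_pure counit_add counit_closed A.m_assoc A.l_distr)

text \<open>For Y the pure tensor of p and q all three values are p (counit X) q, as X enters only
  through the product of its legs.\<close>

lemma counit_sandwich:
  assumes X: "X \<in> centralized" and Y: "Y \<in> carrier AA"
  shows "counit (sandwich X Y) = counit (sandwich (src (counit X)) Y)"
    and "counit (sandwich X Y) = counit (sandwich (tgt (counit X)) Y)"
proof -
  note X' = centralizedD(1)[OF X] counit_base[OF X] baseD(1)[OF counit_base[OF X]]
  note st = src_centralized[OF X'(2)] tgt_centralized[OF X'(2)]
  have st': "counit (src (counit X)) = counit X" "counit (tgt (counit X)) = counit X"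
    using X' by (simp_all add: src_def tgt_def counit_pure)
  show "counit (sandwich X Y) = counit (sandwich (src (counit X)) Y)"
    using Y by (induction rule: AA.tensor_induct)
      (simp_all add: X X' st st' sandwich_pure sandwich_add sandwich_closed counit_add counit_lact counit_ract centralizedD)
  show "counit (sandwich X Y) = counit (sandwich (tgt (counit X)) Y)"
    using Y by (induction rule: AA.tensor_induct)
      (simp_all add: X X' st st' sandwich_pure sandwich_add sandwich_closed counit_add counit_lact counit_ract centralizedD)
qed

lemma counit_bimodule_hom: "counit \<in> bimodule_hom (carrier base) (carrier base) ST.Tbim (regular base)"
  using baseD(1)
  by (intro bimodule_homI homI)
    (simp_all add: counit_base counit_add counit_lact counit_ract centralizedD tring_simps(2) sandwich_tgt sandwich_src)

text \<open>The counit axiom not contained in the facts on coactions. The counit of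
  \<open>(id \<otimes> \<gamma>\<^sub>j) x\<close> is the j-th coordinate of x, so the sum is the
  dual basis expansion of x.\<close>

lemma counit_left:
  assumes x: "x \<in> centralized"
  shows "tensor_lift ST.Tbim (\<lambda>y z. counit y \<triangleright>\<^bsub>ST.Tbim\<^esub> z) (comult x) = x"
proof -
  have comm: "comm_group ST.Tbim" using bimod_tring by (rule bimod.axioms(1))
  have closed: "apply_right (\<gamma> j) x \<in> centralized" "u j \<in> centralized" if "j < n" for j
    using apply_right_centralized[OF \<gamma>[OF that] x] u[OF that] .
  have bal: "balanced_map (carrier base) ST.Tbim ST.Tbim ST.Tbim (\<lambda>y z. counit y \<triangleright>\<^bsub>ST.Tbim\<^esub> z)"
  proof (rule balanced_mapI)
    fix y z r assume "y \<in> carrier ST.Tbim" "z \<in> carrier ST.Tbim" and r: "r \<in> carrier base"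
    then have yz: "y \<in> centralized" "z \<in> centralized" by simp_all
    have y': "y \<triangleleft>\<^bsub>AA\<^esub> r \<in> centralized"
      using sandwich_centralized[OF yz(1) src_centralized[OF r]] yz r by (simp add: sandwich_src)
    have z': "sandwich z (tgt r) \<in> centralized"
      using sandwich_centralized[OF yz(2) tgt_centralized[OF r]] .
    have "counit y \<otimes> r \<in> carrier base" using counit_base[OF y'] yz r baseD(1) by (simp add: counit_ract centralizedD)
    then show "counit (y \<triangleleft>\<^bsub>ST.Tbim\<^esub> r) \<triangleright>\<^bsub>ST.Tbim\<^esub> z = counit y \<triangleright>\<^bsub>ST.Tbim\<^esub> (r \<triangleright>\<^bsub>ST.Tbim\<^esub> z)"
      using yz r z' baseD(1) counit_base
      by (simp add: tring_simps(2) sandwich_src counit_ract centralizedD sandwich_tgt lact_lact)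
  next
    fix y y' z assume "y \<in> carrier ST.Tbim" "y' \<in> carrier ST.Tbim" "z \<in> carrier ST.Tbim"
    then show "counit (y \<otimes>\<^bsub>ST.Tbim\<^esub> y') \<triangleright>\<^bsub>ST.Tbim\<^esub> z =
        counit y \<triangleright>\<^bsub>ST.Tbim\<^esub> z \<otimes>\<^bsub>ST.Tbim\<^esub> counit y' \<triangleright>\<^bsub>ST.Tbim\<^esub> z"
      using ST.R.add.m_closed[of "counit y" "counit y'"] counit_base baseD(1)
      by (simp add: tring_simps(2) counit_add centralizedD sandwich_tgt lact_add_scalar)
  next
    fix y z z' assume "y \<in> carrier ST.Tbim" "z \<in> carrier ST.Tbim" "z' \<in> carrier ST.Tbim"
    then show "counit y \<triangleright>\<^bsub>ST.Tbim\<^esub> (z \<otimes>\<^bsub>ST.Tbim\<^esub> z') =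
        counit y \<triangleright>\<^bsub>ST.Tbim\<^esub> z \<otimes>\<^bsub>ST.Tbim\<^esub> counit y \<triangleright>\<^bsub>ST.Tbim\<^esub> z'"
      using counit_base baseD(1)
      by (simp add: tring_simps(2) centralized_add centralizedD sandwich_tgt AA.MN.lact_add)
  qed (simp add: tring_simps(2) sandwich_centralized tgt_centralized counit_base)
  have "tensor_lift ST.Tbim (\<lambda>y z. counit y \<triangleright>\<^bsub>ST.Tbim\<^esub> z) (comult x) =
      finprod ST.Tbim (\<lambda>j. tensor_lift ST.Tbim (\<lambda>y z. counit y \<triangleright>\<^bsub>ST.Tbim\<^esub> z) (ST.pureTT (apply_right (\<gamma> j) x) (u j))) {..<n}"
    unfolding comult_def ST.TT_def ST.pureTT_def using closed
    by (intro comm_group_hom_finprod[OF ST.TT_pair.MN.comm_group_axioms comm ST.TT_pair.lift_hom[OF comm bal]])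
      (auto intro!: ST.TT_pair.pure_closed)
  also have "\<dots> = finprod ST.Tbim (\<lambda>j. contract_right (\<gamma> j) x \<triangleright>\<^bsub>ST.Tbim\<^esub> u j) {..<n}"
  proof (rule comm_monoid.finprod_cong'[OF comm_group.axioms(1)[OF comm] refl])
    show "tensor_lift ST.Tbim (\<lambda>y z. counit y \<triangleright>\<^bsub>ST.Tbim\<^esub> z) (ST.pureTT (apply_right (\<gamma> j) x) (u j)) =
        contract_right (\<gamma> j) x \<triangleright>\<^bsub>ST.Tbim\<^esub> u j" if "j \<in> {..<n}" for j
    proof -
      have j: "j < n" using that by simp
      have "counit (apply_right (\<gamma> j) x) = contract_right (\<gamma> j) x"
        using contract_right_comp[OF id_End \<gamma>[OF j] centralizedD(1)[OF x]] by (simp add: counit_def)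
      then show ?thesis
        using ST.TT_pair.lift_pure[OF comm bal, of "apply_right (\<gamma> j) x" "u j"] closed[OF j]
        by (simp add: ST.pureTT_def)
    qed
    show "(\<lambda>j. contract_right (\<gamma> j) x \<triangleright>\<^bsub>ST.Tbim\<^esub> u j) \<in> {..<n} \<rightarrow> carrier ST.Tbim"
      using x u \<gamma> by (auto simp: tring_simps(2) sandwich_centralized tgt_centralized End_base)
  qed
  also have "\<dots> = x" using Tbim_expansion[OF x] by simp
  finally show ?thesis .
qed

lemma right_bialgebroid: "right_bialgebroid base tring src tgt comult counit"
proof (intro right_bialgebroid.intro source_target right_bialgebroid_axioms.intro)
  show "comult \<in> bimodule_hom (carrier base) (carrier base) ST.Tbim ST.TT"
    by (rule comult_bimodule_hom)
  show "counit \<in> bimodule_hom (carrier base) (carrier base) ST.Tbim (regular base)"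
    by (rule counit_bimodule_hom)
  fix x assume "x \<in> carrier tring"
  then have x: "x \<in> centralized" by simp
  show "tensor_assoc (carrier base) ST.Tbim ST.Tbim ST.Tbim
       (tensor_map (carrier base) ST.TT ST.Tbim comult (\<lambda>y. y) (comult x)) =
      tensor_map (carrier base) ST.Tbim ST.TT (\<lambda>y. y) comult (comult x)"
    using d2_module.coact_coassoc[OF d2_module_tring, unfolded comult_eq, folded ST.Tbim_def, folded ST.TT_def] x
    by simp
  show "tensor_lift ST.Tbim (\<lambda>y z. counit y \<triangleright>\<^bsub>ST.Tbim\<^esub> z) (comult x) = x"
    using x by (rule counit_left)
  show "tensor_lift ST.Tbim (\<lambda>y z. y \<triangleleft>\<^bsub>ST.Tbim\<^esub> counit z) (comult x) = x"
    using comult_facts(5)[of x] x by (simp add: ST.TT_pair.coord_def counit_def)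
  show "tensor_map (carrier base) ST.Tbim ST.Tbim (\<lambda>y. src r \<otimes>\<^bsub>tring\<^esub> y) (\<lambda>z. z) (comult x) =
      tensor_map (carrier base) ST.Tbim ST.Tbim (\<lambda>y. y) (\<lambda>z. tgt r \<otimes>\<^bsub>tring\<^esub> z) (comult x)"
    if "r \<in> carrier base" for r
    using comult_facts(2)[of x] x that by (simp add: ST.TT_pair.takeuchi_elem_def)
  fix y assume "y \<in> carrier tring"
  then have y: "y \<in> centralized" by simp
  show "comult (x \<otimes>\<^bsub>tring\<^esub> y) = tensor_mult (carrier base) ST.Tbim ST.Tbim tring tring (comult x) (comult y)"
    using comult_facts(3) x y by simp
  show "counit (x \<otimes>\<^bsub>tring\<^esub> y) = counit (src (counit x) \<otimes>\<^bsub>tring\<^esub> y)"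
    "counit (x \<otimes>\<^bsub>tring\<^esub> y) = counit (tgt (counit x) \<otimes>\<^bsub>tring\<^esub> y)"
    using counit_sandwich[OF x centralizedD(1)[OF y]] by (simp_all add: tring_simps(2))
next
  show "comult \<one>\<^bsub>tring\<^esub> = ST.pureTT \<one>\<^bsub>tring\<^esub> \<one>\<^bsub>tring\<^esub>"
    using comult_facts(4) by (simp add: ST.pureTT_def)
  show "counit \<one>\<^bsub>tring\<^esub> = \<one>\<^bsub>base\<^esub>"
    by (simp add: counit_pure)
qed

lemma algebra_over_base: "algebra_over_base base tring src tgt comult counit A (\<lambda>r. r)"
  using baseD(1)
  by (intro algebra_over_base.intro algebra_over_base_axioms.intro right_bialgebroid A.ring_axioms)
    (auto intro!: ring_hom_memI)

sublocale AO: algebra_over_base base tring src tgt comult counit A "\<lambda>r. r"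
  by (rule algebra_over_base)

definition coaction :: "'a \<Rightarrow> ('a, ('a, 'a) tensor) tensor" where
  "coaction a = finprod AO.AT (\<lambda>j. AO.pureAT (\<gamma> j a) (u j)) {..<n}"

lemma coaction_eq:
  "d2_module.coact A B n \<gamma> u A (\<lambda>r. r) (monoid.mult A) (\<lambda>f. f) = coaction"
  unfolding d2_module.coact_def[OF d2_module_A, abs_def] coaction_def[abs_def] AO.AT_def AO.pureAT_def AO.Abim_def ..

lemmas coaction_facts =
  d2_module.coact_right_hom[OF d2_module_A, unfolded coaction_eq, folded AO.Abim_def]
  d2_module.takeuchi_coact[OF d2_module_A, unfolded coaction_eq, folded AO.Abim_def]
  d2_module.coact_mult[OF d2_module_A, unfolded coaction_eq, folded AO.Abim_def]
  d2_module.coact_one[OF d2_module_A, unfolded coaction_eq, folded AO.Abim_def]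
  d2_module.coact_counit[OF d2_module_A, unfolded coaction_eq, folded AO.Abim_def]
  d2_module.coact_coassoc[OF d2_module_A, unfolded coaction_eq, folded AO.Abim_def]
  d2_module.coord_coact[OF d2_module_A, unfolded coaction_eq, folded AO.Abim_def]

lemmas AT_ext = d2_module.coord_ext[OF d2_module_A, folded AO.Abim_def]

lemma right_comodule_algebra:
  "right_comodule_algebra base tring src tgt comult counit A (\<lambda>r. r) coaction"
proof (intro right_comodule_algebra.intro algebra_over_base right_comodule_algebra_axioms.intro)
  show "coaction \<in> right_hom (carrier base) AO.Abim AO.AT"
    using coaction_facts(1) by (simp add: AO.AT_def)
  show "coaction \<one> = AO.pureAT \<one> \<one>\<^bsub>tring\<^esub>"
    using coaction_facts(4) by (simp add: AO.pureAT_def)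
  fix a assume a: "a \<in> carrier A"
  show "tensor_assoc (carrier base) AO.Abim ST.Tbim ST.Tbim
      (tensor_map (carrier base) AO.AT ST.Tbim coaction (\<lambda>x. x) (coaction a)) =
    tensor_map (carrier base) AO.Abim ST.TT (\<lambda>a'. a') comult (coaction a)"
    using coaction_facts(6)[OF a] by (simp add: AO.AT_def)
  show "tensor_lift AO.Abim (\<lambda>a' x. a' \<triangleleft>\<^bsub>AO.Abim\<^esub> counit x) (coaction a) = a"
    using coaction_facts(5)[OF a] by (simp add: AO.AT_pair.coord_def counit_def)
  show "tensor_map (carrier base) AO.Abim ST.Tbim (\<lambda>a'. r \<otimes> a') (\<lambda>x. x) (coaction a) =
      tensor_map (carrier base) AO.Abim ST.Tbim (\<lambda>a'. a') (\<lambda>x. tgt r \<otimes>\<^bsub>tring\<^esub> x) (coaction a)"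
    if "r \<in> carrier base" for r
    using coaction_facts(2)[OF a] that by (simp add: AO.AT_pair.takeuchi_elem_def)
  show "coaction (a \<otimes> a') = tensor_mult (carrier base) AO.Abim ST.Tbim A tring (coaction a) (coaction a')"
    if "a' \<in> carrier A" for a'
    using coaction_facts(3) a that by blast
qed

text \<open>Right multiplication by a commutes with every f in \<open>End(A\<^sub>B)\<close>, which
  one sees by applying \<open>p \<otimes> q \<mapsto> f(x p) q\<close> to the equation. Balancedness
  then produces an element of B, equal to a by evaluation at 1.\<close>

lemma tensor_commute_coinvariant:
  assumes bal: "balanced A B" and a: "a \<in> carrier A" and eq: "\<one> \<otimes>\<^sub>B a = a \<otimes>\<^sub>B \<one>"
  shows "a \<in> B"
proof -
  let ?g = "\<lambda>x. x \<otimes> a"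
  have hom: "?g \<in> hom (add_monoid A) (add_monoid A)"
    using a by (intro homI) (simp_all add: A.l_distr)
  have comm: "?g (f x) = f (?g x)" if f: "f \<in> right_End A B" and x: "x \<in> carrier A" for f x
  proof -
    have f': "f \<in> right_hom B (regular A) (regular A)" using f by (simp add: right_End_def)
    have F: "(\<lambda>p. f (x \<otimes> p)) \<in> right_hom B (regular A) (regular A)"
      using x right_homD[OF f'] unfolding right_hom_def
      by (auto intro!: homI simp: A.r_distr simp flip: A.m_assoc)
    have "f x \<otimes> a = contract_left (\<lambda>p. f (x \<otimes> p)) (\<one> \<otimes>\<^sub>B a)"
      using x a F by (simp add: contract_left_pure)
    also have "\<dots> = f (x \<otimes> a)"
      unfolding eq using x a F right_homD(3)[OF f'] by (simp add: contract_left_pure)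
    finally show ?thesis .
  qed
  obtain b where b: "b \<in> B" "\<forall>x\<in>carrier A. x \<otimes> a = x \<otimes> b"
    using bal[unfolded balanced_def, rule_format, OF hom comm] by blast
  then have "a = b" by (metis A.l_one A.one_closed B_closed a b)
  with b show ?thesis by simp
qed

text \<open>In coordinates, coinvariance says that f(a) = a f(1) for all f in \<open>End\<close>.
  For a in B this is left B-linearity; conversely, the cases of the \<open>\<gamma> j\<close> turn
  the expansion of \<open>1 \<otimes> a\<close> into a times that of
  \<open>1 \<otimes> 1\<close>.\<close>

lemma coaction_coinvariant_iff:
  assumes bal: "balanced A B" and a: "a \<in> carrier A"
  shows "coaction a = AO.pureAT a \<one>\<^bsub>tring\<^esub> \<longleftrightarrow> a \<in> B"
proof
  have closed: "coaction a \<in> carrier AO.AT_pair.MN"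
    using coaction_facts(1) a by (auto simp: right_hom_def hom_def)
  have pure: "AO.pureAT a \<one>\<^bsub>tring\<^esub> \<in> carrier AO.AT_pair.MN"
    using AO.AT_pair.pure_closed'[of a "\<one>\<^bsub>tring\<^esub>"] a by (simp add: AO.pureAT_def pure_centralized one_base)
  have coord_pure: "AO.AT_pair.coord (contract_right f) (AO.pureAT a \<one>\<^bsub>tring\<^esub>) = a \<otimes> f \<one>" if f: "f \<in> End" for f
    using AO.AT_pair.coord_pure[OF contract_right_left_hom[OF f], of a "\<one>\<^bsub>tring\<^esub>"] a f
    by (simp add: AO.pureAT_def pure_centralized one_base contract_right_pure End_left_hom EndD)
  show "coaction a = AO.pureAT a \<one>\<^bsub>tring\<^esub>" if "a \<in> B"
  proof (rule AT_ext[OF closed pure])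
    fix f assume f: "f \<in> End"
    have "f a = a \<otimes> f \<one>" using EndD(2)[OF f that, of \<one>] a by simp
    then show "AO.AT_pair.coord (contract_right f) (coaction a) =
        AO.AT_pair.coord (contract_right f) (AO.pureAT a \<one>\<^bsub>tring\<^esub>)"
      using coaction_facts(7)[OF f a] coord_pure[OF f] by simp
  qed
  assume eq: "coaction a = AO.pureAT a \<one>\<^bsub>tring\<^esub>"
  have \<gamma>a: "\<gamma> j a = a \<otimes> \<gamma> j \<one>" if "j < n" for j
    using coaction_facts(7)[OF \<gamma>[OF that] a] coord_pure[OF \<gamma>[OF that]] eq by simp
  have u': "u j \<in> carrier AA" and \<gamma>1: "\<gamma> j \<one> \<in> carrier A" if "j < n" for j
    using centralizedD(1)[OF u[OF that]] EndD(3)[OF \<gamma>[OF that], of \<one>] by simp_all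
  have "\<one> \<otimes>\<^sub>B a = finprod AA (\<lambda>j. \<gamma> j a \<triangleright>\<^bsub>AA\<^esub> u j) {..<n}" using a by (rule quasibasis)
  also have "\<dots> = finprod AA (\<lambda>j. a \<triangleright>\<^bsub>AA\<^esub> (\<gamma> j \<one> \<triangleright>\<^bsub>AA\<^esub> u j)) {..<n}"
    using a u' \<gamma>1 by (intro AA.MN.finprod_cong'[OF refl]) (auto simp: \<gamma>a lact_lact)
  also have "\<dots> = a \<triangleright>\<^bsub>AA\<^esub> (\<one> \<otimes>\<^sub>B \<one>)"
    unfolding quasibasis[OF A.one_closed] using a u' \<gamma>1
    by (intro comm_group_hom_finprod[symmetric] AA.MN.comm_group_axioms AA.MN.lact_hom) auto
  also have "\<dots> = a \<otimes>\<^sub>B \<one>" using a AA.lact_pure[of a \<one> \<one>] by simp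
  finally show "a \<in> B" using bal a by (intro tensor_commute_coinvariant)
qed

text \<open>The dual basis of \<open>Tbim_expansion\<close>, read backwards through the criterion
  for summands of copies.\<close>

lemma left_fg_projective_Tbim: "left_fg_projective base ST.Tbim"
proof -
  have bimods: "bimod (carrier base) {} ST.Tbim" "bimod (carrier base) {} (regular base)"
    by (auto intro!: bimod.bimod_subset[OF bimod_tring] bimod.bimod_subset[OF bimod_regular[OF ring_base]])
  have "(\<lambda>r. r \<triangleright>\<^bsub>ST.Tbim\<^esub> u i) \<in> left_hom (carrier base) (regular base) ST.Tbim" if i: "i < n" for i
  proof -
    have *: "r \<triangleright>\<^bsub>ST.Tbim\<^esub> u i = r \<triangleright>\<^bsub>AA\<^esub> u i" "r \<triangleright>\<^bsub>ST.Tbim\<^esub> u i \<in> centralized" if "r \<in> carrier base" for r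
      using that u[OF i] by (simp_all add: tring_simps(2) sandwich_tgt sandwich_centralized tgt_centralized del: sandwich_tgt)
        (simp add: sandwich_tgt)
    have **: "r \<triangleright>\<^bsub>AA\<^esub> u i \<in> centralized" if "r \<in> carrier base" for r
      using *[OF that] by simp
    show ?thesis
      unfolding left_hom_def
    proof (intro CollectI conjI ballI homI)
      fix r r' assume r: "r \<in> carrier (regular base)" "r' \<in> carrier (regular base)"
      then have r': "r \<oplus> r' \<in> carrier base" using ST.R.add.m_closed[of r r'] by simp
      show "(r \<otimes>\<^bsub>regular base\<^esub> r') \<triangleright>\<^bsub>ST.Tbim\<^esub> u i = (r \<triangleright>\<^bsub>ST.Tbim\<^esub> u i) \<otimes>\<^bsub>ST.Tbim\<^esub> (r' \<triangleright>\<^bsub>ST.Tbim\<^esub> u i)"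
        using r r' baseD(1) u[OF i] by (simp add: * lact_add_scalar centralizedD del: ST.Tbim_simps(4))
    next
      fix l r assume r: "l \<in> carrier base" "r \<in> carrier (regular base)"
      then have r': "l \<otimes> r \<in> carrier base" using ST.R.m_closed[of l r] by simp
      show "(l \<triangleright>\<^bsub>regular base\<^esub> r) \<triangleright>\<^bsub>ST.Tbim\<^esub> u i = l \<triangleright>\<^bsub>ST.Tbim\<^esub> (r \<triangleright>\<^bsub>ST.Tbim\<^esub> u i)"
        using r r' baseD(1) u[OF i] sandwich_tgt[OF ** , of r l]
        by (simp add: tring_simps(2) sandwich_tgt lact_lact centralizedD)
    qed (simp add: *(2) del: ST.Tbim_simps(4))
  qed
  then have "\<forall>i<n. contract_right (\<gamma> i) \<in> left_hom (carrier base) ST.Tbim (regular base) \<and>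
      (\<lambda>r. r \<triangleright>\<^bsub>ST.Tbim\<^esub> u i) \<in> left_hom (carrier base) (regular base) ST.Tbim"
    using contract_right_left_hom[OF \<gamma>] by blast
  moreover have "\<forall>x\<in>carrier ST.Tbim. x = finprod ST.Tbim (\<lambda>i. contract_right (\<gamma> i) x \<triangleright>\<^bsub>ST.Tbim\<^esub> u i) {..<n}"
    using Tbim_expansion unfolding ST.Tbim_simps(1) tring_simps(1) by blast
  ultimately have "iso_to_summand (bimodule_hom (carrier base) {} ST.Tbim (copies n (regular base)))
      (sub_bimodule (carrier base) {} (copies n (regular base))) ST.Tbim (copies n (regular base))"
    unfolding summand_of_copies_iff[OF bimods] unfolding bimodule_hom_left_scalars
    by (intro exI[of _ "\<lambda>i. contract_right (\<gamma> i)"] exI[of _ "\<lambda>i r. r \<triangleright>\<^bsub>ST.Tbim\<^esub> u i"]) blast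
  then show ?thesis
    unfolding left_fg_projective_def Let_def bimodule_hom_left_scalars by blast
qed

text \<open>The Galois map preserves coordinates: along f, the image of X has coordinate
  \<open>contract_right f X\<close>. Since both sides are expanded in the same u with such
  coordinates, bijectivity follows.\<close>

lemma right_galois_extension:
  assumes bal: "balanced A B"
  shows "right_galois_extension base tring src tgt comult counit A (\<lambda>r. r) coaction B"
proof -
  interpret CA: right_comodule_algebra base tring src tgt comult counit A "\<lambda>r. r" coaction
    by (rule right_comodule_algebra)
  have coinv: "CA.coinvariants = B"
    using coaction_coinvariant_iff[OF bal] unfolding CA.coinvariants_def by blast
  \<comment> \<open>Supplies additivity of the Galois map and its values on pure tensors.\<close>
  interpret CE: coinvariant_extension base tring src tgt comult counit A "\<lambda>r. r" coaction B
    by (intro coinvariant_extension.intro right_comodule_algebra ring_extension_axioms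
        coinvariant_extension_axioms.intro coinv)
  interpret AT: bimod "carrier A" "carrier base" AO.AT
    unfolding AO.AT_def by (rule AO.AT_pair.bimod_tensor)
  let ?coord = "\<lambda>f. AO.AT_pair.coord (contract_right f)"
  note coord = AO.AT_pair.coord_pure[OF contract_right_left_hom] AO.AT_pair.coord_add[OF contract_right_left_hom]
    AO.AT_pair.coord_closed[OF contract_right_left_hom] AO.AT_pair.coord_hom[OF contract_right_left_hom]
  have coord_lact: "?coord f (a \<triangleright>\<^bsub>AO.AT\<^esub> X) = a \<otimes> ?coord f X"
    if "f \<in> End" "a \<in> carrier A" "X \<in> carrier AO.AT" for f a X
    using that(3,1,2) baseD(1) unfolding AO.AT_def
    by (induction rule: AO.AT_pair.tensor_induct)
      (simp_all add: coord AO.AT_pair.lact_pure AO.AT_pair.MN.lact_add A.m_assoc A.r_distr End_base)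
  have galois_closed: "CA.galois_map X \<in> carrier AO.AT" if "X \<in> carrier AA" for X
    using CE.galois_hom that by (auto simp: hom_def)
  \<comment> \<open>On \<open>p \<otimes> q\<close> both sides are p f(q), because the coaction of q
    has coordinate f(q).\<close>
  have coord_galois: "?coord f (CA.galois_map X) = contract_right f X" if f: "f \<in> End" and X: "X \<in> carrier AA" for f X
    using X
  proof (induction rule: AA.tensor_induct)
    case (pure p q)
    then show ?case
      using f coaction_facts(7)[OF f, of q] CE.\<delta>_closed[of q]
      by (simp add: CE.galois_pure coord_lact contract_right_pure End_left_hom)
  next
    case (add X Y)
    then show ?case
      using f galois_closed[of X] galois_closed[of Y] hom_mult[OF CE.galois_hom, of X Y]
      by (simp add: AO.AT_def coord contract_right_add End_left_hom)
  qed
  have inj: "X = Y" if X: "X \<in> carrier AA" and Y: "Y \<in> carrier AA" and eq: "CA.galois_map X = CA.galois_map Y" for X Y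
  proof -
    have "finprod AA (\<lambda>i. contract_right (\<gamma> i) X \<triangleright>\<^bsub>AA\<^esub> u i) {..<n} = finprod AA (\<lambda>i. contract_right (\<gamma> i) Y \<triangleright>\<^bsub>AA\<^esub> u i) {..<n}"
    proof (rule AA.MN.finprod_cong'[OF refl])
      show "contract_right (\<gamma> i) X \<triangleright>\<^bsub>AA\<^esub> u i = contract_right (\<gamma> i) Y \<triangleright>\<^bsub>AA\<^esub> u i" if "i \<in> {..<n}" for i
        using coord_galois[OF \<gamma> X, of i] coord_galois[OF \<gamma> Y, of i] eq that by simp
      show "(\<lambda>i. contract_right (\<gamma> i) Y \<triangleright>\<^bsub>AA\<^esub> u i) \<in> {..<n} \<rightarrow> carrier AA"
        using Y u \<gamma> by (auto simp: centralizedD End_left_hom)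
    qed
    then show ?thesis by (rule trans[OF trans[OF expansion[OF X]] expansion[OF Y, symmetric]])
  qed
  have surj: "\<exists>X\<in>carrier AA. CA.galois_map X = Z" if Z: "Z \<in> carrier AO.AT" for Z
  proof
    \<comment> \<open>The preimage has the coordinates of Z along the \<open>\<gamma> k\<close>;
      these lie in A, so they may serve as left coefficients in the tensor square.\<close>
    let ?X = "finprod AA (\<lambda>k. ?coord (\<gamma> k) Z \<triangleright>\<^bsub>AA\<^esub> u k) {..<n}"
    have Z': "Z \<in> carrier AO.AT_pair.MN" using Z by (simp add: AO.AT_def)
    have c: "?coord (\<gamma> k) Z \<in> carrier A" "u k \<in> carrier AA" "u k \<in> centralized" if "k < n" for k
      using coord(3)[OF \<gamma>[OF that] Z'] u[OF that] centralizedD(1)[OF u[OF that]] by auto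
    show X: "?X \<in> carrier AA" using c by (intro AA.MN.finprod_closed) auto
    have expZ: "Z = finprod AO.AT_pair.MN (\<lambda>k. AO.AT_pair.pure (?coord (\<gamma> k) Z) (u k)) {..<n}"
    proof (rule AO.AT_pair.coord_expansion[OF _ _ _ Z'])
      show "contract_right (\<gamma> i) \<in> left_hom (carrier base) ST.Tbim (regular base)" if "i < n" for i
        using contract_right_left_hom[OF \<gamma>[OF that]] .
    qed (use u Tbim_expansion in simp_all)
    show "CA.galois_map ?X = Z"
    proof (rule AT_ext[OF _ Z'])
      show "CA.galois_map ?X \<in> carrier AO.AT_pair.MN"
        using galois_closed[OF X] by (simp add: AO.AT_def)
      fix f assume f: "f \<in> End"
      have "?coord f (CA.galois_map ?X) = contract_right f ?X" using f X by (rule coord_galois)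
      also have "\<dots> = finprod (regular A) (\<lambda>k. contract_right f (?coord (\<gamma> k) Z \<triangleright>\<^bsub>AA\<^esub> u k)) {..<n}"
        using c f by (intro comm_group_hom_finprod AA.MN.comm_group_axioms reg.comm_group_axioms contract_right_hom End_left_hom) auto
      also have "\<dots> = finprod (regular A) (\<lambda>k. ?coord f (AO.AT_pair.pure (?coord (\<gamma> k) Z) (u k))) {..<n}"
        using c f baseD(1) by (intro reg.finprod_cong'[OF refl])
          (auto simp: contract_right_lact End_left_hom coord End_base)
      also have "\<dots> = ?coord f (finprod AO.AT_pair.MN (\<lambda>k. AO.AT_pair.pure (?coord (\<gamma> k) Z) (u k)) {..<n})"
      proof (rule comm_group_hom_finprod[symmetric, OF AO.AT_pair.MN.comm_group_axioms reg.comm_group_axioms])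
        show "?coord f \<in> hom AO.AT_pair.MN (regular A)"
          using coord(4)[OF f] by (simp add: hom_def)
        show "(\<lambda>k. AO.AT_pair.pure (?coord (\<gamma> k) Z) (u k)) \<in> {..<n} \<rightarrow> carrier AO.AT_pair.MN"
          using c by (auto intro!: AO.AT_pair.pure_closed')
      qed
      also have "\<dots> = ?coord f Z" using expZ by simp
      finally show "?coord f (CA.galois_map ?X) = ?coord f Z" .
    qed
  qed
  have "bij_betw CA.galois_map (carrier (tensor_square A B)) (carrier AO.AT)"
    unfolding tensor_square_def
  proof (rule bij_betw_imageI)
    show "inj_on CA.galois_map (carrier AA)" using inj by (rule inj_onI)
    show "CA.galois_map ` carrier AA = carrier AO.AT" using galois_closed surj by blast
  qed
  then show ?thesis
    using left_fg_projective_Tbim coinv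
    by (intro right_galois_extension.intro right_comodule_algebra right_galois_extension_axioms.intro)
qed

end

section \<open>The two implications and the equivalence\<close>

lemma depth_two_balanced_if_galois:
  assumes galois: "right_galois_extension R T s t \<Delta> \<epsilon> A \<eta> \<delta> B"
    and "subring B A" and frob: "frobenius_extension A B"
  shows "depth_two A B \<and> balanced A B"
proof -
  interpret G: right_galois_extension R T s t \<Delta> \<epsilon> A \<eta> \<delta> B by fact
  interpret galois_ring_extension R T s t \<Delta> \<epsilon> A \<eta> \<delta> B
    by (intro galois_ring_extension.intro coinvariant_extension.intro G.right_comodule_algebra_axioms
        ring_extension.intro ring_extension_axioms.intro G.A.ring_axioms assms(2)
        coinvariant_extension_axioms.intro G.coinvariants_eq
        galois_ring_extension_axioms.intro G.left_finite_projective G.galois_bij)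
  show ?thesis
    using right_depth_two left_depth_two_if_right[OF frob] balanced_if_fg_projective frob
    unfolding depth_two_def frobenius_extension_def by blast
qed

text \<open>The witnesses are the centralizer of B and the ring of centralized tensors, whence the
  types in the statement.\<close>

lemma galois_if_depth_two_balanced:
  fixes A :: "('a, 'x) ring_scheme"
  assumes "ring A" "subring B A" "right_depth_two A B" "balanced A B"
  shows "\<exists>(R :: 'a ring) (T :: ('a, 'a) tensor ring) s t \<Delta> \<epsilon> \<eta> \<delta>.
    right_galois_extension R T s t \<Delta> \<epsilon> A \<eta> \<delta> B"
proof -
  interpret E: ring_extension A B
    using assms by (intro ring_extension.intro ring_extension_axioms.intro)
  obtain n :: nat and \<gamma> u where "\<forall>i<n. \<gamma> i \<in> E.End \<and> u i \<in> E.centralized"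
    "\<forall>a\<in>carrier A. pure_tensor B (regular A) (regular A) \<one>\<^bsub>A\<^esub> a = finprod E.AA (\<lambda>i. \<gamma> i a \<triangleright>\<^bsub>E.AA\<^esub> u i) {..<n}"
    using assms(3) unfolding E.right_depth_two_iff by blast
  then have "right_d2 A B n \<gamma> u"
    by (intro right_d2.intro right_d2_axioms.intro E.ring_extension_axioms) blast+
  from right_d2.right_galois_extension[OF this assms(4)] show ?thesis by blast
qed

text \<open>A formula cannot quantify over types, so existence is asserted at the types produced by
  the construction, while the second conjunct states the other implication for a base ring and a
  bialgebroid of arbitrary types.\<close>

theorem theorem3p1:
  fixes A :: "('a, 'x) ring_scheme" and B :: "'a set"
  assumes "ring A" and "subring B A"
    and "frobenius_extension A B"
  shows
    "((\<exists>(R :: 'a ring) (T :: ('a, 'a) tensor ring) s t \<Delta> \<epsilon> \<eta> \<delta>.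
          right_galois_extension R T s t \<Delta> \<epsilon> A \<eta> \<delta> B)
        \<longleftrightarrow> depth_two A B \<and> balanced A B) \<and>
     ((\<exists>(R :: 'r ring) (T :: 't ring) s t \<Delta> \<epsilon> \<eta> \<delta>.
          right_galois_extension R T s t \<Delta> \<epsilon> A \<eta> \<delta> B)
        \<longrightarrow> depth_two A B \<and> balanced A B)"
  using assms depth_two_balanced_if_galois galois_if_depth_two_balanced
  unfolding depth_two_def by metis

end
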